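(* Let $n\ge 1$ and $m\geq 2$ be integers, let $\vec{q_i}=(q_{i1},\dots,q_{in})$ with $1<q_{ij}<\infty$ for all $i=1,\dots,m$, $j=1,\dots,n$, and define $\vec{q}=(q_1,\dots,q_n)$ by $\frac{1}{q_j}=\sum_{i=1}^m\frac{1}{q_{ij}}$ for $j=1,\dots,n$. Let $\varphi,\varphi_1,\dots,\varphi_m:\mathbb{R}^n\times(0,\infty)\to(0,\infty)$ be Lebesgue measurable functions for which there is a constant $C_0>0$ such that $$\prod_{i=1}^m\int_r^\infty\frac{\varphi_i(x,t)}{t}\,dt\le C_0\,\varphi(x,r)\qquad\text{for all }x\in\mathbb{R}^n,\ r>0.$$ Then the multi-sublinear maximal operator $M_m$ is bounded from $M^{\varphi_1}_{\vec{q_1}}(\mathbb{R}^n)\times\cdots\times M^{\varphi_m}_{\vec{q_m}}(\mathbb{R}^n)$ to $M^{\varphi}_{\vec{q}}(\mathbb{R}^n)$; that is, there is $C>0$ such that $\|M_m(\vec f)\|_{M^{\varphi}_{\vec q}}\le C\prod_{i=1}^m\|f_i\|_{M^{\varphi_i}_{\vec{q_i}}}$ for all $f_i\in M^{\varphi_i}_{\vec{q_i}}(\mathbb{R}^n)$.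
   Context: Mixed Lebesgue norm: for $\vec p=(p_1,\dots,p_n)\in(0,\infty)^n$ and measurable $f:\mathbb{R}^n\to\mathbb{C}$, $$\|f\|_{L^{\vec p}}=\left(\int_{\mathbb R}\cdots\left(\int_{\mathbb R}\left(\int_{\mathbb R}|f(x_1,\dots,x_n)|^{p_1}dx_1\right)^{p_2/p_1}dx_2\right)^{p_3/p_2}\cdots dx_n\right)^{1/p_n}.$$ Generalized mixed Morrey spaces: for a measurable $\varphi:\mathbb R^n\times(0,\infty)\to(0,\infty)$, $M^{\varphi}_{\vec q}(\mathbb R^n)$ is the set of measurable $f$ with $$\|f\|_{M^{\varphi}_{\vec q}}=\sup_{x\in\mathbb R^n,\,r>0}\varphi(x,r)^{-1}\|\chi_{B(x,r)}\|_{L^{\vec q}}^{-1}\|f\chi_{B(x,r)}\|_{L^{\vec q}}<\infty,$$ where $B(x,r)$ is the open ball with center $x$ and radius $r$. The same expression is used when some components of $\vec q$ are less than $1$ (it is then a quasi-norm). Multi-sublinear maximal operator: for $\vec f=(f_1,\dots,f_m)$ with each $f_i\in L^1_{\rm loc}(\mathbb R^n)$, $$M_m(\vec f)(x)=\sup_{r>0}\prod_{i=1}^m\frac{1}{|B(x,r)|}\int_{B(x,r)}|f_i(y_i)|\,dy_i .$$ *)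

theory Defs
  imports "HOL-Analysis.Analysis"
begin

text \<open>
  Points of \<open>R^n\<close> are vectors of type \<open>real ^ 'n\<close>, where the finite index type \<open>'n\<close> carries a
  linear order: its elements in increasing order play the role of the coordinates \<open>1, \<dots>, n\<close>.
  The order matters, since mixed norms depend on the order of integration.

  Norms are defined on \<open>[0, \<infinity>]\<close>-valued functions and applied to the modulus of a complex
  function; this also covers maximal functions, which may be infinite at some points.
\<close>

text \<open>
  Only used for \<open>a > 0\<close>, where \<open>0\<close> and \<open>\<infinity>\<close> are fixed.
\<close>
definition ennreal_powr :: "ennreal \<Rightarrow> real \<Rightarrow> ennreal" where
  "ennreal_powr u a = (if u = \<infinity> then \<infinity> else ennreal (enn2real u powr a))"

text \<open>
  With \<open>js = [j\<^sub>1, \<dots>, j\<^sub>k]\<close> the coordinates still to be integrated out, innermost first, and \<open>a\<close> the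
  exponent of the preceding integration (\<open>1\<close> initially), each step raises the integrand to the
  power \<open>p\<^sub>j / a\<close> and integrates in \<open>x\<^sub>j\<close>. Once no coordinate is left, the function is constant and
  can be evaluated at \<open>0\<close>.
\<close>
fun iterated_norm ::
    "real ^ 'n \<Rightarrow> real \<Rightarrow> 'n list \<Rightarrow> (real ^ 'n \<Rightarrow> ennreal) \<Rightarrow> ennreal" where
  "iterated_norm p a [] F = ennreal_powr (F 0) (1 / a)"
| "iterated_norm p a (j # js) F =
     iterated_norm p (p $ j) js
       (\<lambda>x. \<integral>\<^sup>+ t. ennreal_powr (F (\<chi> k. if k = j then t else x $ k)) (p $ j / a) \<partial>lebesgue)"

definition mixed_norm ::
    "real ^ 'n::{finite,linorder} \<Rightarrow> (real ^ 'n::{finite,linorder} \<Rightarrow> ennreal) \<Rightarrow> ennreal" where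
  "mixed_norm p F = iterated_norm p 1 (sorted_list_of_set UNIV) F"

text \<open>
  A weight is a curried function \<open>\<phi> x r\<close>, of which only the values for \<open>r > 0\<close> are used.
\<close>
definition morrey_norm ::
    "(real ^ 'n::{finite,linorder} \<Rightarrow> real \<Rightarrow> real) \<Rightarrow> real ^ 'n::{finite,linorder} \<Rightarrow>
      (real ^ 'n::{finite,linorder} \<Rightarrow> ennreal) \<Rightarrow> ennreal"
  where
  "morrey_norm \<phi> q F =
     (SUP x. SUP r\<in>{0<..}.
        inverse (ennreal (\<phi> x r)) * inverse (mixed_norm q (indicator (ball x r)))
          * mixed_norm q (\<lambda>y. F y * indicator (ball x r) y))"

definition morrey_space ::
    "(real ^ 'n::{finite,linorder} \<Rightarrow> real \<Rightarrow> real) \<Rightarrow> real ^ 'n::{finite,linorder} \<Rightarrow>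
      (real ^ 'n::{finite,linorder} \<Rightarrow> complex) set" where
  "morrey_space \<phi> q =
     {f. f \<in> borel_measurable lebesgue \<and> morrey_norm \<phi> q (\<lambda>x. ennreal (cmod (f x))) < \<infinity>}"

definition morrey_weight :: "(real ^ 'n \<Rightarrow> real \<Rightarrow> real) \<Rightarrow> bool" where
  "morrey_weight \<phi> \<longleftrightarrow>
     (\<lambda>(x, r). \<phi> x r) \<in> borel_measurable (lebesgue_on (UNIV \<times> {0<..})) \<and>
     (\<forall>x. \<forall>r>0. \<phi> x r > 0)"

definition multi_maximal ::
    "nat \<Rightarrow> (nat \<Rightarrow> real ^ 'n \<Rightarrow> complex) \<Rightarrow> real ^ 'n \<Rightarrow> ennreal" where
  "multi_maximal m f x =
     (SUP r\<in>{0<..}. \<Prod>i\<in>{1..m}.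
        (\<integral>\<^sup>+ y\<in>ball x r. ennreal (cmod (f i y)) \<partial>lebesgue) / emeasure lebesgue (ball x r))"

end

theory Submission
  imports Defs
begin

text \<open>
  Averages over balls are bounded by the composition of the one-dimensional maximal functions in the
  coordinates, so mixed norm inequalities reduce to a single coordinate \<open>j\<close>. There, the
  inequality is propagated through the inner norms as a weighted inequality in \<open>x\<^sub>j\<close> for all
  \<open>A\<^sub>p\<close> weights: integrating it with exponent \<open>p\<^sub>k\<close> in another coordinate \<open>x\<^sub>k\<close> is Fubini's theorem,
  and extrapolation changes the exponent from \<open>p\<^sub>k\<close> to that of the next coordinate.

  For the Morrey norm fix a ball \<open>B(x, r)\<close>. Averages of \<open>f\<^sub>i\<close> over balls with center in \<open>B(x, r)\<close> and
  radius at most \<open>r\<close> only see \<open>f\<^sub>i\<close> on \<open>B(x, 2r)\<close>, where the mixed norm inequality applies; those of radius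
  \<open>t > r\<close> are controlled through Hoelder's inequality by the norm of \<open>f\<^sub>i\<close> on \<open>B(x, 2t)\<close>. Both give a bound
  in terms of the integral of \<open>\<phi>\<^sub>i(x, t) / t\<close>, and the Hoelder inequality for mixed norms multiplies the
  bounds for \<open>i = 1, \<dots>, m\<close>.
\<close>

subsection \<open>Real powers and the Hoelder inequality\<close>

text \<open>The obstacle is that a coordinate maximal function does not commute with the norms taken
  in the coordinates before \<open>j\<close>; only the norms after \<open>j\<close> preserve the
  inequality by mere monotonicity. A bound for a single weight cannot be moved to another exponent,
  whereas a bound for every weight, with a constant that sees only its A_p constant, can. Dependence
  on that constant is therefore tracked throughout.

  The components of \<open>q\<close> may lie below 1, so the target has no triangle inequality with
  constant 1. The near and far contributions are added for each \<open>f i\<close> separately, in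
  the norm \<open>qs i\<close> whose components exceed 1, giving one majorant valid for all radii at
  once; the supremum over radii then passes through the product.

  The functions are only Lebesgue measurable, and slices of such functions need not be measurable.
  Estimates are proved for Borel functions, and Borel representatives are substituted at the end,
  which requires that nested norms ignore null sets of the whole space.\<close>

lemma ennreal_powr_ennreal: "0 \<le> x \<Longrightarrow> ennreal_powr (ennreal x) a = ennreal (x powr a)"
  by (simp add: ennreal_powr_def)

lemma ennreal_powr_top [simp]: "ennreal_powr \<infinity> a = \<infinity>" "ennreal_powr top a = top"
  by (simp_all add: ennreal_powr_def)

lemma ennreal_powr_0 [simp]: "ennreal_powr 0 a = 0"
  by (simp add: ennreal_powr_def)

lemma ennreal_powr_1 [simp]: "ennreal_powr u 1 = u"
  by (cases u) (auto simp: ennreal_powr_ennreal)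

lemma ennreal_1_powr [simp]: "ennreal_powr 1 a = 1"
  using ennreal_powr_ennreal[of 1 a] by simp

text \<open>No sign condition on the exponents: real \<open>powr\<close> sends \<open>0\<close> to
  \<open>0\<close> for every exponent, and \<open>ennreal_powr\<close> fixes
  \<open>\<infinity>\<close>.\<close>

lemma ennreal_powr_powr: "ennreal_powr (ennreal_powr u a) b = ennreal_powr u (a * b)"
  by (cases u) (auto simp: ennreal_powr_ennreal powr_powr)

lemma ennreal_powr_mult: "a > 0 \<Longrightarrow> ennreal_powr (u * v) a = ennreal_powr u a * ennreal_powr v a"
  by (cases u; cases v)
     (auto simp: ennreal_powr_ennreal powr_mult ennreal_top_mult ennreal_mult_top
       simp flip: ennreal_mult)

lemma ennreal_powr_add: "ennreal_powr u (a + b) = ennreal_powr u a * ennreal_powr u b"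
  by (cases u) (auto simp: ennreal_powr_ennreal powr_add simp flip: ennreal_mult)

lemma ennreal_powr_mono: "0 \<le> a \<Longrightarrow> u \<le> v \<Longrightarrow> ennreal_powr u a \<le> ennreal_powr v a"
  by (cases u; cases v) (auto simp: ennreal_powr_ennreal powr_mono2 top_unique)

lemma ennreal_powr_le_iff:
  assumes "a > 0" shows "ennreal_powr u a \<le> v \<longleftrightarrow> u \<le> ennreal_powr v (1 / a)"
  using assms ennreal_powr_mono[of a u "ennreal_powr v (1 / a)"]
    ennreal_powr_mono[of "1 / a" "ennreal_powr u a" v]
  by (auto simp: ennreal_powr_powr)

lemma ennreal_powr_eq_0_iff [simp]: "ennreal_powr u a = 0 \<longleftrightarrow> u = 0"
  by (cases u) (auto simp: ennreal_powr_ennreal)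

lemma ennreal_powr_eq_top_iff [simp]: "ennreal_powr u a = top \<longleftrightarrow> u = top"
  by (cases u) (auto simp: ennreal_powr_ennreal)

lemma ennreal_powr_less_top_iff [simp]: "ennreal_powr u a < top \<longleftrightarrow> u < top"
  by (metis ennreal_powr_eq_top_iff less_top)

text \<open>For \<open>a > 0\<close> the power is an order isomorphism with inverse exponent
  \<open>1 / a\<close>; \<open>ennreal_powr_le_iff\<close> is the adjunction that moves suprema
  across it.\<close>

lemma ennreal_powr_SUP:
  assumes "a > 0"
  shows "ennreal_powr (SUP i\<in>I. f i) a = (SUP i\<in>I. ennreal_powr (f i) a)"
proof (rule antisym)
  show "ennreal_powr (SUP i\<in>I. f i) a \<le> (SUP i\<in>I. ennreal_powr (f i) a)"
    unfolding ennreal_powr_le_iff[OF assms]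
  proof (rule SUP_least)
    fix i assume "i \<in> I"
    then show "f i \<le> ennreal_powr (SUP i\<in>I. ennreal_powr (f i) a) (1 / a)"
      unfolding ennreal_powr_le_iff[OF assms, symmetric] by (rule SUP_upper)
  qed
  show "(SUP i\<in>I. ennreal_powr (f i) a) \<le> ennreal_powr (SUP i\<in>I. f i) a"
    using assms by (intro SUP_least ennreal_powr_mono SUP_upper) auto
qed

lemma ennreal_powr_prod:
  "a > 0 \<Longrightarrow> ennreal_powr (\<Prod>i\<in>I. f i) a = (\<Prod>i\<in>I. ennreal_powr (f i) a)"
  by (induction I rule: infinite_finite_induct) (auto simp: ennreal_powr_mult)

text \<open>Comparison with twice the maximum involves no convexity, so the bound serves exponents
  above and below \<open>1\<close>; both occur in \<open>coord_norm_add_le\<close>.\<close>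

lemma ennreal_powr_add_le:
  assumes "a > 0"
  shows "ennreal_powr (u + v) a \<le> ennreal (2 powr a) * (ennreal_powr u a + ennreal_powr v a)"
proof -
  have "u + v \<le> 2 * max u v"
    by (metis add_mono max.cobounded1 max.cobounded2 mult_2)
  then have "ennreal_powr (u + v) a \<le> ennreal_powr (2 * max u v) a"
    using assms by (intro ennreal_powr_mono) auto
  also have "\<dots> = ennreal (2 powr a) * ennreal_powr (max u v) a"
    using assms ennreal_powr_ennreal[of 2 a] by (simp add: ennreal_powr_mult)
  also have "\<dots> \<le> ennreal (2 powr a) * (ennreal_powr u a + ennreal_powr v a)"
    by (intro mult_left_mono) (auto simp: max_def)
  finally show ?thesis .
qed

lemma measurable_ennreal_powr [measurable (raw)]:
  assumes [measurable]: "f \<in> borel_measurable M"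
  shows "(\<lambda>x. ennreal_powr (f x) a) \<in> borel_measurable M"
  unfolding ennreal_powr_def by measurable

lemma ennreal_Young:
  assumes "a > 0" "b > 0" "a + b = 1"
  shows "ennreal_powr u a * ennreal_powr v b \<le> ennreal a * u + ennreal b * v"
proof (cases u; cases v)
  fix x y assume xy: "0 \<le> x" "u = ennreal x" "0 \<le> y" "v = ennreal y"
  have "x powr a * y powr b \<le> a * x + b * y"
    using Youngs_inequality_0[of a b x y] assms xy by (cases "x = 0 \<or> y = 0") auto
  then show ?thesis using xy assms
    by (simp add: ennreal_powr_ennreal flip: ennreal_mult ennreal_plus)
qed (use assms in \<open>auto simp: ennreal_mult_top\<close>)

text \<open>Powers \<open>a\<close> and \<open>b\<close> with sum \<open>1\<close> spare the
  conversion of conjugate exponents. Young's inequality is applied after both integrals are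
  normalized to \<open>1\<close>, so integrals equal to \<open>0\<close> or
  \<open>\<infinity>\<close> are treated apart.\<close>

lemma nn_integral_Holder:
  assumes ab: "a > 0" "b > 0" "a + b = 1"
    and [measurable]: "f \<in> borel_measurable M" "g \<in> borel_measurable M"
  shows "(\<integral>\<^sup>+x. ennreal_powr (f x) a * ennreal_powr (g x) b \<partial>M)
    \<le> ennreal_powr (\<integral>\<^sup>+x. f x \<partial>M) a * ennreal_powr (\<integral>\<^sup>+x. g x \<partial>M) b" (is "?L \<le> ?R")
proof -
  let ?A = "\<integral>\<^sup>+x. f x \<partial>M" and ?B = "\<integral>\<^sup>+x. g x \<partial>M"
  \<comment> \<open>A vanishing integral kills the integrand almost everywhere, which also settles
    the product of \<open>0\<close> and \<open>\<infinity>\<close> on the right.\<close>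
  have zero: "?L = 0" if "?A = 0 \<or> ?B = 0"
  proof -
    have "AE x in M. f x = 0 \<or> g x = 0"
      using that by (auto simp: nn_integral_0_iff_AE)
    then show ?thesis
      by (subst nn_integral_0_iff_AE) auto
  qed
  consider "?A = 0 \<or> ?B = 0" | "?A \<noteq> 0" "?B \<noteq> 0" "?A = top \<or> ?B = top"
    | "?A \<noteq> 0" "?B \<noteq> 0" "?A \<noteq> top" "?B \<noteq> top" by blast
  then show ?thesis
  proof cases
    case 3
    let ?c = "ennreal_powr ?A a * ennreal_powr ?B b"
    have "?L = (\<integral>\<^sup>+x. ?c * (ennreal_powr (f x / ?A) a * ennreal_powr (g x / ?B) b) \<partial>M)"
    proof (rule nn_integral_cong)
      fix x
      have "f x = ?A * (f x / ?A)" "g x = ?B * (g x / ?B)"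
        using 3 by (simp_all add: ennreal_times_divide mult_divide_eq_ennreal mult.commute)
      then have "ennreal_powr (f x) a = ennreal_powr ?A a * ennreal_powr (f x / ?A) a"
        "ennreal_powr (g x) b = ennreal_powr ?B b * ennreal_powr (g x / ?B) b"
        using ab by (metis ennreal_powr_mult)+
      then show "ennreal_powr (f x) a * ennreal_powr (g x) b
        = ?c * (ennreal_powr (f x / ?A) a * ennreal_powr (g x / ?B) b)"
        by (simp add: mult_ac)
    qed
    also have "\<dots> \<le> (\<integral>\<^sup>+x. ?c * (ennreal a * (f x / ?A) + ennreal b * (g x / ?B)) \<partial>M)"
      by (intro nn_integral_mono mult_left_mono ennreal_Young ab) auto
    also have "\<dots> = ?c * (ennreal a * (?A / ?A) + ennreal b * (?B / ?B))"
      by (simp add: nn_integral_cmult nn_integral_add nn_integral_divide)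
    also have "\<dots> = ?c"
      using 3 ab by (simp add: less_top ennreal_divide_self flip: ennreal_plus)
    finally show ?thesis .
  qed (use zero in \<open>auto simp: ennreal_mult_top ennreal_top_mult\<close>)
qed

text \<open>One factor is split off; dividing the remaining exponents by their sum \<open>s\<close>
  makes them add up to \<open>1\<close> again, which is why \<open>l\<close> varies in the
  induction.\<close>

lemma nn_integral_Holder_prod:
  assumes "finite I" "I \<noteq> {}" "\<And>i. i \<in> I \<Longrightarrow> l i > 0" "(\<Sum>i\<in>I. l i) = (1::real)"
    and "\<And>i. i \<in> I \<Longrightarrow> f i \<in> borel_measurable M"
  shows "(\<integral>\<^sup>+x. (\<Prod>i\<in>I. ennreal_powr (f i x) (l i)) \<partial>M)
    \<le> (\<Prod>i\<in>I. ennreal_powr (\<integral>\<^sup>+x. f i x \<partial>M) (l i))"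
  using assms
proof (induction I arbitrary: l rule: finite_ne_induct)
  case (singleton i)
  then show ?case by simp
next
  case (insert k J)
  define s where "s = sum l J"
  have s: "s > 0" "l k + s = 1"
    using insert unfolding s_def by (auto intro!: sum_pos)
  have lk: "l k > 0" using insert by auto
  have [measurable]: "f i \<in> borel_measurable M" if "i \<in> insert k J" for i
    using insert that by auto
  have J: "(\<Prod>i\<in>J. ennreal_powr (g i) (l i)) = ennreal_powr (\<Prod>i\<in>J. ennreal_powr (g i) (l i / s)) s"
    for g :: "_ \<Rightarrow> ennreal"
    using s by (simp add: ennreal_powr_prod ennreal_powr_powr)
  have "(\<integral>\<^sup>+x. (\<Prod>i\<in>insert k J. ennreal_powr (f i x) (l i)) \<partial>M)
    = (\<integral>\<^sup>+x. ennreal_powr (f k x) (l k) * ennreal_powr (\<Prod>i\<in>J. ennreal_powr (f i x) (l i / s)) s \<partial>M)"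
    using insert.hyps by (simp add: J)
  also have "\<dots> \<le> ennreal_powr (\<integral>\<^sup>+x. f k x \<partial>M) (l k) *
     ennreal_powr (\<integral>\<^sup>+x. (\<Prod>i\<in>J. ennreal_powr (f i x) (l i / s)) \<partial>M) s"
    using s lk insert.hyps by (intro nn_integral_Holder borel_measurable_prod) auto
  also have "\<dots> \<le> ennreal_powr (\<integral>\<^sup>+x. f k x \<partial>M) (l k) *
     ennreal_powr (\<Prod>i\<in>J. ennreal_powr (\<integral>\<^sup>+x. f i x \<partial>M) (l i / s)) s"
    using s insert.prems
    by (intro mult_left_mono ennreal_powr_mono insert.IH) (auto simp: s_def simp flip: sum_divide_distrib)
  also have "\<dots> = (\<Prod>i\<in>insert k J. ennreal_powr (\<integral>\<^sup>+x. f i x \<partial>M) (l i))"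
    using insert.hyps by (simp add: J)
  finally show ?case .
qed

text \<open>Hoelder's inequality for the probability measure on the naturals with masses
  \<open>(1/2) ^ Suc k\<close>. It replaces Minkowski's inequality for the series in
  \<open>rubio_de_francia\<close>: powers with exponent \<open>p\<close> can then be integrated term
  by term.\<close>

lemma ennreal_powr_suminf_le:
  assumes p: "p > 1"
  shows "ennreal_powr (\<Sum>k. ennreal ((1/2) ^ k) * c k) p \<le> ennreal (2 powr p) * (\<Sum>k. ennreal ((1/2) ^ Suc k) * ennreal_powr (c k) p)"
proof -
  let ?M = "density (count_space (UNIV :: nat set)) (\<lambda>k. ennreal ((1/2) ^ Suc k))"
  have int: "(\<integral>\<^sup>+k. g k \<partial>?M) = (\<Sum>k. ennreal ((1/2) ^ Suc k) * g k)" for g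
    by (subst nn_integral_density) (simp_all add: nn_integral_count_space_nat del: power_Suc)
  have "(\<Sum>k. ennreal ((1/2) ^ Suc k)) = ennreal 1"
    by (rule suminf_ennreal_eq[OF _ power_half_series]) (rule zero_le_power, simp)
  then have one: "(\<Sum>k. ennreal ((1/2) ^ Suc k)) = 1"
    by (simp only: ennreal_1)
  have "(\<Sum>k. ennreal ((1/2) ^ k) * c k) = 2 * (\<Sum>k. ennreal ((1/2) ^ Suc k) * c k)"
  proof -
    have "ennreal ((1/2) ^ k) * c k = 2 * (ennreal ((1/2) ^ Suc k) * c k)" for k
      by (simp add: numeral_mult_ennreal flip: mult.assoc)
    then have "(\<Sum>k. ennreal ((1/2) ^ k) * c k) = (\<Sum>k. 2 * (ennreal ((1/2) ^ Suc k) * c k))"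
      by (rule suminf_cong)
    then show ?thesis
      by (simp only: ennreal_suminf_cmult)
  qed
  also have "(\<Sum>k. ennreal ((1/2) ^ Suc k) * c k) = (\<integral>\<^sup>+k. ennreal_powr (ennreal_powr (c k) p) (1/p) * ennreal_powr 1 (1 - 1/p) \<partial>?M)"
    using p by (simp add: int[of c] ennreal_powr_powr del: power_Suc)
  also have "\<dots> \<le> ennreal_powr (\<integral>\<^sup>+k. ennreal_powr (c k) p \<partial>?M) (1/p) * ennreal_powr (\<integral>\<^sup>+k. 1 \<partial>?M) (1 - 1/p)"
    using p by (intro nn_integral_Holder) auto
  also have "(\<integral>\<^sup>+k. 1 \<partial>?M) = 1"
    unfolding int mult_1_right by (rule one)
  finally have le: "(\<Sum>k. ennreal ((1/2) ^ k) * c k) \<le> 2 * ennreal_powr (\<integral>\<^sup>+k. ennreal_powr (c k) p \<partial>?M) (1/p)"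
    by (simp add: mult_left_mono)
  have "ennreal_powr (\<Sum>k. ennreal ((1/2) ^ k) * c k) p
      \<le> ennreal_powr (2 * ennreal_powr (\<integral>\<^sup>+k. ennreal_powr (c k) p \<partial>?M) (1/p)) p"
    using p le by (intro ennreal_powr_mono) auto
  also have "\<dots> = ennreal (2 powr p) * (\<integral>\<^sup>+k. ennreal_powr (c k) p \<partial>?M)"
    using p ennreal_powr_ennreal[of 2 p] by (simp add: ennreal_powr_mult ennreal_powr_powr)
  finally show ?thesis
    by (simp only: int)
qed

subsection \<open>Weighted maximal functions on the line\<close>

text \<open>Dividing by \<open>Y\<close> to the power \<open>1 - 1 / p\<close> is legitimate only
  for finite \<open>Y\<close>; for this reason later estimates first treat finite families of
  intervals or truncated functions.\<close>

lemma ennreal_powr_absorb: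
  assumes p: "p > 0" and Y: "Y < top" "Y \<le> C * ennreal_powr Y (1 - 1 / p)"
  shows "Y \<le> ennreal_powr C p"
proof (cases "Y = 0")
  case False
  let ?B = "ennreal_powr Y (1 - 1 / p)"
  have "?B * ennreal_powr Y (1 / p) \<le> ?B * C"
    using Y(2) by (simp add: mult_ac flip: ennreal_powr_add)
  moreover have "?B \<noteq> 0" "?B \<noteq> top" using False Y(1) by auto
  ultimately have "ennreal_powr Y (1 / p) \<le> C"
    by (simp add: ennreal_mult_le_mult_iff)
  then show ?thesis
    using p by (subst (asm) ennreal_powr_le_iff) auto
qed simp

text \<open>Countability makes suprema over these intervals measurable and lets finite subfamilies
  exhaust them, while every ball on the line lies in one of comparable length.\<close>

definition rat_intervals :: "real set set" where
  "rat_intervals = {{a<..<b} | a b. a \<in> \<rat> \<and> b \<in> \<rat> \<and> a < b}"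

text \<open>The uncentred maximal function. \<open>M\<close> is arbitrary because weighted measures
  occur, and \<open>S\<close> is a parameter so that finite families can approximate.\<close>

definition interval_maximal :: "real set set \<Rightarrow> real measure \<Rightarrow> (real \<Rightarrow> ennreal) \<Rightarrow> real \<Rightarrow> ennreal" where
  "interval_maximal S M h t =
     (SUP I\<in>S. (\<integral>\<^sup>+x\<in>I. h x \<partial>M) / emeasure M I * indicator I t)"

lemma countable_rat_intervals: "countable rat_intervals"
proof -
  have "rat_intervals \<subseteq> (\<lambda>(a, b). {a<..<b}) ` (\<rat> \<times> \<rat>)"
    unfolding rat_intervals_def by auto
  then show ?thesis
    by (rule countable_subset) (intro countable_image countable_SIGMA countable_rat)
qed

lemma rat_intervals_borel: "I \<in> rat_intervals \<Longrightarrow> I \<in> sets borel"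
  unfolding rat_intervals_def by auto

text \<open>A subfamily that is minimal among those with the same union covers no point three times:
  of three intervals with a common point, the one reaching furthest to the left and the one
  reaching furthest to the right cover the third.\<close>
lemma interval_covering:
  assumes "finite S" "S \<subseteq> rat_intervals"
  obtains T where "T \<subseteq> S" "\<Union>T = \<Union>S" "\<And>t. card {I\<in>T. t \<in> I} \<le> 2"
proof -
  define P where "P T \<longleftrightarrow> T \<subseteq> S \<and> \<Union>T = \<Union>S" for T
  have "P S" by (simp add: P_def)
  then obtain T where T: "P T" "\<And>T'. P T' \<Longrightarrow> card T \<le> card T'"
    using exists_least_iff[of "\<lambda>n. \<exists>T. P T \<and> card T = n"] by (metis not_less)
  have finT: "finite T" using T(1) assms finite_subset unfolding P_def by auto
  have "card {I\<in>T. t \<in> I} \<le> 2" for t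
  proof (rule ccontr)
    assume card: "\<not> card {I\<in>T. t \<in> I} \<le> 2"
    define Q where "Q = {I\<in>T. t \<in> I}"
    have Q: "finite Q" "Q \<subseteq> T" using finT by (auto simp: Q_def)
    have "Q \<noteq> {}" using card unfolding Q_def[symmetric] by auto
    have "Min (Inf ` Q) \<in> Inf ` Q" "Max (Sup ` Q) \<in> Sup ` Q"
      using Q(1) \<open>Q \<noteq> {}\<close> by (auto intro!: Min_in Max_in)
    then obtain I1 I2 where I12: "I1 \<in> Q" "Inf I1 = Min (Inf ` Q)" "I2 \<in> Q" "Sup I2 = Max (Sup ` Q)"
      by (auto elim!: imageE)
    have I1: "Inf I1 \<le> Inf I" and I2: "Sup I \<le> Sup I2" if "I \<in> Q" for I
      using Q(1) I12 that by auto
    have "\<not> Q \<subseteq> {I1, I2}"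
      using card card_mono[of "{I1, I2}" Q] unfolding Q_def[symmetric]
      by (auto simp: card_insert_if split: if_splits)
    then obtain I3 where I3: "I3 \<in> Q" "I3 \<noteq> I1" "I3 \<noteq> I2"
      by auto
    have "I1 \<in> rat_intervals" "I2 \<in> rat_intervals" "I3 \<in> rat_intervals"
      using I12 I3 Q T(1) assms by (auto simp: P_def)
    then obtain a1 b1 a2 b2 a3 b3 where ab: "I1 = {a1<..<b1}" "I2 = {a2<..<b2}" "I3 = {a3<..<b3}"
      "a1 < b1" "a2 < b2" "a3 < b3"
      unfolding rat_intervals_def by blast
    have "a1 \<le> a3" "b3 \<le> b2"
      using I1[OF I3(1)] I2[OF I3(1)] ab by auto
    moreover have "t \<in> I1" "t \<in> I2" using I12 by (auto simp: Q_def)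
    ultimately have "I3 \<subseteq> I1 \<union> I2" using ab by auto
    then have "\<Union>(T - {I3}) = \<Union>T"
      using I12 I3 Q(2) by blast
    then have "P (T - {I3})" using T(1) by (auto simp: P_def)
    then have "card T \<le> card (T - {I3})" by (rule T(2))
    then show False
      using I3(1) Q(2) finT by (metis card_Diff1_less not_less subsetD)
  qed
  then show ?thesis using that T(1) unfolding P_def by blast
qed

lemma interval_maximal_greater_eq:
  assumes "S \<subseteq> rat_intervals"
  shows "{t. l < interval_maximal S M h t} = \<Union>{I\<in>S. l < (\<integral>\<^sup>+x\<in>I. h x \<partial>M) / emeasure M I}"
  unfolding interval_maximal_def less_SUP_iff by (auto simp: indicator_def split: if_splits) 

lemma interval_maximal_measurable [measurable]:
  assumes "S \<subseteq> rat_intervals"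
  shows "interval_maximal S M h \<in> borel_measurable borel"
proof -
  have "countable S" using assms countable_rat_intervals countable_subset by blast
  moreover have "I \<in> sets borel" if "I \<in> S" for I
    using that assms rat_intervals_borel by auto
  ultimately show ?thesis
    unfolding interval_maximal_def[abs_def] by (intro borel_measurable_SUP) auto
qed

text \<open>Overlap at most two takes the place of a doubling condition, so the constant
  \<open>2\<close> is the same for every measure. As the selected intervals lie inside the level
  set, \<open>h\<close> is integrated over that set only.\<close>

lemma interval_maximal_weak_type:
  assumes S: "finite S" "S \<subseteq> rat_intervals"
    and sets [measurable_cong]: "sets M = sets borel" and [measurable]: "h \<in> borel_measurable borel"
  shows "l * emeasure M {t. l < interval_maximal S M h t}
    \<le> 2 * (\<integral>\<^sup>+t\<in>{t. l < interval_maximal S M h t}. h t \<partial>M)"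
proof -
  define S' where "S' = {I\<in>S. l < (\<integral>\<^sup>+x\<in>I. h x \<partial>M) / emeasure M I}"
  have S': "finite S'" "S' \<subseteq> rat_intervals"
    using S by (auto simp: S'_def)
  obtain T where T: "T \<subseteq> S'" "\<Union>T = \<Union>S'" "\<And>t. card {I\<in>T. t \<in> I} \<le> 2"
    using interval_covering[OF S'] by blast
  have eq: "{t. l < interval_maximal S M h t} = \<Union>T"
    unfolding interval_maximal_greater_eq[OF S(2)] T(2) S'_def ..
  have finT: "finite T" using T(1) S(1) S'(1) finite_subset by auto
  have [measurable]: "I \<in> sets borel" if "I \<in> T" for I
    using that T(1) S(2) rat_intervals_borel unfolding S'_def by auto
  have [measurable]: "\<Union>T \<in> sets borel"
    using finT by (intro sets.finite_Union) auto
  \<comment> \<open>An interval of infinite measure has average \<open>0\<close>, which cannot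
    exceed \<open>l\<close>, so it does not belong to \<open>S'\<close>.\<close>
  have le: "l * emeasure M I \<le> (\<integral>\<^sup>+x\<in>I. h x \<partial>M)" if "I \<in> T" for I
  proof (cases "emeasure M I = 0 \<or> emeasure M I = top")
    case True
    then show ?thesis using that T(1) by (auto simp: S'_def)
  next
    case False
    have "l * emeasure M I \<le> (\<integral>\<^sup>+x\<in>I. h x \<partial>M) / emeasure M I * emeasure M I"
      using that T(1) by (intro mult_right_mono) (auto simp: S'_def)
    also have "\<dots> = (\<integral>\<^sup>+x\<in>I. h x \<partial>M)"
      using False by (subst ennreal_divide_times) (simp add: less_top)
    finally show ?thesis .
  qed
  have "l * emeasure M (\<Union>T) \<le> l * (\<Sum>I\<in>T. emeasure M I)"
    using emeasure_subadditive_finite[of T id M] finT T(1) S'(2) rat_intervals_borel sets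
    by (intro mult_left_mono) auto
  also have "\<dots> \<le> (\<Sum>I\<in>T. \<integral>\<^sup>+x\<in>I. h x \<partial>M)"
    unfolding sum_distrib_left by (intro sum_mono le)
  also have "\<dots> = (\<integral>\<^sup>+x. (\<Sum>I\<in>T. h x * indicator I x) \<partial>M)"
    by (intro nn_integral_sum[symmetric]) auto
  also have "\<dots> \<le> (\<integral>\<^sup>+x. 2 * (h x * indicator (\<Union>T) x) \<partial>M)"
  proof (intro nn_integral_mono)
    fix x
    have "(\<Sum>I\<in>T. indicator I x :: ennreal) = of_nat (card {I\<in>T. x \<in> I})"
      using finT by (simp add: indicator_def sum.If_cases Int_def)
    also have "\<dots> \<le> 2 * indicator (\<Union>T) x"
    proof (cases "x \<in> \<Union>T")
      case True
      then show ?thesis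
        using of_nat_mono[OF T(3)[of x], where 'a = ennreal] by simp
    next
      case False
      then have "{I\<in>T. x \<in> I} = {}" by auto
      then show ?thesis by (simp only: card.empty) simp
    qed
    finally show "(\<Sum>I\<in>T. h x * indicator I x) \<le> 2 * (h x * indicator (\<Union>T) x)"
      by (subst sum_distrib_left[symmetric], subst mult.left_commute) (rule mult_left_mono, auto)
  qed
  also have "\<dots> = 2 * (\<integral>\<^sup>+x\<in>\<Union>T. h x \<partial>M)"
    by (intro nn_integral_cmult) measurable
  finally show ?thesis unfolding eq .
qed

text \<open>The layer cake representation of a power. The indicator of \<open>{0..}\<close> matters,
  because \<open>ennreal\<close> sends negative \<open>l\<close> to \<open>0\<close>.\<close>

lemma nn_integral_powr_below:
  assumes a: "a > 0" and u: "u < top"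
  shows "(\<integral>\<^sup>+l. ennreal (a * l powr (a - 1)) * (indicator {0..} l * indicator {l. ennreal l < u} l) \<partial>lborel)
    = ennreal_powr u a"
proof (cases u)
  case (real c)
  have "((\<lambda>x. x powr (a - 1)) has_integral (c powr a / a)) {0..c}"
    using has_integral_powr_from_0[of "a - 1" c] a real by simp
  then have "((\<lambda>x. a * x powr (a - 1)) has_integral (c powr a)) {0..c}"
    using has_integral_mult_right[of "\<lambda>x. x powr (a - 1)" "c powr a / a" "{0..c}" a] a by simp
  then have "((\<lambda>x. if x \<in> {0..c} then a * x powr (a - 1) else 0) has_integral (c powr a)) UNIV"
    by (subst has_integral_restrict_UNIV)
  then have int: "(\<integral>\<^sup>+x. ennreal (if x \<in> {0..c} then a * x powr (a - 1) else 0) \<partial>lborel) = ennreal (c powr a)"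
    using a by (intro nn_integral_has_integral_lborel) auto
  have "(\<integral>\<^sup>+l. ennreal (a * l powr (a - 1)) * (indicator {0..} l * indicator {l. ennreal l < u} l) \<partial>lborel)
    = (\<integral>\<^sup>+x. ennreal (if x \<in> {0..c} then a * x powr (a - 1) else 0) \<partial>lborel)"
    using real AE_lborel_singleton[of c]
    by (intro nn_integral_cong_AE)
       (auto elim!: eventually_mono simp: indicator_def ennreal_less_iff split: if_splits)
  also have "\<dots> = ennreal_powr u a"
    using int real by (simp add: ennreal_powr_ennreal)
  finally show ?thesis .
qed (use u in auto)

text \<open>The layer cake formula turns a weak type inequality with the integral of \<open>h\<close> over the level
  sets of \<open>f\<close> itself into a strong one.\<close>
lemma weak_type_imp_strong_type:
  assumes p: "p > 1" and "sigma_finite_measure M"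
    and [measurable]: "f \<in> borel_measurable M" "h \<in> borel_measurable M"
    and f: "\<And>x. f x < top"
    and fin: "(\<integral>\<^sup>+x. ennreal_powr (f x) p \<partial>M) < top"
    and weak: "\<And>l. l * emeasure M {x\<in>space M. l < f x} \<le> 2 * (\<integral>\<^sup>+x\<in>{x\<in>space M. l < f x}. h x \<partial>M)"
  shows "(\<integral>\<^sup>+x. ennreal_powr (f x) p \<partial>M)
    \<le> ennreal ((2 * p / (p - 1)) powr p) * (\<integral>\<^sup>+x. ennreal_powr (h x) p \<partial>M)"
proof -
  interpret M: sigma_finite_measure M by fact
  interpret pair_sigma_finite M lborel ..
  let ?A = "\<integral>\<^sup>+x. ennreal_powr (f x) p \<partial>M" and ?H = "\<integral>\<^sup>+x. ennreal_powr (h x) p \<partial>M"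
  let ?c = "2 * p / (p - 1)"
  have c: "?c > 0" using p by simp
  let ?i = "\<lambda>x l. indicator {0..} l * indicator {l. ennreal l < f x} l :: ennreal"
  have "?A = (\<integral>\<^sup>+x. (\<integral>\<^sup>+l. ennreal (p * l powr (p - 1)) * ?i x l \<partial>lborel) \<partial>M)"
    using p f by (subst nn_integral_powr_below) auto
  also have "\<dots> = (\<integral>\<^sup>+l. (\<integral>\<^sup>+x. ennreal (p * l powr (p - 1)) * ?i x l \<partial>M) \<partial>lborel)"
    by (intro Fubini'[symmetric]) measurable
  \<comment> \<open>One power of \<open>l\<close> is spent on the weak type inequality, so
    \<open>p - 1\<close> drops to \<open>p - 1 - 1\<close>; the factor \<open>p - 1\<close> is
    inserted to recognise the layer cake with exponent \<open>p - 1\<close> once the integrals are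
    exchanged back.\<close>
  also have "\<dots> \<le> (\<integral>\<^sup>+l. (\<integral>\<^sup>+x. ennreal ?c * (h x * (ennreal ((p - 1) * l powr (p - 1 - 1)) * ?i x l)) \<partial>M) \<partial>lborel)"
  proof (rule nn_integral_mono_AE, rule eventually_mono[OF AE_lborel_singleton[of 0]])
    fix l :: real assume l0: "l \<noteq> 0"
    show "(\<integral>\<^sup>+x. ennreal (p * l powr (p - 1)) * ?i x l \<partial>M)
      \<le> (\<integral>\<^sup>+x. ennreal ?c * (h x * (ennreal ((p - 1) * l powr (p - 1 - 1)) * ?i x l)) \<partial>M)"
    proof (cases "l > 0")
      case True
      let ?E = "{x\<in>space M. ennreal l < f x}"
      have "(\<integral>\<^sup>+x. ennreal (p * l powr (p - 1)) * ?i x l \<partial>M)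
        = (\<integral>\<^sup>+x. ennreal (p * l powr (p - 1)) * indicator ?E x \<partial>M)"
        using True by (intro nn_integral_cong) (auto simp: indicator_def)
      also have "\<dots> = ennreal (p * l powr (p - 1 - 1)) * (ennreal l * emeasure M ?E)"
      proof -
        have "p * l powr (p - 1) = p * l powr (p - 1 - 1) * l"
          using True powr_add[of l "p - 1 - 1" 1] by simp
        then show ?thesis
          using True p by (simp add: nn_integral_cmult mult_ac flip: ennreal_mult)
            (simp add: ennreal_mult mult_ac)
      qed
      also have "\<dots> \<le> ennreal (p * l powr (p - 1 - 1)) * (2 * (\<integral>\<^sup>+x\<in>?E. h x \<partial>M))"
        by (intro mult_left_mono weak) auto
      also have "\<dots> = ennreal (?c * ((p - 1) * l powr (p - 1 - 1))) * (\<integral>\<^sup>+x\<in>?E. h x \<partial>M)"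
      proof -
        have "?c * ((p - 1) * l powr (p - 1 - 1)) = (p * l powr (p - 1 - 1)) * 2"
          using p by (simp add: field_simps)
        then show ?thesis using p by (simp add: ennreal_mult mult_ac)
      qed
      also have "\<dots> = (\<integral>\<^sup>+x. ennreal (?c * ((p - 1) * l powr (p - 1 - 1))) * (h x * indicator ?E x) \<partial>M)"
        by (intro nn_integral_cmult[symmetric]) measurable
      also have "\<dots> = (\<integral>\<^sup>+x. ennreal ?c * (h x * (ennreal ((p - 1) * l powr (p - 1 - 1)) * ?i x l)) \<partial>M)"
      proof -
        have e: "ennreal (?c * y) = ennreal ?c * ennreal y" for y
          using c by (intro ennreal_mult') simp
        then show ?thesis
          using True unfolding e by (intro nn_integral_cong) (auto simp: indicator_def mult_ac)
      qed
      finally show ?thesis .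
    qed (use l0 in auto)
  qed
  also have "\<dots> = (\<integral>\<^sup>+x. (\<integral>\<^sup>+l. ennreal ?c * (h x * (ennreal ((p - 1) * l powr (p - 1 - 1)) * ?i x l)) \<partial>lborel) \<partial>M)"
    by (intro Fubini') measurable
  also have "\<dots> = (\<integral>\<^sup>+x. ennreal ?c * (h x * ennreal_powr (f x) (p - 1)) \<partial>M)"
    using p f by (intro nn_integral_cong) (simp add: nn_integral_cmult nn_integral_powr_below[of "p - 1", simplified])
  also have "\<dots> = ennreal ?c * (\<integral>\<^sup>+x. ennreal_powr (ennreal_powr (h x) p) (1 / p) * ennreal_powr (ennreal_powr (f x) p) (1 - 1 / p) \<partial>M)"
    using p by (simp add: nn_integral_cmult ennreal_powr_powr right_diff_distrib)
  also have "\<dots> \<le> ennreal ?c * (ennreal_powr ?H (1 / p) * ennreal_powr ?A (1 - 1 / p))"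
    using p by (intro mult_left_mono nn_integral_Holder) auto
  finally have "?A \<le> (ennreal ?c * ennreal_powr ?H (1 / p)) * ennreal_powr ?A (1 - 1 / p)"
    by (simp add: mult.assoc)
  then have "?A \<le> ennreal_powr (ennreal ?c * ennreal_powr ?H (1 / p)) p"
    using p fin by (intro ennreal_powr_absorb) auto
  also have "\<dots> = ennreal (?c powr p) * ?H"
    using p c by (simp add: ennreal_powr_mult ennreal_powr_powr ennreal_powr_ennreal)
  finally show ?thesis .
qed

text \<open>A finite family supplies the finiteness required by
  \<open>weak_type_imp_strong_type\<close>: the maximal function is at most a finite sum of finite
  averages and vanishes off a set of finite measure. The constant does not depend on
  \<open>S\<close>.\<close>

lemma interval_maximal_strong_finite:
  assumes p: "p > 1" and "sigma_finite_measure M" and S: "finite S" "S \<subseteq> rat_intervals"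
    and sets [measurable_cong]: "sets M = sets borel" and [measurable]: "h \<in> borel_measurable borel"
    and M: "\<And>I. I \<in> S \<Longrightarrow> 0 < emeasure M I \<and> emeasure M I < top"
  shows "(\<integral>\<^sup>+x. ennreal_powr (interval_maximal S M h x) p \<partial>M)
    \<le> ennreal ((2 * p / (p - 1)) powr p) * (\<integral>\<^sup>+x. ennreal_powr (h x) p \<partial>M)"
proof (cases "(\<integral>\<^sup>+x. ennreal_powr (h x) p \<partial>M) = top")
  case True
  then show ?thesis using p by (simp add: ennreal_mult_top)
next
  case False
  define av where "av I = (\<integral>\<^sup>+x\<in>I. h x \<partial>M) / emeasure M I" for I
  have [measurable]: "I \<in> sets borel" if "I \<in> S" for I
    using that S rat_intervals_borel by auto
  have av: "av I < top" if I: "I \<in> S" for I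
  proof -
    have "(\<integral>\<^sup>+x\<in>I. h x \<partial>M) = (\<integral>\<^sup>+x. ennreal_powr (ennreal_powr (h x) p) (1 / p) * ennreal_powr (indicator I x) (1 - 1 / p) \<partial>M)"
      using p by (intro nn_integral_cong) (auto simp: indicator_def ennreal_powr_powr)
    also have "\<dots> \<le> ennreal_powr (\<integral>\<^sup>+x. ennreal_powr (h x) p \<partial>M) (1 / p) * ennreal_powr (\<integral>\<^sup>+x. indicator I x \<partial>M) (1 - 1 / p)"
      using p I by (intro nn_integral_Holder) auto
    also have "\<dots> < top"
      using False M[OF I] I by (auto simp: ennreal_mult_eq_top_iff simp flip: less_top)
    finally show ?thesis
      using M[OF I] unfolding av_def by (auto simp: ennreal_divide_eq_top_iff simp flip: less_top)
  qed
  have le: "interval_maximal S M h x \<le> sum av S * indicator (\<Union>S) x" for x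
    unfolding interval_maximal_def av_def[symmetric]
    using S(1) by (intro SUP_least) (auto simp: indicator_def intro: member_le_sum)
  have "sum av S < top" using av S(1) by auto
  have "emeasure M (\<Union>S) \<le> (\<Sum>I\<in>S. emeasure M I)"
    using emeasure_subadditive_finite[of S id M] S rat_intervals_borel sets by auto
  also have "\<dots> < top" using M S(1) by auto
  finally have US: "emeasure M (\<Union>S) < top" .
  have [measurable]: "\<Union>S \<in> sets borel" using S(1) by (intro sets.finite_Union) auto
  have [measurable]: "interval_maximal S M h \<in> borel_measurable borel"
    by (rule interval_maximal_measurable[OF S(2)])
  have sp: "space M = UNIV" using sets_eq_imp_space_eq[OF sets] by simp
  show ?thesis
  proof (rule weak_type_imp_strong_type)
    show "interval_maximal S M h x < top" for x
      using le[of x] \<open>sum av S < top\<close> by (auto simp: indicator_def split: if_splits intro: le_less_trans)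
    have "(\<integral>\<^sup>+x. ennreal_powr (interval_maximal S M h x) p \<partial>M)
      \<le> (\<integral>\<^sup>+x. ennreal_powr (sum av S) p * indicator (\<Union>S) x \<partial>M)"
    proof (intro nn_integral_mono)
      fix x
      show "ennreal_powr (interval_maximal S M h x) p \<le> ennreal_powr (sum av S) p * indicator (\<Union>S) x"
        using ennreal_powr_mono[OF _ le[of x], of p] p by (cases "x \<in> \<Union>S") auto
    qed
    also have "\<dots> = ennreal_powr (sum av S) p * emeasure M (\<Union>S)"
      by (subst nn_integral_cmult_indicator) auto
    also have "\<dots> < top"
      using US \<open>sum av S < top\<close> by (auto simp: ennreal_mult_less_top)
    finally show "(\<integral>\<^sup>+x. ennreal_powr (interval_maximal S M h x) p \<partial>M) < top" .
    show "l * emeasure M {x \<in> space M. l < interval_maximal S M h x}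
      \<le> 2 * (\<integral>\<^sup>+x\<in>{x \<in> space M. l < interval_maximal S M h x}. h x \<partial>M)" for l
      using interval_maximal_weak_type[OF S sets, of h l] by (simp add: sp)
  qed (use p assms(2) in auto)
qed

text \<open>Finite families increase to all rational intervals along an enumeration, and the uniform
  constant survives monotone convergence.\<close>

lemma interval_maximal_strong_type:
  assumes p: "p > 1" and "sigma_finite_measure M"
    and sets [measurable_cong]: "sets M = sets borel" and h [measurable]: "h \<in> borel_measurable borel"
    and M: "\<And>I. I \<in> rat_intervals \<Longrightarrow> 0 < emeasure M I \<and> emeasure M I < top"
  shows "(\<integral>\<^sup>+x. ennreal_powr (interval_maximal rat_intervals M h x) p \<partial>M)
    \<le> ennreal ((2 * p / (p - 1)) powr p) * (\<integral>\<^sup>+x. ennreal_powr (h x) p \<partial>M)"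
proof -
  have ne: "rat_intervals \<noteq> {}"
    unfolding rat_intervals_def using Rats_0 Rats_1 zero_less_one by blast
  define S where "S n = from_nat_into rat_intervals ` {..n}" for n :: nat
  have S: "finite (S n)" "S n \<subseteq> rat_intervals" for n
    unfolding S_def using from_nat_into[OF ne] by auto
  have US: "rat_intervals = (\<Union>n. S n)"
    using range_from_nat_into[OF ne countable_rat_intervals] unfolding S_def by blast
  have [measurable]: "interval_maximal (S n) M h \<in> borel_measurable borel" for n
    by (rule interval_maximal_measurable[OF S(2)])
  have "interval_maximal rat_intervals M h x = (SUP n. interval_maximal (S n) M h x)" for x
    unfolding interval_maximal_def US SUP_UNION ..
  then have "(\<integral>\<^sup>+x. ennreal_powr (interval_maximal rat_intervals M h x) p \<partial>M)
    = (\<integral>\<^sup>+x. (SUP n. ennreal_powr (interval_maximal (S n) M h x) p) \<partial>M)"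
    using p by (simp add: ennreal_powr_SUP)
  also have "\<dots> = (SUP n. \<integral>\<^sup>+x. ennreal_powr (interval_maximal (S n) M h x) p \<partial>M)"
  proof (rule nn_integral_monotone_convergence_SUP)
    have "interval_maximal (S m) M h x \<le> interval_maximal (S n) M h x" if "m \<le> n" for m n x
      unfolding interval_maximal_def using that by (intro SUP_subset_mono) (auto simp: S_def)
    then show "incseq (\<lambda>n x. ennreal_powr (interval_maximal (S n) M h x) p)"
      using p by (auto simp: incseq_def le_fun_def intro!: ennreal_powr_mono)
  qed measurable
  also have "\<dots> \<le> ennreal ((2 * p / (p - 1)) powr p) * (\<integral>\<^sup>+x. ennreal_powr (h x) p \<partial>M)"
    using S M by (intro SUP_least interval_maximal_strong_finite assms) auto
  finally show ?thesis .
qed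

subsection \<open>Muckenhoupt weights\<close>

abbreviation maxf :: "(real \<Rightarrow> ennreal) \<Rightarrow> real \<Rightarrow> ennreal" where
  "maxf \<equiv> interval_maximal rat_intervals lborel"

text \<open>Muckenhoupt's condition with the denominators cleared, so that no division in
  \<open>ennreal\<close> occurs. Positivity and real values at every point, not just almost
  everywhere, allow weights to be inverted freely.\<close>

definition Ap_weight :: "real \<Rightarrow> real \<Rightarrow> (real \<Rightarrow> real) \<Rightarrow> bool" where
  "Ap_weight p A w \<longleftrightarrow> w \<in> borel_measurable borel \<and> (\<forall>t. 0 < w t) \<and>
     (\<forall>I\<in>rat_intervals. (\<integral>\<^sup>+t\<in>I. ennreal (w t) \<partial>lborel)
         * ennreal_powr (\<integral>\<^sup>+t\<in>I. ennreal (w t powr (- 1 / (p - 1))) \<partial>lborel) (p - 1)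
       \<le> ennreal A * ennreal_powr (emeasure lborel I) p)"

lemma emeasure_rat_interval:
  assumes "I \<in> rat_intervals"
  obtains L where "L > 0" "emeasure lborel I = ennreal L"
  using assms unfolding rat_intervals_def by (auto intro!: that[of "_ - _"])

lemma measurable_maxf [measurable]: "maxf h \<in> borel_measurable borel"
  by (rule interval_maximal_measurable) simp

lemma ennreal_mult_inverse_cancel:
  assumes "0 < x" shows "ennreal x * (y * ennreal (1 / x)) = y"
proof -
  have "ennreal x * ennreal (1 / x) = 1"
    using assms by (simp flip: ennreal_mult)
  then show ?thesis by (simp add: mult.left_commute)
qed

lemma one_divide_powr:
  fixes x :: real
  shows "0 < x \<Longrightarrow> (1 / x) powr a = x powr (- a)"
  by (simp add: powr_divide powr_minus_divide)

lemma nn_integral_interval_pos: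
  assumes [measurable]: "h \<in> borel_measurable borel" and "\<And>t. 0 < h t" and I: "I \<in> rat_intervals"
  shows "0 < (\<integral>\<^sup>+t\<in>I. h t \<partial>lborel)"
proof (rule ccontr)
  have [measurable]: "I \<in> sets borel" using I rat_intervals_borel by auto
  assume "\<not> 0 < (\<integral>\<^sup>+t\<in>I. h t \<partial>lborel)"
  then have "AE t in lborel. h t * indicator I t = 0"
    by (subst (asm) not_gr_zero, subst (asm) nn_integral_0_iff_AE) auto
  then have "AE t in lborel. t \<notin> I"
    by eventually_elim (use assms(2) in \<open>auto simp: indicator_def less_le\<close>)
  then have "emeasure lborel I = 0"
    by (subst (asm) AE_iff_measurable[OF _ refl]) auto
  moreover obtain L where "L > 0" "emeasure lborel I = ennreal L"
    by (rule emeasure_rat_interval[OF I])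
  ultimately show False by simp
qed

text \<open>Raising the condition to the power \<open>1 / (p - 1)\<close> exchanges the roles of its
  two integrals.\<close>

lemma Ap_weight_dual:
  assumes p: "p > 1" and A: "A > 0" and w: "Ap_weight p A w"
  shows "Ap_weight (p / (p - 1)) (A powr (1 / (p - 1))) (\<lambda>t. w t powr (- 1 / (p - 1)))"
proof -
  have [measurable]: "w \<in> borel_measurable borel" and pos: "\<And>t. 0 < w t"
    using w by (auto simp: Ap_weight_def)
  have p': "p / (p - 1) - 1 = 1 / (p - 1)" "- 1 / (1 / (p - 1)) = - (p - 1)"
    using p by (simp_all add: field_simps)
  have inv: "(w t powr (- 1 / (p - 1))) powr (- (p - 1)) = w t" for t
  proof -
    have "- 1 / (p - 1) * - (p - 1) = 1" using p by (simp add: field_simps)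
    then show ?thesis using pos[of t] unfolding powr_powr by simp
  qed
  show ?thesis
    unfolding Ap_weight_def p' inv
  proof (intro conjI ballI allI)
    fix I assume I: "I \<in> rat_intervals"
    let ?W = "\<integral>\<^sup>+t\<in>I. ennreal (w t) \<partial>lborel" and ?N = "\<integral>\<^sup>+t\<in>I. ennreal (w t powr (- 1 / (p - 1))) \<partial>lborel"
    have "?W * ennreal_powr ?N (p - 1) \<le> ennreal A * ennreal_powr (emeasure lborel I) p"
      using w I by (auto simp: Ap_weight_def)
    then have "ennreal_powr (?W * ennreal_powr ?N (p - 1)) (1 / (p - 1))
        \<le> ennreal_powr (ennreal A * ennreal_powr (emeasure lborel I) p) (1 / (p - 1))"
      using p by (intro ennreal_powr_mono) auto
    then show "?N * ennreal_powr ?W (1 / (p - 1))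
        \<le> ennreal (A powr (1 / (p - 1))) * ennreal_powr (emeasure lborel I) (p / (p - 1))"
      using p A by (simp add: ennreal_powr_mult ennreal_powr_powr ennreal_powr_ennreal mult.commute)
  qed (use pos in \<open>auto simp: less_imp_neq[symmetric]\<close>)
qed

lemma Ap_weight_integrals:
  assumes p: "p > 1" and A: "A > 0" and w: "Ap_weight p A w" and I: "I \<in> rat_intervals"
  shows "0 < (\<integral>\<^sup>+t\<in>I. ennreal (w t) \<partial>lborel)" "(\<integral>\<^sup>+t\<in>I. ennreal (w t) \<partial>lborel) < top"
    "0 < (\<integral>\<^sup>+t\<in>I. ennreal (w t powr (- 1 / (p - 1))) \<partial>lborel)"
    "(\<integral>\<^sup>+t\<in>I. ennreal (w t powr (- 1 / (p - 1))) \<partial>lborel) < top"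
proof -
  let ?W = "\<integral>\<^sup>+t\<in>I. ennreal (w t) \<partial>lborel" and ?N = "\<integral>\<^sup>+t\<in>I. ennreal (w t powr (- 1 / (p - 1))) \<partial>lborel"
  have [measurable]: "w \<in> borel_measurable borel" and pos: "\<And>t. 0 < w t"
    using w by (auto simp: Ap_weight_def)
  show W: "0 < ?W" and N: "0 < ?N"
    using pos by (auto intro!: nn_integral_interval_pos I simp: less_imp_neq[symmetric])
  have "?W * ennreal_powr ?N (p - 1) \<le> ennreal A * ennreal_powr (emeasure lborel I) p"
    using w I by (auto simp: Ap_weight_def)
  also have "\<dots> < top"
  proof -
    obtain L where "L > 0" "emeasure lborel I = ennreal L"
      by (rule emeasure_rat_interval[OF I])
    then show ?thesis using A by (simp add: ennreal_powr_ennreal flip: ennreal_mult)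
  qed
  finally show "?W < top" "?N < top"
    using W N by (auto simp: ennreal_mult_less_top)
qed

text \<open>The three factors arise in \<open>muckenhoupt\<close>: \<open>A\<close> to the conjugate
  exponent from the pointwise domination, then the strong type constants at the conjugate exponent
  for the measure of \<open>w\<close> and at \<open>p\<close> for that of the dual weight.\<close>

definition muckenhoupt_const :: "real \<Rightarrow> real \<Rightarrow> real" where
  "muckenhoupt_const p A = A powr (p / (p - 1)) * (2 * (p / (p - 1)) / (p / (p - 1) - 1)) powr (p / (p - 1))
     * (2 * p / (p - 1)) powr p"

lemma muckenhoupt_const_pos: "p > 1 \<Longrightarrow> A > 0 \<Longrightarrow> muckenhoupt_const p A > 0"
  unfolding muckenhoupt_const_def by (auto intro!: mult_pos_pos simp: field_simps)

lemma sigma_finite_density_real: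
  "w \<in> borel_measurable borel \<Longrightarrow> sigma_finite_measure (density lborel (\<lambda>t. ennreal (w t)))"
  by (subst sigma_finite_measure.sigma_finite_iff_density_finite[OF sigma_finite_lborel]) auto

text \<open>Lerner's proof of Muckenhoupt's theorem: with \<open>s = w\<^bsup>-1/(p-1)\<^esup>\<close>, the \<open>A\<^sub>p\<close> condition dominates
  the averages of \<open>f\<close> by the composition of the maximal functions of the measures \<open>s dt\<close> and
  \<open>w dt\<close>, which are bounded on their own \<open>L\<^sup>p\<close> spaces without any condition on the weight.\<close>
lemma muckenhoupt:
  assumes p: "p > 1" and A: "A > 0" and w: "Ap_weight p A w"
    and [measurable]: "f \<in> borel_measurable borel"
  shows "(\<integral>\<^sup>+t. ennreal_powr (maxf f t) p * ennreal (w t) \<partial>lborel)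
     \<le> ennreal (muckenhoupt_const p A) * (\<integral>\<^sup>+t. ennreal_powr (f t) p * ennreal (w t) \<partial>lborel)"
proof -
  define p' where "p' = p / (p - 1)"
  have p': "p' > 1" "p' * (p - 1) = p" "(p - 1) * p' = p" using p by (auto simp: p'_def field_simps)
  define s where "s t = w t powr (- 1 / (p - 1))" for t
  have [measurable]: "w \<in> borel_measurable borel" and pos: "\<And>t. 0 < w t"
    using w by (auto simp: Ap_weight_def)
  have [measurable]: "s \<in> borel_measurable borel" and spos: "\<And>t. 0 < s t"
    unfolding s_def using pos by (measurable, simp add: less_imp_neq[symmetric])
  define mu where "mu = density lborel (\<lambda>t. ennreal (w t))"
  define nu where "nu = density lborel (\<lambda>t. ennreal (s t))"
  have sets [measurable_cong]: "sets mu = sets borel" "sets nu = sets borel"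
    by (simp_all add: mu_def nu_def)
  have sf: "sigma_finite_measure mu" "sigma_finite_measure nu"
    unfolding mu_def nu_def by (intro sigma_finite_density_real; measurable)+
  have intmu: "(\<integral>\<^sup>+t. g t \<partial>mu) = (\<integral>\<^sup>+t. ennreal (w t) * g t \<partial>lborel)"
    and intnu: "(\<integral>\<^sup>+t. g t \<partial>nu) = (\<integral>\<^sup>+t. ennreal (s t) * g t \<partial>lborel)"
    if [measurable]: "g \<in> borel_measurable borel" for g
    unfolding mu_def nu_def by (simp_all add: nn_integral_density)
  have mb: "I \<in> sets borel" if "I \<in> rat_intervals" for I
    using that rat_intervals_borel by auto
  have mumeas: "emeasure mu I = (\<integral>\<^sup>+t\<in>I. ennreal (w t) \<partial>lborel)"
    and numeas: "emeasure nu I = (\<integral>\<^sup>+t\<in>I. ennreal (s t) \<partial>lborel)" if "I \<in> rat_intervals" for I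
    using mb[OF that] unfolding mu_def nu_def by (simp_all add: emeasure_density)
  have mupos: "0 < emeasure mu I \<and> emeasure mu I < top"
    and nupos: "0 < emeasure nu I \<and> emeasure nu I < top" if I: "I \<in> rat_intervals" for I
    using Ap_weight_integrals[OF p A w I] mumeas[OF I] numeas[OF I] by (simp_all add: s_def)
  \<comment> \<open>\<open>g\<close> is \<open>f\<close> written against the dual measure: the
    Lebesgue integral of \<open>f\<close> over an interval is the \<open>nu\<close>-integral of
    \<open>g\<close>.\<close>
  define g where "g t = f t * ennreal (1 / s t)" for t
  have [measurable]: "g \<in> borel_measurable borel" unfolding g_def by measurable
  have gs: "ennreal (s t) * g t = f t" for t
    unfolding g_def using spos by (rule ennreal_mult_inverse_cancel)
  define h where "h = interval_maximal rat_intervals nu g"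
  have [measurable]: "h \<in> borel_measurable borel"
    unfolding h_def by (rule interval_maximal_measurable) simp
  \<comment> \<open>Division by \<open>w\<close> turns Lebesgue integrals of \<open>h\<close> to the
    power \<open>p - 1\<close> into \<open>mu\<close>-integrals of \<open>k\<close>.\<close>
  define k where "k t = ennreal_powr (h t) (p - 1) * ennreal (1 / w t)" for t
  have [measurable]: "k \<in> borel_measurable borel" unfolding k_def by measurable
  have kw: "ennreal (w t) * k t = ennreal_powr (h t) (p - 1)" for t
    unfolding k_def using pos by (rule ennreal_mult_inverse_cancel)
  have point: "ennreal_powr (maxf f t) (p - 1) \<le> ennreal A * interval_maximal rat_intervals mu k t" for t
  proof -
    have *: "ennreal_powr ((\<integral>\<^sup>+x\<in>I. f x \<partial>lborel) / emeasure lborel I * indicator I t) (p - 1)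
       \<le> ennreal A * ((\<integral>\<^sup>+x\<in>I. k x \<partial>mu) / emeasure mu I * indicator I t)" if I: "I \<in> rat_intervals" for I
    proof (cases "t \<in> I")
      case True
      note mb[OF I, measurable]
      obtain L where L: "L > 0" "emeasure lborel I = ennreal L" by (rule emeasure_rat_interval[OF I])
      obtain W where W: "W > 0" "emeasure mu I = ennreal W"
        using mupos[OF I] by (cases "emeasure mu I") auto
      obtain N where N: "N > 0" "emeasure nu I = ennreal N"
        using nupos[OF I] by (cases "emeasure nu I") auto
      have "ennreal W * ennreal_powr (ennreal N) (p - 1) \<le> ennreal A * ennreal_powr (ennreal L) p"
        using w I unfolding Ap_weight_def W(2)[symmetric] N(2)[symmetric] L(2)[symmetric]
          mumeas[OF I] numeas[OF I] s_def by blast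
      then have Ap: "W * N powr (p - 1) \<le> A * L powr p"
        using W N L A by (simp add: ennreal_powr_ennreal flip: ennreal_mult)
      define F where "F = (\<integral>\<^sup>+x\<in>I. f x \<partial>lborel)"
      have F: "F = (\<integral>\<^sup>+x\<in>I. g x \<partial>nu)"
        unfolding F_def by (subst intnu) (auto simp: gs simp flip: mult.assoc)
      \<comment> \<open>Everywhere on \<open>I\<close>, \<open>h\<close> is at least the
        \<open>nu\<close>-average \<open>F / N\<close> of \<open>g\<close>; integrating this
        constant bound over \<open>I\<close> leads to the \<open>mu\<close>-integral of
        \<open>k\<close>.\<close>
      have hge: "ennreal_powr F (p - 1) * ennreal (N powr (1 - p)) \<le> ennreal_powr (h x) (p - 1)" if "x \<in> I" for x
      proof -
        have "F / emeasure nu I * indicator I x \<le> h x"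
          unfolding F h_def interval_maximal_def by (rule SUP_upper[OF I])
        then have "F * ennreal (1 / N) \<le> h x"
          using that N by (simp add: divide_ennreal_def inverse_ennreal inverse_eq_divide)
        then have "ennreal_powr (F * ennreal (1 / N)) (p - 1) \<le> ennreal_powr (h x) (p - 1)"
          using p by (intro ennreal_powr_mono) auto
        then show ?thesis
          using p N one_divide_powr[OF N(1), of "p - 1"]
          by (simp add: ennreal_powr_mult ennreal_powr_ennreal)
      qed
      have "ennreal L * (ennreal_powr F (p - 1) * ennreal (N powr (1 - p))) =
          (\<integral>\<^sup>+x. ennreal_powr F (p - 1) * ennreal (N powr (1 - p)) * indicator I x \<partial>lborel)"
        using L by (subst nn_integral_cmult_indicator) (auto simp: mult_ac)
      also have "\<dots> \<le> (\<integral>\<^sup>+x. ennreal_powr (h x) (p - 1) * indicator I x \<partial>lborel)"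
        by (intro nn_integral_mono) (auto simp: indicator_def hge)
      also have "\<dots> = (\<integral>\<^sup>+x\<in>I. k x \<partial>mu)"
        by (subst intmu) (auto simp: kw simp flip: mult.assoc)
      finally have kI: "ennreal L * (ennreal_powr F (p - 1) * ennreal (N powr (1 - p))) \<le> (\<integral>\<^sup>+x\<in>I. k x \<partial>mu)" .
      \<comment> \<open>The A_p inequality solved for the power of the length: it trades the average
        \<open>F / L\<close> for the \<open>nu\<close>-average \<open>F / N\<close> at the cost of
        \<open>A * L / W\<close>.\<close>
      have "L powr (1 - p) \<le> A / W * L * N powr (1 - p)"
      proof -
        have "1 \<le> A * L powr p / (W * N powr (p - 1))"
          using Ap W N by (simp add: field_simps)
        then have "L powr (1 - p) \<le> L powr (1 - p) * (A * L powr p / (W * N powr (p - 1)))"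
          using mult_left_mono[of 1 "A * L powr p / (W * N powr (p - 1))" "L powr (1 - p)"] by simp
        also have "\<dots> = A / W * (L powr p * L powr (1 - p)) * (1 / N powr (p - 1))"
          by simp
        also have "L powr p * L powr (1 - p) = L"
          using L by (simp flip: powr_add)
        also have "1 / N powr (p - 1) = N powr (1 - p)"
          using powr_minus_divide[of N "p - 1"] by simp
        finally show ?thesis .
      qed
      then have "ennreal_powr F (p - 1) * ennreal (L powr (1 - p))
         \<le> ennreal_powr F (p - 1) * ennreal (A / W * L * N powr (1 - p))"
        by (intro mult_left_mono ennreal_leI) auto
      also have "\<dots> = ennreal (A / W) * (ennreal L * (ennreal_powr F (p - 1) * ennreal (N powr (1 - p))))"
        unfolding ennreal_mult''[OF powr_ge_zero] ennreal_mult''[OF less_imp_le[OF L(1)]] by (simp only: mult_ac)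
      also have "\<dots> \<le> ennreal (A / W) * (\<integral>\<^sup>+x\<in>I. k x \<partial>mu)"
        by (intro mult_left_mono kI) auto
      also have "\<dots> = ennreal A * ((\<integral>\<^sup>+x\<in>I. k x \<partial>mu) / emeasure mu I)"
        using A W by (simp add: divide_ennreal_def inverse_ennreal mult_ac inverse_eq_divide flip: ennreal_mult mult.assoc)
      also have "ennreal_powr F (p - 1) * ennreal (L powr (1 - p)) = ennreal_powr (F / emeasure lborel I) (p - 1)"
        using L p one_divide_powr[OF L(1), of "p - 1"]
        by (simp add: divide_ennreal_def inverse_ennreal inverse_eq_divide ennreal_powr_mult ennreal_powr_ennreal)
      finally show ?thesis
        using True by (simp add: F_def)
    qed simp
    have "ennreal_powr (maxf f t) (p - 1)
        = (SUP I\<in>rat_intervals. ennreal_powr ((\<integral>\<^sup>+x\<in>I. f x \<partial>lborel) / emeasure lborel I * indicator I t) (p - 1))"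
      unfolding interval_maximal_def using p by (subst ennreal_powr_SUP) auto
    also have "\<dots> \<le> (SUP I\<in>rat_intervals. ennreal A * ((\<integral>\<^sup>+x\<in>I. k x \<partial>mu) / emeasure mu I * indicator I t))"
      using * by (intro SUP_mono) blast
    also have "\<dots> = ennreal A * interval_maximal rat_intervals mu k t"
      unfolding interval_maximal_def by (rule SUP_mult_left_ennreal[symmetric])
    finally show ?thesis .
  qed
  \<comment> \<open>The exponents fit since \<open>w\<close> to the power \<open>1 - p'\<close> is
    \<open>s\<close>; dually, \<open>s\<close> to the power \<open>1 - p\<close> is \<open>w\<close>
    in \<open>gf\<close> below.\<close>
  have kh: "(\<integral>\<^sup>+t. ennreal_powr (k t) p' \<partial>mu) = (\<integral>\<^sup>+t. ennreal_powr (h t) p \<partial>nu)"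
  proof -
    have "ennreal (w t) * ennreal_powr (k t) p' = ennreal (s t) * ennreal_powr (h t) p" for t
    proof -
      have "w t * (1 / w t) powr p' = w t powr (1 - p')"
        using pos[of t] by (simp add: powr_divide powr_diff)
      also have "1 - p' = - 1 / (p - 1)" using p by (simp add: p'_def field_simps)
      finally have "w t * (1 / w t) powr p' = s t" by (simp add: s_def)
      moreover have "ennreal (w t * (1 / w t) powr p') = ennreal (w t) * ennreal_powr (ennreal (1 / w t)) p'"
        using pos[of t] by (simp add: ennreal_mult' ennreal_powr_ennreal)
      ultimately show ?thesis
        using p' by (simp add: k_def ennreal_powr_mult ennreal_powr_powr mult_ac)
    qed
    then show ?thesis by (simp add: intmu intnu)
  qed
  have hg: "(\<integral>\<^sup>+t. ennreal_powr (h t) p \<partial>nu) \<le> ennreal ((2 * p / (p - 1)) powr p) * (\<integral>\<^sup>+t. ennreal_powr (g t) p \<partial>nu)"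
    unfolding h_def using nupos interval_maximal_strong_type[OF p sf(2) sets(2), of g] by auto
  have gf: "(\<integral>\<^sup>+t. ennreal_powr (g t) p \<partial>nu) = (\<integral>\<^sup>+t. ennreal_powr (f t) p * ennreal (w t) \<partial>lborel)"
  proof -
    have "ennreal (s t) * ennreal_powr (g t) p = ennreal_powr (f t) p * ennreal (w t)" for t
    proof -
      have "s t * (1 / s t) powr p = s t powr (1 - p)"
        using spos[of t] by (simp add: powr_divide powr_diff)
      also have "\<dots> = w t"
      proof -
        have "- 1 / (p - 1) * (1 - p) = 1" using p by (simp add: field_simps)
        then show ?thesis using pos[of t] unfolding s_def powr_powr by simp
      qed
      finally have "s t * (1 / s t) powr p = w t" .
      moreover have "ennreal (s t * (1 / s t) powr p) = ennreal (s t) * ennreal_powr (ennreal (1 / s t)) p"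
        using spos[of t] by (simp add: ennreal_mult' ennreal_powr_ennreal)
      ultimately show ?thesis
        using p by (simp add: g_def ennreal_powr_mult mult_ac)
    qed
    then show ?thesis by (simp add: intnu)
  qed
  have "(\<integral>\<^sup>+t. ennreal_powr (maxf f t) p * ennreal (w t) \<partial>lborel)
     = (\<integral>\<^sup>+t. ennreal_powr (ennreal_powr (maxf f t) (p - 1)) p' \<partial>mu)"
    using p' by (subst intmu) (auto simp: ennreal_powr_powr mult.commute)
  also have "\<dots> \<le> (\<integral>\<^sup>+t. ennreal_powr (ennreal A * interval_maximal rat_intervals mu k t) p' \<partial>mu)"
    using p' by (intro nn_integral_mono ennreal_powr_mono point) auto
  also have "\<dots> = ennreal (A powr p') * (\<integral>\<^sup>+t. ennreal_powr (interval_maximal rat_intervals mu k t) p' \<partial>mu)"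
    using p' A interval_maximal_measurable[OF order_refl, of mu k]
    by (simp add: ennreal_powr_mult ennreal_powr_ennreal nn_integral_cmult)
  also have "\<dots> \<le> ennreal (A powr p') * (ennreal ((2 * p' / (p' - 1)) powr p') * (\<integral>\<^sup>+t. ennreal_powr (k t) p' \<partial>mu))"
    using mupos interval_maximal_strong_type[OF p'(1) sf(1) sets(1), of k] by (intro mult_left_mono) auto
  also have "\<dots> \<le> ennreal (A powr p') * (ennreal ((2 * p' / (p' - 1)) powr p') *
      (ennreal ((2 * p / (p - 1)) powr p) * (\<integral>\<^sup>+t. ennreal_powr (f t) p * ennreal (w t) \<partial>lborel)))"
    unfolding kh gf[symmetric] by (intro mult_left_mono hg) auto
  finally show ?thesis
    using p A unfolding muckenhoupt_const_def p'_def[symmetric]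
    by (simp add: ennreal_mult mult.assoc)
qed

subsection \<open>Extrapolation\<close>

text \<open>Twice the operator norm bound given by \<open>muckenhoupt\<close>; the factor
  \<open>2\<close> undoes the ratio of the geometric series in
  \<open>rubio_de_francia\<close>.\<close>

definition rubio_const :: "real \<Rightarrow> real \<Rightarrow> real" where
  "rubio_const p A = 2 * muckenhoupt_const p A powr (1 / p)"

lemma rubio_const_pos: "p > 1 \<Longrightarrow> A > 0 \<Longrightarrow> rubio_const p A > 0"
  unfolding rubio_const_def using muckenhoupt_const_pos[of p A] by simp

lemma maxf_cmult:
  assumes [measurable]: "h \<in> borel_measurable borel"
  shows "maxf (\<lambda>t. c * h t) t = c * maxf h t"
proof -
  have "(\<integral>\<^sup>+x\<in>I. c * h x \<partial>lborel) / emeasure lborel I * indicator I t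
      = c * ((\<integral>\<^sup>+x\<in>I. h x \<partial>lborel) / emeasure lborel I * indicator I t)" if "I \<in> rat_intervals" for I
    using rat_intervals_borel[OF that]
    by (simp add: mult.assoc nn_integral_cmult divide_ennreal_def)
  then show ?thesis
    unfolding interval_maximal_def by (simp add: SUP_mult_left_ennreal)
qed

lemma maxf_suminf_le:
  assumes [measurable]: "\<And>k. h k \<in> borel_measurable borel"
  shows "maxf (\<lambda>t. \<Sum>k. h k t) t \<le> (\<Sum>k. maxf (h k) t)"
  unfolding interval_maximal_def
proof (rule SUP_least)
  fix I assume I: "I \<in> rat_intervals"
  note rat_intervals_borel[OF I, measurable]
  have "(\<integral>\<^sup>+x\<in>I. (\<Sum>k. h k x) \<partial>lborel) / emeasure lborel I * indicator I t
      = (\<Sum>k. (\<integral>\<^sup>+x\<in>I. h k x \<partial>lborel) / emeasure lborel I * indicator I t)"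
    by (simp add: nn_integral_suminf divide_ennreal_def flip: ennreal_suminf_multc)
  also have "\<dots> \<le> (\<Sum>k. SUP I\<in>rat_intervals. (\<integral>\<^sup>+x\<in>I. h k x \<partial>lborel) / emeasure lborel I * indicator I t)"
    using I by (intro suminf_le SUP_upper) auto
  finally show "(\<integral>\<^sup>+x\<in>I. (\<Sum>k. h k x) \<partial>lborel) / emeasure lborel I * indicator I t
     \<le> (\<Sum>k. SUP I\<in>rat_intervals. (\<integral>\<^sup>+x\<in>I. h k x \<partial>lborel) / emeasure lborel I * indicator I t)" .
qed

text \<open>The Rubio de Francia iteration: \<open>H\<close> sums the iterates of
  \<open>maxf\<close>, divided by powers of a bound \<open>c\<close> for its norm, with coefficients
  \<open>(1/2) ^ k\<close>. Applying \<open>maxf\<close> shifts the series by one place, at the cost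
  of a factor \<open>2 * c\<close>.\<close>

lemma rubio_de_francia:
  assumes p: "p > 1" and A: "A > 0" and w: "Ap_weight p A w"
    and f [measurable]: "f \<in> borel_measurable borel"
  obtains H where "H \<in> borel_measurable borel" "\<And>t. f t \<le> H t"
    "\<And>t. maxf H t \<le> ennreal (rubio_const p A) * H t"
    "(\<integral>\<^sup>+t. ennreal_powr (H t) p * ennreal (w t) \<partial>lborel)
       \<le> ennreal (2 powr p) * (\<integral>\<^sup>+t. ennreal_powr (f t) p * ennreal (w t) \<partial>lborel)"
proof -
  define K where "K = muckenhoupt_const p A"
  define c where "c = K powr (1 / p)"
  have K: "K > 0" unfolding K_def by (rule muckenhoupt_const_pos[OF p A])
  have c: "c > 0" "c powr p = K" "rubio_const p A = 2 * c"
    using K p by (auto simp: c_def powr_powr rubio_const_def K_def)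
  have [measurable]: "w \<in> borel_measurable borel" and pos: "\<And>t. 0 < w t"
    using w by (auto simp: Ap_weight_def)
  \<comment> \<open>Normalizing each application by \<open>c\<close> keeps the weighted norm of
    every iterate \<open>m k\<close> below that of \<open>f\<close>.\<close>
  define m where "m = rec_nat f (\<lambda>_ g t. ennreal (1 / c) * maxf g t)"
  have m0: "m 0 = f" and mS: "m (Suc k) = (\<lambda>t. ennreal (1 / c) * maxf (m k) t)" for k
    by (simp_all add: m_def)
  have mm [measurable]: "m k \<in> borel_measurable borel" for k
    by (induction k) (simp_all add: m0 mS)
  have mint: "(\<integral>\<^sup>+t. ennreal_powr (m k t) p * ennreal (w t) \<partial>lborel)
    \<le> (\<integral>\<^sup>+t. ennreal_powr (f t) p * ennreal (w t) \<partial>lborel)" for k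
  proof (induction k)
    case (Suc k)
    have "(\<integral>\<^sup>+t. ennreal_powr (m (Suc k) t) p * ennreal (w t) \<partial>lborel)
      = ennreal (1 / K) * (\<integral>\<^sup>+t. ennreal_powr (maxf (m k) t) p * ennreal (w t) \<partial>lborel)"
    proof -
      have "(1 / c) powr p = 1 / K" using c by (simp add: powr_divide)
      then show ?thesis
        using p c unfolding mS
        by (subst nn_integral_cmult[symmetric])
           (auto simp: ennreal_powr_mult ennreal_powr_ennreal mult.assoc)
    qed
    also have "\<dots> \<le> ennreal (1 / K) * (ennreal K * (\<integral>\<^sup>+t. ennreal_powr (m k t) p * ennreal (w t) \<partial>lborel))"
      unfolding K_def by (intro mult_left_mono muckenhoupt[OF p A w]) auto
    also have "\<dots> = (\<integral>\<^sup>+t. ennreal_powr (m k t) p * ennreal (w t) \<partial>lborel)"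
      using K by (simp flip: ennreal_mult mult.assoc)
    finally show ?case using Suc by (rule order_trans)
  qed (simp add: m0)
  define H where "H t = (\<Sum>k. ennreal ((1/2) ^ k) * m k t)" for t
  show ?thesis
  proof (rule that[of H])
    show H: "H \<in> borel_measurable borel" unfolding H_def by measurable
    show "f t \<le> H t" for t
    proof -
      have "ennreal ((1/2) ^ 0) * m 0 t \<le> H t"
        unfolding H_def using sum_le_suminf[of "\<lambda>k. ennreal ((1/2) ^ k) * m k t" "{0}"] by auto
      then show ?thesis by (simp add: m0)
    qed
    show "maxf H t \<le> ennreal (rubio_const p A) * H t" for t
    proof -
      have "maxf H t \<le> (\<Sum>k. maxf (\<lambda>t. ennreal ((1/2) ^ k) * m k t) t)"
        unfolding H_def by (rule maxf_suminf_le) measurable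
      also have "\<dots> = (\<Sum>k. ennreal ((1/2) ^ k) * maxf (m k) t)"
        by (simp add: maxf_cmult)
      also have "\<dots> = (\<Sum>k. ennreal (2 * c) * (ennreal ((1/2) ^ Suc k) * m (Suc k) t))"
      proof (rule suminf_cong)
        fix k
        have "2 * c * ((1/2) ^ Suc k * (1 / c)) = (1/2) ^ k" using c by simp
        then have "ennreal ((1/2) ^ k) = ennreal (2 * c) * (ennreal ((1/2) ^ Suc k) * ennreal (1 / c))"
          using c by (metis ennreal_mult'' less_imp_le mult_pos_pos zero_le_divide_1_iff zero_le_mult_iff zero_le_numeral zero_le_power)
        then show "ennreal ((1/2) ^ k) * maxf (m k) t = ennreal (2 * c) * (ennreal ((1/2) ^ Suc k) * m (Suc k) t)"
          by (simp only: mS mult.assoc)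
      qed
      also have "\<dots> = ennreal (2 * c) * (\<Sum>k. ennreal ((1/2) ^ Suc k) * m (Suc k) t)"
        by (rule ennreal_suminf_cmult)
      also have "(\<Sum>k. ennreal ((1/2) ^ Suc k) * m (Suc k) t) \<le> H t"
        unfolding H_def
        by (subst (2) suminf_offset[of _ 1]) (auto simp del: power_Suc)
      finally show ?thesis
        unfolding c(3) by (simp add: mult_left_mono)
    qed
    have "(\<integral>\<^sup>+t. ennreal_powr (H t) p * ennreal (w t) \<partial>lborel)
      \<le> (\<integral>\<^sup>+t. ennreal (2 powr p) * (\<Sum>k. ennreal ((1/2) ^ Suc k) * ennreal_powr (m k t) p) * ennreal (w t) \<partial>lborel)"
      unfolding H_def by (intro nn_integral_mono mult_right_mono ennreal_powr_suminf_le p) auto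
    also have "\<dots> = (\<integral>\<^sup>+t. ennreal (2 powr p) * (\<Sum>k. ennreal ((1/2) ^ Suc k) * (ennreal_powr (m k t) p * ennreal (w t))) \<partial>lborel)"
      by (simp only: mult.assoc flip: ennreal_suminf_multc)
    also have "\<dots> = ennreal (2 powr p) * (\<Sum>k. ennreal ((1/2) ^ Suc k) * (\<integral>\<^sup>+t. ennreal_powr (m k t) p * ennreal (w t) \<partial>lborel))"
      by (simp add: nn_integral_cmult nn_integral_suminf del: power_Suc)
    also have "\<dots> \<le> ennreal (2 powr p) * (\<Sum>k. ennreal ((1/2) ^ Suc k) * (\<integral>\<^sup>+t. ennreal_powr (f t) p * ennreal (w t) \<partial>lborel))"
      by (intro mult_left_mono suminf_le mint) auto
    also have "\<dots> = ennreal (2 powr p) * ((\<Sum>k. ennreal ((1/2) ^ Suc k)) * (\<integral>\<^sup>+t. ennreal_powr (f t) p * ennreal (w t) \<partial>lborel))"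
      by (simp only: ennreal_suminf_multc)
    also have "(\<Sum>k. ennreal ((1/2) ^ Suc k)) = ennreal 1"
      by (rule suminf_ennreal_eq[OF _ power_half_series]) (rule zero_le_power, simp)
    finally show "(\<integral>\<^sup>+t. ennreal_powr (H t) p * ennreal (w t) \<partial>lborel)
       \<le> ennreal (2 powr p) * (\<integral>\<^sup>+t. ennreal_powr (f t) p * ennreal (w t) \<partial>lborel)"
      by simp
  qed
qed

text \<open>The hypothesis on \<open>maxf H\<close> is Muckenhoupt's \<open>A\<^sub>1\<close> condition.\<close>
lemma maxf_average:
  assumes H: "H \<in> borel_measurable borel" "\<And>t. maxf H t \<le> ennreal c * H t" "\<And>t. 0 < H t"
    and c: "c > 0" and fin: "AE t in lborel. H t < top" and I: "I \<in> rat_intervals" and L: "emeasure lborel I = ennreal L" "L > 0"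
  obtains a where "a > 0" "(\<integral>\<^sup>+t\<in>I. H t \<partial>lborel) = ennreal (a * L)" "\<And>t. t \<in> I \<Longrightarrow> ennreal (a / c) \<le> H t"
proof -
  let ?J = "\<integral>\<^sup>+t\<in>I. H t \<partial>lborel"
  have le: "?J / ennreal L \<le> ennreal c * H t" if "t \<in> I" for t
  proof -
    have "?J / ennreal L * indicator I t \<le> maxf H t"
      unfolding interval_maximal_def L(1)[symmetric] by (rule SUP_upper[OF I])
    then show ?thesis using H(2)[of t] that by (simp add: order_trans)
  qed
  have "\<exists>t\<in>I. H t < top"
  proof (rule ccontr)
    assume "\<not> ?thesis"
    then have "AE t in lborel. t \<notin> I"
      using fin by (auto elim!: eventually_mono)
    then have "emeasure lborel I = 0"
      using rat_intervals_borel[OF I] by (subst (asm) AE_iff_measurable[OF _ refl]) auto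
    then show False using L by simp
  qed
  then obtain t where "t \<in> I" "H t < top" by auto
  then have "?J / ennreal L < top"
    using le[of t] by (auto simp: ennreal_mult_less_top intro: le_less_trans)
  then have "?J < top" using L by (auto simp: ennreal_divide_eq_top_iff less_top[symmetric])
  moreover have "0 < ?J" by (rule nn_integral_interval_pos[OF H(1,3) I])
  ultimately obtain b where b: "?J = ennreal b" "b > 0" by (cases ?J) auto
  show ?thesis
  proof (rule that[of "b / L"])
    show "ennreal (b / L / c) \<le> H t" if "t \<in> I" for t
    proof -
      have "ennreal (1 / c) * (?J / ennreal L) \<le> ennreal (1 / c) * (ennreal c * H t)"
        by (intro mult_left_mono le that) auto
      also have "\<dots> = H t"
        using c by (simp flip: ennreal_mult mult.assoc)
      also have "ennreal (1 / c) * (?J / ennreal L) = ennreal (b / L / c)"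
        using b L c by (simp add: divide_ennreal flip: ennreal_mult)
      finally show ?thesis .
    qed
  qed (use b L in auto)
qed

text \<open>Every point lies in arbitrarily large intervals, some of which meet the mass of
  \<open>H\<close>. For an A_1 majorant this forces strict positivity everywhere, even where the
  majorized function vanishes.\<close>

lemma maxf_pos:
  assumes [measurable]: "H \<in> borel_measurable borel" and "(\<integral>\<^sup>+t. H t \<partial>lborel) \<noteq> 0"
  shows "0 < maxf H t"
proof (rule ccontr)
  assume "\<not> 0 < maxf H t"
  then have M0: "maxf H t = 0" by simp
  obtain k where k: "\<bar>t\<bar> < real k" using reals_Archimedean2 by blast
  define J where "J n = {- real (n + k)<..<real (n + k)}" for n
  have "AE x in lborel. H x * indicator (J n) x = 0" for n
  proof -
    have I: "J n \<in> rat_intervals"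
      unfolding rat_intervals_def J_def
      by (intro CollectI exI[of _ "- real (n + k)"] exI[of _ "real (n + k)"] conjI refl) (use k in auto)
    note rat_intervals_borel[OF I, measurable]
    have "(\<integral>\<^sup>+x\<in>J n. H x \<partial>lborel) / emeasure lborel (J n) * indicator (J n) t \<le> maxf H t"
      unfolding interval_maximal_def by (rule SUP_upper[OF I])
    moreover have "t \<in> J n" using k by (auto simp: J_def)
    moreover have "emeasure lborel (J n) \<noteq> top" by (simp add: J_def)
    ultimately have "(\<integral>\<^sup>+x\<in>J n. H x \<partial>lborel) = 0"
      using M0 by simp
    then show ?thesis by (subst (asm) nn_integral_0_iff_AE) auto
  qed
  then have "AE x in lborel. \<forall>n. H x * indicator (J n) x = 0"
    by (intro AE_all_countable[THEN iffD2] allI)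
  then have "AE x in lborel. H x = 0"
  proof eventually_elim
    case (elim x)
    obtain n where "\<bar>x\<bar> < real n" using reals_Archimedean2 by blast
    then have "x \<in> J n" by (auto simp: J_def)
    then show ?case using elim[rule_format, of n] by simp
  qed
  then show False using assms(2) by (simp add: nn_integral_0_iff_AE)
qed

text \<open>The constant that \<open>Ap_weight_quotient\<close> yields for the two majorants built
  in \<open>extrapolation\<close>. The maximum with \<open>1\<close> admits the constant weight
  \<open>1\<close>, called for when \<open>F\<close> vanishes almost everywhere.\<close>

definition extrapolation_const :: "real \<Rightarrow> real \<Rightarrow> real \<Rightarrow> real" where
  "extrapolation_const q p A = max 1 (rubio_const p A powr (q - 1)
     * rubio_const (p / (p - 1)) (A powr (1 / (p - 1))))"

lemma Ap_weight_1: "q > 1 \<Longrightarrow> A \<ge> 1 \<Longrightarrow> Ap_weight q A (\<lambda>_. 1)"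
  unfolding Ap_weight_def
proof (intro conjI allI ballI)
  fix I assume q: "q > 1" "A \<ge> 1" and I: "I \<in> rat_intervals"
  obtain L where L: "L > 0" "emeasure lborel I = ennreal L" by (rule emeasure_rat_interval[OF I])
  have "(\<integral>\<^sup>+t\<in>I. ennreal 1 \<partial>lborel) = ennreal L"
    using L rat_intervals_borel[OF I] by simp
  moreover have "L * L powr (q - 1) = L powr q" using L by (simp add: powr_mult_base)
  moreover have "L powr q \<le> A * L powr q" using q mult_right_mono[of 1 A "L powr q"] by simp
  ultimately show "(\<integral>\<^sup>+t\<in>I. ennreal 1 \<partial>lborel) * ennreal_powr (\<integral>\<^sup>+t\<in>I. ennreal (1 powr (- 1 / (q - 1))) \<partial>lborel) (q - 1)
       \<le> ennreal A * ennreal_powr (emeasure lborel I) q"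
    using L q by (simp add: ennreal_powr_ennreal flip: ennreal_mult)
qed auto

lemma AE_less_top_of_weighted:
  assumes [measurable]: "H \<in> borel_measurable borel" "w \<in> borel_measurable borel" and "\<And>t. 0 < w t"
    and "(\<integral>\<^sup>+t. ennreal_powr (H t) p * ennreal (w t) \<partial>lborel) < top"
  shows "AE t in lborel. H t < top"
proof -
  have "AE t in lborel. ennreal_powr (H t) p * ennreal (w t) \<noteq> top"
    using nn_integral_PInf_AE[of "\<lambda>t. ennreal_powr (H t) p * ennreal (w t)" lborel] assms(4) by auto
  then show ?thesis
  proof eventually_elim
    case (elim t)
    then show ?case using assms(3)[of t] by (cases "H t") (auto simp: ennreal_top_mult)
  qed
qed

text \<open>The elementary half of Jones's factorization theorem. In each of the two integrals the
  factor with negative exponent is estimated through its A_1 lower bound, average over constant, and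
  the other factor is integrated exactly; the averages then cancel.\<close>

lemma Ap_weight_quotient:
  assumes q: "q > 1" and c: "c1 > 0" "c2 > 0"
    and [measurable]: "H1 \<in> borel_measurable borel" "H2 \<in> borel_measurable borel"
    and M: "\<And>t. maxf H1 t \<le> ennreal c1 * H1 t" "\<And>t. maxf H2 t \<le> ennreal c2 * H2 t"
    and pos: "\<And>t. 0 < H1 t" "\<And>t. 0 < H2 t"
    and fin: "AE t in lborel. H1 t < top" "AE t in lborel. H2 t < top"
    and A: "c1 powr (q - 1) * c2 \<le> A"
  obtains v where "Ap_weight q A v"
    "AE t in lborel. H1 t < top \<and> H2 t < top \<and> v t = enn2real (H1 t) powr (1 - q) * enn2real (H2 t)"
proof -
  \<comment> \<open>On the null set where a majorant is infinite, the value \<open>1\<close> keeps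
    \<open>v\<close> real and positive, as \<open>Ap_weight\<close> demands at every point.\<close>
  define v where "v t = (if H1 t < top \<and> H2 t < top then enn2real (H1 t) powr (1 - q) * enn2real (H2 t) else 1)" for t
  have [measurable]: "v \<in> borel_measurable borel" unfolding v_def by measurable
  have vpos: "0 < v t" for t
    using pos[of t] by (auto simp: v_def enn2real_positive_iff less_imp_neq[symmetric])
  have ae: "AE t in lborel. H1 t < top \<and> H2 t < top \<and> v t = enn2real (H1 t) powr (1 - q) * enn2real (H2 t)"
    using fin by eventually_elim (simp add: v_def)
  have "(\<integral>\<^sup>+t\<in>I. ennreal (v t) \<partial>lborel) * ennreal_powr (\<integral>\<^sup>+t\<in>I. ennreal (v t powr (- 1 / (q - 1))) \<partial>lborel) (q - 1)
       \<le> ennreal A * ennreal_powr (emeasure lborel I) q" if I: "I \<in> rat_intervals" for I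
  proof -
    note rat_intervals_borel[OF I, measurable]
    obtain L where L: "L > 0" "emeasure lborel I = ennreal L" by (rule emeasure_rat_interval[OF I])
    obtain a1 where a1: "a1 > 0" "(\<integral>\<^sup>+t\<in>I. H1 t \<partial>lborel) = ennreal (a1 * L)" "\<And>t. t \<in> I \<Longrightarrow> ennreal (a1 / c1) \<le> H1 t"
      using maxf_average[of H1 c1 I L] M pos c fin I L by auto
    obtain a2 where a2: "a2 > 0" "(\<integral>\<^sup>+t\<in>I. H2 t \<partial>lborel) = ennreal (a2 * L)" "\<And>t. t \<in> I \<Longrightarrow> ennreal (a2 / c2) \<le> H2 t"
      using maxf_average[of H2 c2 I L] M pos c fin I L by auto
    have "(\<integral>\<^sup>+t\<in>I. ennreal (v t) \<partial>lborel) \<le> (\<integral>\<^sup>+t. ennreal ((a1 / c1) powr (1 - q)) * (H2 t * indicator I t) \<partial>lborel)"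
    proof (rule nn_integral_mono_AE, use ae in eventually_elim)
      case (elim t)
      show ?case
      proof (cases "t \<in> I")
        case True
        obtain h1 h2 where h: "H1 t = ennreal h1" "H2 t = ennreal h2" "h1 \<ge> 0" "h2 \<ge> 0"
          using elim by (cases "H1 t"; cases "H2 t") auto
        have "a1 / c1 \<le> h1" using a1(3)[OF True] h by simp
        then have "h1 powr (1 - q) \<le> (a1 / c1) powr (1 - q)"
          using q a1 c by (intro powr_mono2') auto
        then have "h1 powr (1 - q) * h2 \<le> (a1 / c1) powr (1 - q) * h2"
          using h by (intro mult_right_mono) auto
        then show ?thesis using True elim h by (simp flip: ennreal_mult)
      qed simp
    qed
    also have "\<dots> = ennreal ((a1 / c1) powr (1 - q) * (a2 * L))"
      using a1 a2 L c by (simp add: nn_integral_cmult ennreal_mult)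
    finally have V1: "(\<integral>\<^sup>+t\<in>I. ennreal (v t) \<partial>lborel) \<le> ennreal ((a1 / c1) powr (1 - q) * (a2 * L))" .
    have e: "- 1 / (q - 1) \<le> 0" "(1 - q) * (- 1 / (q - 1)) = 1"
      using q by (simp_all add: field_simps)
    have "(\<integral>\<^sup>+t\<in>I. ennreal (v t powr (- 1 / (q - 1))) \<partial>lborel)
       \<le> (\<integral>\<^sup>+t. ennreal ((a2 / c2) powr (- 1 / (q - 1))) * (H1 t * indicator I t) \<partial>lborel)"
    proof (rule nn_integral_mono_AE, use ae in eventually_elim)
      case (elim t)
      show ?case
      proof (cases "t \<in> I")
        case True
        obtain h1 h2 where h: "H1 t = ennreal h1" "H2 t = ennreal h2" "h1 \<ge> 0" "h2 \<ge> 0"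
          using elim by (cases "H1 t"; cases "H2 t") auto
        have "a2 / c2 \<le> h2" using a2(3)[OF True] h by simp
        then have "h2 powr (- 1 / (q - 1)) \<le> (a2 / c2) powr (- 1 / (q - 1))"
          using e a2 c by (intro powr_mono2') auto
        then have "h1 * h2 powr (- 1 / (q - 1)) \<le> (a2 / c2) powr (- 1 / (q - 1)) * h1"
          using h by (subst mult.commute) (intro mult_right_mono, auto)
        moreover have "v t powr (- 1 / (q - 1)) = h1 * h2 powr (- 1 / (q - 1))"
        proof -
          have "v t = h1 powr (1 - q) * h2" using elim h by simp
          then show ?thesis
            using h by (simp only: powr_mult powr_powr e) simp
        qed
        ultimately show ?thesis using True h by (simp flip: ennreal_mult)
      qed simp
    qed
    also have "\<dots> = ennreal ((a2 / c2) powr (- 1 / (q - 1)) * (a1 * L))"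
      using a1 a2 L c by (simp add: nn_integral_cmult ennreal_mult)
    finally have "ennreal_powr (\<integral>\<^sup>+t\<in>I. ennreal (v t powr (- 1 / (q - 1))) \<partial>lborel) (q - 1)
      \<le> ennreal_powr (ennreal ((a2 / c2) powr (- 1 / (q - 1)) * (a1 * L))) (q - 1)"
      using q by (intro ennreal_powr_mono) auto
    also have "\<dots> = ennreal ((a2 / c2) powr (- 1) * (a1 * L) powr (q - 1))"
    proof -
      have e': "- 1 / (q - 1) * (q - 1) = - 1" using q by simp
      show ?thesis
        using a1 a2 L c by (subst ennreal_powr_ennreal) (simp, simp only: powr_mult powr_powr e')
    qed
    finally have V2: "ennreal_powr (\<integral>\<^sup>+t\<in>I. ennreal (v t powr (- 1 / (q - 1))) \<partial>lborel) (q - 1)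
      \<le> ennreal ((a2 / c2) powr (- 1) * (a1 * L) powr (q - 1))" .
    have "(a1 / c1) powr (1 - q) * (a2 * L) * ((a2 / c2) powr (- 1) * (a1 * L) powr (q - 1)) = c1 powr (q - 1) * c2 * L powr q"
    proof -
      have "(a1 / c1) powr (1 - q) = c1 powr (q - 1) / a1 powr (q - 1)"
        using powr_minus_divide[of "a1 / c1" "q - 1"] a1 c by (simp add: powr_divide)
      moreover have "(a2 / c2) powr (- 1) = c2 / a2"
        using a2 c by (simp add: powr_minus_divide)
      moreover have "L powr q = L * L powr (q - 1)" using L by (simp add: powr_mult_base)
      ultimately show ?thesis
        using a1 a2 c L by (simp add: powr_mult field_simps)
    qed
    also have "\<dots> \<le> A * L powr q" using A by (intro mult_right_mono) auto
    finally have r: "(a1 / c1) powr (1 - q) * (a2 * L) * ((a2 / c2) powr (- 1) * (a1 * L) powr (q - 1)) \<le> A * L powr q" .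
    have "(\<integral>\<^sup>+t\<in>I. ennreal (v t) \<partial>lborel) * ennreal_powr (\<integral>\<^sup>+t\<in>I. ennreal (v t powr (- 1 / (q - 1))) \<partial>lborel) (q - 1)
      \<le> ennreal ((a1 / c1) powr (1 - q) * (a2 * L)) * ennreal ((a2 / c2) powr (- 1) * (a1 * L) powr (q - 1))"
      by (intro mult_mono V1 V2) auto
    also have "\<dots> = ennreal ((a1 / c1) powr (1 - q) * (a2 * L) * ((a2 / c2) powr (- 1) * (a1 * L) powr (q - 1)))"
      using a1 a2 c L by (intro ennreal_mult[symmetric]) auto
    also have "\<dots> \<le> ennreal (A * L powr q)" by (intro ennreal_leI r)
    also have "\<dots> = ennreal A * ennreal_powr (emeasure lborel I) q"
      using L by (simp add: ennreal_mult'' ennreal_powr_ennreal)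
    finally show ?thesis .
  qed
  then have "Ap_weight q A v" using vpos by (auto simp: Ap_weight_def)
  then show ?thesis using that ae by blast
qed

text \<open>Both \<open>F\<close> and the dual function of (a truncation of) \<open>G\<close>
  are majorized by \<open>A\<^sub>1\<close> weights, whose quotient serves as the \<open>A\<^sub>q\<close> weight.\<close>
lemma extrapolation:
  assumes q: "q > 1" and p: "p > 1" and A: "A > 0" and B: "B > 0" and w: "Ap_weight p A w"
    and [measurable]: "F \<in> borel_measurable borel" "G \<in> borel_measurable borel"
    and FG: "\<And>v. Ap_weight q (extrapolation_const q p A) v \<Longrightarrow>
      (\<integral>\<^sup>+t. ennreal_powr (G t) q * ennreal (v t) \<partial>lborel) \<le> ennreal B * (\<integral>\<^sup>+t. ennreal_powr (F t) q * ennreal (v t) \<partial>lborel)"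
  shows "(\<integral>\<^sup>+t. ennreal_powr (G t) p * ennreal (w t) \<partial>lborel)
    \<le> ennreal ((4 * B powr (1 / q)) powr p) * (\<integral>\<^sup>+t. ennreal_powr (F t) p * ennreal (w t) \<partial>lborel)"
proof -
  let ?X = "\<integral>\<^sup>+t. ennreal_powr (F t) p * ennreal (w t) \<partial>lborel"
  define p' where "p' = p / (p - 1)"
  define A' where "A' = A powr (1 / (p - 1))"
  define s where "s t = w t powr (- 1 / (p - 1))" for t
  have p': "p' > 1" "(p - 1) * p' = p" "1 / p' = 1 - 1 / p" "1 - p' = - 1 / (p - 1)"
    using p by (auto simp: p'_def field_simps)
  have A': "A' > 0" using A by (simp add: A'_def)
  have s: "Ap_weight p' A' s"
    unfolding p'_def A'_def s_def by (rule Ap_weight_dual[OF p A w])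
  have [measurable]: "w \<in> borel_measurable borel" "s \<in> borel_measurable borel"
    and pos: "\<And>t. 0 < w t" "\<And>t. 0 < s t"
    using w s by (auto simp: Ap_weight_def)
  have w0: "ennreal (w t) \<noteq> 0" "ennreal (s t) \<noteq> 0" for t using pos[of t] by auto
  define c1 where "c1 = rubio_const p A"
  define c2 where "c2 = rubio_const p' A'"
  have c: "c1 > 0" "c2 > 0" unfolding c1_def c2_def using rubio_const_pos p p' A A' by auto
  have K: "c1 powr (q - 1) * c2 \<le> extrapolation_const q p A" "1 \<le> extrapolation_const q p A"
    unfolding extrapolation_const_def c1_def c2_def p'_def A'_def by auto
  \<comment> \<open>Truncation in height and in space makes the left-hand integral finite, since
    \<open>w\<close> is integrable over bounded intervals; it can then be absorbed.\<close>
  define Gn where "Gn n t = min (G t) (of_nat n) * indicator {- real n<..<real n} t" for n t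
  have [measurable]: "Gn n \<in> borel_measurable borel" for n unfolding Gn_def by measurable
  have Gn_le: "Gn n t \<le> G t" for n t by (auto simp: Gn_def indicator_def)
  have main: "(\<integral>\<^sup>+t. ennreal_powr (Gn n t) p * ennreal (w t) \<partial>lborel) \<le> ennreal ((4 * B powr (1 / q)) powr p) * ?X"
    (is "?Y \<le> _") for n
  proof -
    consider "?X = top" | "?X = 0" | "?Y = 0" | "?X \<noteq> top" "?X \<noteq> 0" "?Y \<noteq> 0" by blast
    then show ?thesis
    proof cases
      case 1
      then show ?thesis using B by (simp add: ennreal_mult_top)
    next
      \<comment> \<open>The majorant of \<open>F\<close> would vanish almost everywhere too and
        could not be inverted, so the hypothesis is used with the weight \<open>1\<close>
        instead.\<close>
      case 2
      then have "AE t in lborel. F t = 0"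
        by (subst (asm) nn_integral_0_iff_AE) (auto simp: w0)
      then have "(\<integral>\<^sup>+t. ennreal_powr (F t) q * ennreal 1 \<partial>lborel) = 0"
        by (subst nn_integral_0_iff_AE) auto
      then have "(\<integral>\<^sup>+t. ennreal_powr (G t) q * ennreal 1 \<partial>lborel) = 0"
        using FG[OF Ap_weight_1[OF q K(2)]] by simp
      then have "AE t in lborel. G t = 0"
        by (subst (asm) nn_integral_0_iff_AE) auto
      then have "AE t in lborel. Gn n t = 0"
        by eventually_elim (metis Gn_le le_zero_eq)
      then have "?Y = 0"
        by (subst nn_integral_0_iff_AE) auto
      then show ?thesis by simp
    next
      case 3
      then show ?thesis by simp
    next
      case 4
      have Yfin: "?Y < top"
      proof (cases "n = 0")
        case False
        have I: "{- real n<..<real n} \<in> rat_intervals"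
          unfolding rat_intervals_def
          by (intro CollectI exI[of _ "- real n"] exI[of _ "real n"] conjI refl) (use False in auto)
        have "?Y \<le> (\<integral>\<^sup>+t. ennreal_powr (of_nat n) p * (ennreal (w t) * indicator {- real n<..<real n} t) \<partial>lborel)"
        proof (rule nn_integral_mono)
          fix t show "ennreal_powr (Gn n t) p * ennreal (w t) \<le> ennreal_powr (of_nat n) p * (ennreal (w t) * indicator {- real n<..<real n} t)"
            using p unfolding Gn_def
            by (cases "t \<in> {- real n<..<real n}") (auto intro!: mult_right_mono ennreal_powr_mono)
        qed
        also have "\<dots> = ennreal_powr (of_nat n) p * (\<integral>\<^sup>+t\<in>{- real n<..<real n}. ennreal (w t) \<partial>lborel)"
          by (rule nn_integral_cmult) measurable
        also have "\<dots> < top"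
          using Ap_weight_integrals(2)[OF p A w I] by (simp add: ennreal_mult_less_top of_nat_less_top)
        finally show ?thesis .
      qed (simp add: Gn_def)
      obtain H1 where H1: "H1 \<in> borel_measurable borel" "\<And>t. F t \<le> H1 t"
        "\<And>t. maxf H1 t \<le> ennreal c1 * H1 t"
        "(\<integral>\<^sup>+t. ennreal_powr (H1 t) p * ennreal (w t) \<partial>lborel) \<le> ennreal (2 powr p) * ?X"
        unfolding c1_def by (rule rubio_de_francia[OF p A w \<open>F \<in> borel_measurable borel\<close>]) blast
      \<comment> \<open>The function dual to \<open>Gn n\<close>: its product with
        \<open>Gn n\<close> is the left integrand, and the integral of its power \<open>p'\<close>
        against the dual weight is again \<open>?Y\<close>.\<close>
      define g where "g t = ennreal_powr (Gn n t) (p - 1) * ennreal (w t)" for t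
      have gm: "g \<in> borel_measurable borel" unfolding g_def by measurable
      obtain H2 where H2: "H2 \<in> borel_measurable borel" "\<And>t. g t \<le> H2 t"
        "\<And>t. maxf H2 t \<le> ennreal c2 * H2 t"
        "(\<integral>\<^sup>+t. ennreal_powr (H2 t) p' * ennreal (s t) \<partial>lborel) \<le> ennreal (2 powr p') * (\<integral>\<^sup>+t. ennreal_powr (g t) p' * ennreal (s t) \<partial>lborel)"
        unfolding c2_def by (rule rubio_de_francia[OF p'(1) A' s gm]) blast
      note [measurable] = H1(1) H2(1) gm
      have gint: "(\<integral>\<^sup>+t. ennreal_powr (g t) p' * ennreal (s t) \<partial>lborel) = ?Y"
      proof (rule nn_integral_cong)
        fix t
        have "w t powr p' * s t = w t powr (p' + (1 - p'))"
          unfolding s_def p'(4)[symmetric] by (rule powr_add[symmetric])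
        then have "w t powr p' * s t = w t" using pos(1)[of t] by simp
        then have "ennreal (w t powr p') * ennreal (s t) = ennreal (w t)"
          using pos[of t] by (simp flip: ennreal_mult)
        then show "ennreal_powr (g t) p' * ennreal (s t) = ennreal_powr (Gn n t) p * ennreal (w t)"
          using p' pos(1)[of t]
          by (simp add: g_def ennreal_powr_mult ennreal_powr_powr ennreal_powr_ennreal mult.assoc)
      qed
      have H1pos: "0 < H1 t" for t
      proof -
        have "(\<integral>\<^sup>+t. H1 t \<partial>lborel) \<noteq> 0"
        proof
          assume "(\<integral>\<^sup>+t. H1 t \<partial>lborel) = 0"
          then have "AE t in lborel. H1 t = 0" by (subst (asm) nn_integral_0_iff_AE) auto
          then have "AE t in lborel. F t = 0" by eventually_elim (metis H1(2) le_zero_eq)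
          then have "?X = 0" by (subst nn_integral_0_iff_AE) auto
          then show False using 4 by simp
        qed
        then have "0 < maxf H1 t" by (rule maxf_pos[OF H1(1)])
        then show ?thesis using H1(3)[of t] by (cases "H1 t = 0") (auto simp: zero_less_iff_neq_zero)
      qed
      have H2pos: "0 < H2 t" for t
      proof -
        have "(\<integral>\<^sup>+t. H2 t \<partial>lborel) \<noteq> 0"
        proof
          assume "(\<integral>\<^sup>+t. H2 t \<partial>lborel) = 0"
          then have "AE t in lborel. H2 t = 0" by (subst (asm) nn_integral_0_iff_AE) auto
          then have "AE t in lborel. g t = 0" by eventually_elim (metis H2(2) le_zero_eq)
          then have "(\<integral>\<^sup>+t. ennreal_powr (g t) p' * ennreal (s t) \<partial>lborel) = 0"
            by (subst nn_integral_0_iff_AE) auto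
          then show False using 4 gint by simp
        qed
        then have "0 < maxf H2 t" by (rule maxf_pos[OF H2(1)])
        then show ?thesis using H2(3)[of t] by (cases "H2 t = 0") (auto simp: zero_less_iff_neq_zero)
      qed
      have fin1: "AE t in lborel. H1 t < top"
      proof (rule AE_less_top_of_weighted[OF H1(1) _ pos(1), where p = p])
        show "(\<integral>\<^sup>+t. ennreal_powr (H1 t) p * ennreal (w t) \<partial>lborel) < top"
          by (rule le_less_trans[OF H1(4)]) (use 4(1) in \<open>simp add: ennreal_mult_less_top less_top\<close>)
      qed measurable
      have fin2: "AE t in lborel. H2 t < top"
      proof (rule AE_less_top_of_weighted[OF H2(1) _ pos(2), where p = p'])
        show "(\<integral>\<^sup>+t. ennreal_powr (H2 t) p' * ennreal (s t) \<partial>lborel) < top"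
          by (rule le_less_trans[OF H2(4)]) (use Yfin in \<open>simp add: gint ennreal_mult_less_top\<close>)
      qed measurable
      obtain v where v: "Ap_weight q (extrapolation_const q p A) v"
        "AE t in lborel. H1 t < top \<and> H2 t < top \<and> v t = enn2real (H1 t) powr (1 - q) * enn2real (H2 t)"
        by (rule Ap_weight_quotient[OF q c H1(1) H2(1) H1(3) H2(3) H1pos H2pos fin1 fin2 K(1)]) blast
      have [measurable]: "v \<in> borel_measurable borel" using v(1) by (simp add: Ap_weight_def)
      let ?J = "\<integral>\<^sup>+t. H1 t * H2 t \<partial>lborel"
      \<comment> \<open>Hoelder's inequality applies because the powers of \<open>w\<close> and
        \<open>s\<close> cancel; the factor \<open>4\<close> is \<open>2\<close> from each of the
        two majorants.\<close>
      have J: "?J \<le> 4 * (ennreal_powr ?X (1 / p) * ennreal_powr ?Y (1 - 1 / p))"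
      proof -
        have "?J = (\<integral>\<^sup>+t. ennreal_powr (ennreal_powr (H1 t) p * ennreal (w t)) (1 / p)
            * ennreal_powr (ennreal_powr (H2 t) p' * ennreal (s t)) (1 / p') \<partial>lborel)"
        proof (rule nn_integral_cong)
          fix t
          have e: "1 / p + - 1 / (p - 1) * (1 / p') = 0" unfolding p'(3) using p by (simp add: field_simps)
          have "w t powr (1 / p) * s t powr (1 / p') = w t powr (1 / p + - 1 / (p - 1) * (1 / p'))"
            unfolding s_def powr_powr by (rule powr_add[symmetric])
          also have "\<dots> = 1" unfolding e using pos(1)[of t] by simp
          finally have "ennreal (w t powr (1 / p)) * ennreal (s t powr (1 / p')) = 1"
            by (simp flip: ennreal_mult)
          then have "H1 t * H2 t = H1 t * (ennreal (w t powr (1 / p)) * ennreal (s t powr (1 / p'))) * H2 t"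
            by simp
          then show "H1 t * H2 t = ennreal_powr (ennreal_powr (H1 t) p * ennreal (w t)) (1 / p)
            * ennreal_powr (ennreal_powr (H2 t) p' * ennreal (s t)) (1 / p')"
            using p p'(1) pos[of t]
            by (simp add: ennreal_powr_mult ennreal_powr_powr ennreal_powr_ennreal mult_ac)
        qed
        also have "\<dots> \<le> ennreal_powr (\<integral>\<^sup>+t. ennreal_powr (H1 t) p * ennreal (w t) \<partial>lborel) (1 / p)
           * ennreal_powr (\<integral>\<^sup>+t. ennreal_powr (H2 t) p' * ennreal (s t) \<partial>lborel) (1 / p')"
          using p p'(1,3) by (intro nn_integral_Holder) auto
        also have "\<dots> \<le> ennreal_powr (ennreal (2 powr p) * ?X) (1 / p) * ennreal_powr (ennreal (2 powr p') * ?Y) (1 / p')"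
          using p p'(1) H1(4) H2(4) unfolding gint by (intro mult_mono ennreal_powr_mono) auto
        also have "\<dots> = 4 * (ennreal_powr ?X (1 / p) * ennreal_powr ?Y (1 / p'))"
        proof -
          have "ennreal_powr (ennreal (2 powr p) * ?X) (1 / p) = 2 * ennreal_powr ?X (1 / p)"
            "ennreal_powr (ennreal (2 powr p') * ?Y) (1 / p') = 2 * ennreal_powr ?Y (1 / p')"
            using p p'(1) by (simp_all add: ennreal_powr_mult ennreal_powr_ennreal powr_powr)
          moreover have "2 * x * (2 * y) = 4 * (x * y)" for x y :: ennreal
          proof -
            have "(2::ennreal) * 2 = 4" by simp
            then show ?thesis by (metis mult.assoc mult.left_commute)
          qed
          ultimately show ?thesis by simp
        qed
        finally show ?thesis unfolding p'(3) .
      qed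
      \<comment> \<open>As \<open>F\<close> is below \<open>H1\<close>, multiplication by
        \<open>v\<close> turns its power \<open>q\<close> into at most
        \<open>H1 * H2\<close>.\<close>
      have Fv: "(\<integral>\<^sup>+t. ennreal_powr (F t) q * ennreal (v t) \<partial>lborel) \<le> ?J"
      proof (rule nn_integral_mono_AE, use v(2) in eventually_elim)
        case (elim t)
        obtain h1 h2 where h: "H1 t = ennreal h1" "H2 t = ennreal h2" "h1 \<ge> 0" "h2 \<ge> 0"
          using elim by (cases "H1 t"; cases "H2 t") auto
        have "ennreal_powr (F t) q * ennreal (v t) \<le> ennreal_powr (H1 t) q * ennreal (v t)"
          using q H1(2) by (intro mult_right_mono ennreal_powr_mono) auto
        also have "\<dots> = ennreal (h1 powr q * (h1 powr (1 - q) * h2))"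
          using elim h by (simp add: ennreal_powr_ennreal flip: ennreal_mult)
        also have "h1 powr q * (h1 powr (1 - q) * h2) = h1 powr (q + (1 - q)) * h2"
          unfolding powr_add by simp
        also have "ennreal \<dots> = H1 t * H2 t" using h by (simp add: ennreal_mult)
        finally show ?case .
      qed
      \<comment> \<open>The powers of \<open>H1\<close> in \<open>v\<close> and in
        \<open>H1 * H2\<close> cancel, leaving \<open>G * H2\<close>, which dominates
        \<open>Gn n * g\<close>.\<close>
      have "?Y \<le> (\<integral>\<^sup>+t. ennreal_powr (ennreal_powr (G t) q * ennreal (v t)) (1 / q) * ennreal_powr (H1 t * H2 t) (1 - 1 / q) \<partial>lborel)"
      proof (rule nn_integral_mono_AE, use v(2) in eventually_elim)
        case (elim t)
        obtain h1 h2 where h: "H1 t = ennreal h1" "H2 t = ennreal h2" "h1 \<ge> 0" "h2 \<ge> 0"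
          using elim by (cases "H1 t"; cases "H2 t") auto
        have hp: "h1 > 0" "h2 > 0" using H1pos[of t] H2pos[of t] h by auto
        have "ennreal_powr (Gn n t) p * ennreal (w t) = Gn n t * g t"
          using ennreal_powr_add[of "Gn n t" 1 "p - 1"] by (simp add: g_def mult.assoc)
        also have "\<dots> \<le> G t * H2 t" by (intro mult_mono Gn_le H2(2)) auto
        also have "\<dots> = G t * ennreal ((h1 powr (1 - q) * h2) powr (1 / q) * (h1 * h2) powr (1 - 1 / q))"
        proof -
          have "(h1 powr (1 - q) * h2) powr (1 / q) * (h1 * h2) powr (1 - 1 / q)
              = h1 powr ((1 - q) * (1 / q) + (1 - 1 / q)) * h2 powr (1 / q + (1 - 1 / q))"
            unfolding powr_add powr_mult powr_powr by simp
          also have "(1 - q) * (1 / q) + (1 - 1 / q) = 0" using q by (simp add: field_simps)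
          finally show ?thesis using hp h by simp
        qed
        also have "\<dots> = ennreal_powr (ennreal_powr (G t) q * ennreal (v t)) (1 / q) * ennreal_powr (H1 t * H2 t) (1 - 1 / q)"
        proof -
          have "v t = h1 powr (1 - q) * h2" using elim h by simp
          moreover have "H1 t * H2 t = ennreal (h1 * h2)" using h by (simp add: ennreal_mult)
          ultimately show ?thesis
            using q h by (simp add: ennreal_powr_mult ennreal_powr_powr ennreal_powr_ennreal mult.assoc flip: ennreal_mult)
        qed
        finally show ?case .
      qed
      also have "\<dots> \<le> ennreal_powr (\<integral>\<^sup>+t. ennreal_powr (G t) q * ennreal (v t) \<partial>lborel) (1 / q) * ennreal_powr ?J (1 - 1 / q)"
        using q by (intro nn_integral_Holder) auto
      also have "\<dots> \<le> ennreal_powr (ennreal B * ?J) (1 / q) * ennreal_powr ?J (1 - 1 / q)"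
        using q order_trans[OF FG[OF v(1)] mult_left_mono[OF Fv]] by (intro mult_right_mono ennreal_powr_mono) auto
      also have "\<dots> = ennreal (B powr (1 / q)) * ?J"
        using q B by (simp add: ennreal_powr_mult ennreal_powr_ennreal mult.assoc flip: ennreal_powr_add)
      also have "\<dots> \<le> ennreal (B powr (1 / q)) * (4 * (ennreal_powr ?X (1 / p) * ennreal_powr ?Y (1 - 1 / p)))"
        by (intro mult_left_mono J) auto
      also have "\<dots> = (ennreal (4 * B powr (1 / q)) * ennreal_powr ?X (1 / p)) * ennreal_powr ?Y (1 - 1 / p)"
        by (simp add: ennreal_mult mult_ac)
      finally have "?Y \<le> ennreal_powr (ennreal (4 * B powr (1 / q)) * ennreal_powr ?X (1 / p)) p"
        using p Yfin by (intro ennreal_powr_absorb) auto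
      also have "\<dots> = ennreal ((4 * B powr (1 / q)) powr p) * ?X"
        using p B by (simp add: ennreal_powr_mult ennreal_powr_powr ennreal_powr_ennreal)
      finally show ?thesis .
    qed
  qed
  have inc: "Gn m t \<le> Gn n t" if "m \<le> n" for m n t
    using that unfolding Gn_def by (intro mult_mono min.mono) (auto simp: indicator_def)
  have "G t = (SUP n. Gn n t)" for t
  proof (rule antisym)
    obtain k where k: "\<bar>t\<bar> < real k" using reals_Archimedean2 by blast
    have Gn_eq: "Gn n t = min (G t) (of_nat n)" if "k \<le> n" for n
      using that k unfolding Gn_def by (auto simp: indicator_def)
    show "G t \<le> (SUP n. Gn n t)"
    proof (cases "G t")
      case (real r)
      obtain N where "r < real N" using reals_Archimedean2 by blast
      then have "r \<le> real (max N k)" by simp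
      then have "Gn (max N k) t = G t"
        unfolding Gn_eq[OF max.cobounded2] using real by (simp add: min_def)
      then show ?thesis by (metis SUP_upper UNIV_I)
    next
      case top
      have "of_nat N \<le> (SUP n. Gn n t)" for N
      proof -
        have "of_nat N \<le> Gn (max N k) t" unfolding Gn_eq[OF max.cobounded2] using top by simp
        also have "\<dots> \<le> (SUP n. Gn n t)" by (rule SUP_upper) simp
        finally show ?thesis .
      qed
      then have "(SUP N. of_nat N) \<le> (SUP n. Gn n t)" by (intro SUP_least) auto
      then show ?thesis unfolding ennreal_SUP_of_nat_eq_top by (rule order_trans[OF top_greatest])
    qed
    show "(SUP n. Gn n t) \<le> G t" by (intro SUP_least Gn_le)
  qed
  then have "(\<integral>\<^sup>+t. ennreal_powr (G t) p * ennreal (w t) \<partial>lborel)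
     = (\<integral>\<^sup>+t. (SUP n. ennreal_powr (Gn n t) p * ennreal (w t)) \<partial>lborel)"
    using p by (simp add: ennreal_powr_SUP SUP_mult_right_ennreal)
  also have "\<dots> = (SUP n. \<integral>\<^sup>+t. ennreal_powr (Gn n t) p * ennreal (w t) \<partial>lborel)"
    using p inc by (intro nn_integral_monotone_convergence_SUP)
      (auto simp: incseq_def le_fun_def intro!: mult_right_mono ennreal_powr_mono)
  also have "\<dots> \<le> ennreal ((4 * B powr (1 / q)) powr p) * ?X"
    by (intro SUP_least main)
  finally show ?thesis .
qed

subsection \<open>Nested norms and the maximal function in one coordinate\<close>

definition upd :: "'n \<Rightarrow> real ^ 'n \<Rightarrow> real \<Rightarrow> real ^ 'n" where
  "upd j x t = (\<chi> k. if k = j then t else x $ k)"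

text \<open>Still a function of the whole vector, though constant in coordinate \<open>j\<close>, so
  that partially integrated functions keep one type.\<close>

definition coord_norm :: "'n::finite \<Rightarrow> real \<Rightarrow> (real ^ 'n \<Rightarrow> ennreal) \<Rightarrow> real ^ 'n \<Rightarrow> ennreal" where
  "coord_norm j p F x = ennreal_powr (\<integral>\<^sup>+t. ennreal_powr (F (upd j x t)) p \<partial>lborel) (1 / p)"

text \<open>The root is taken after every integration, unlike in \<open>iterated_norm\<close>, which
  merges it with the next power. Coordinates outside the list remain parameters read from the
  point.\<close>

fun nested_norm :: "real ^ 'n \<Rightarrow> 'n::finite list \<Rightarrow> (real ^ 'n \<Rightarrow> ennreal) \<Rightarrow> real ^ 'n \<Rightarrow> ennreal" where
  "nested_norm p [] F = F"
| "nested_norm p (j # js) F = nested_norm p js (coord_norm j (p $ j) F)"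

lemma upd_nth [simp]: "upd j x t $ k = (if k = j then t else x $ k)"
  by (simp add: upd_def)

lemma upd_upd_same [simp]: "upd j (upd j x s) t = upd j x t"
  by (simp add: vec_eq_iff)

lemma upd_commute: "j \<noteq> k \<Longrightarrow> upd j (upd k x s) t = upd k (upd j x t) s"
  by (auto simp: vec_eq_iff)

lemma measurable_upd [measurable (raw)]:
  fixes f :: "'a \<Rightarrow> real ^ 'n::finite"
  assumes [measurable]: "f \<in> borel_measurable M" "g \<in> borel_measurable M"
  shows "(\<lambda>z. upd j (f z) (g z)) \<in> borel_measurable M"
proof -
  have "continuous_on UNIV (\<lambda>z :: (real ^ 'n) \<times> real. upd j (fst z) (snd z))"
    unfolding upd_def
  proof (rule continuous_on_vec_lambda)
    show "continuous_on UNIV (\<lambda>z :: (real ^ 'n) \<times> real. if k = j then snd z else fst z $ k)" for k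
      by (cases "k = j") (auto intro!: continuous_intros)
  qed
  then have "(\<lambda>z :: (real ^ 'n) \<times> real. upd j (fst z) (snd z)) \<in> borel_measurable (borel \<Otimes>\<^sub>M borel)"
    unfolding borel_prod by (rule borel_measurable_continuous_onI)
  then have "(\<lambda>z. upd j (fst (f z, g z)) (snd (f z, g z))) \<in> borel_measurable M"
    by (rule measurable_compose[rotated]) measurable
  then show ?thesis by simp
qed

lemma measurable_coord_norm [measurable]:
  assumes [measurable]: "F \<in> borel_measurable borel"
  shows "coord_norm j p F \<in> borel_measurable borel"
  unfolding coord_norm_def by measurable

lemma measurable_nested_norm [measurable]:
  "F \<in> borel_measurable borel \<Longrightarrow> nested_norm p js F \<in> borel_measurable borel"
  by (induction js arbitrary: F) auto

lemma nested_norm_append: "nested_norm p (as @ bs) F = nested_norm p bs (nested_norm p as F)"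
  by (induction as arbitrary: F) auto

lemma coord_norm_mono: "p > 0 \<Longrightarrow> (\<And>y. F y \<le> G y) \<Longrightarrow> coord_norm j p F x \<le> coord_norm j p G x"
  unfolding coord_norm_def by (intro ennreal_powr_mono nn_integral_mono) auto

lemma nested_norm_mono:
  "(\<And>j. p $ j > 0) \<Longrightarrow> (\<And>y. F y \<le> G y) \<Longrightarrow> nested_norm p js F x \<le> nested_norm p js G x"
proof (induction js arbitrary: F G)
  case (Cons j js)
  show ?case
    unfolding nested_norm.simps by (intro Cons.IH coord_norm_mono Cons.prems)
qed simp

lemma coord_norm_cmult:
  assumes p: "p > 0" and [measurable]: "F \<in> borel_measurable borel"
  shows "coord_norm j p (\<lambda>y. c * F y) x = c * coord_norm j p F x"
  using p by (simp add: coord_norm_def ennreal_powr_mult nn_integral_cmult ennreal_powr_powr)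

lemma nested_norm_cmult:
  assumes "\<And>j. p $ j > 0" and "F \<in> borel_measurable borel"
  shows "nested_norm p js (\<lambda>y. c * F y) x = c * nested_norm p js F x"
  using assms(2)
proof (induction js arbitrary: F)
  case (Cons j js)
  have "coord_norm j (p $ j) (\<lambda>y. c * F y) = (\<lambda>x. c * coord_norm j (p $ j) F x)"
    using assms(1) Cons.prems by (intro ext coord_norm_cmult) auto
  then show ?case using Cons by simp
qed simp

text \<open>\<open>iterated_norm\<close> carries a pending root \<open>1 / a\<close> along;
  extracting it gives a genuine norm at each stage. Lebesgue measure may be replaced by
  \<open>lborel\<close> because \<open>nn_integral_completion\<close> holds for arbitrary
  integrands.\<close>

lemma iterated_norm_eq_nested_norm:
  assumes "\<And>j. p $ j > 0" "a > 0"
  shows "iterated_norm p a js F = nested_norm p js (\<lambda>x. ennreal_powr (F x) (1 / a)) 0"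
  using assms(2)
proof (induction js arbitrary: a F)
  case (Cons j js)
  show ?case
    using assms(1)[of j] Cons.prems
    by (simp add: Cons.IH nn_integral_completion coord_norm_def[abs_def] ennreal_powr_powr upd_def)
qed simp

lemma mixed_norm_eq_nested_norm:
  assumes "\<And>j. p $ j > 0"
  shows "mixed_norm p F = nested_norm p (sorted_list_of_set UNIV) F 0"
  unfolding mixed_norm_def using iterated_norm_eq_nested_norm[of p 1] assms by simp

text \<open>Hoelder's inequality in one coordinate at a time, with exponents
  \<open>p $ j / ps i $ j\<close>, which add up to \<open>1\<close>. Components of \<open>p\<close>
  below \<open>1\<close> are covered, as the target norm demands.\<close>

lemma nested_norm_Holder:
  assumes I: "finite I" "I \<noteq> {}" and ps: "\<And>i j. i \<in> I \<Longrightarrow> ps i $ j > 0" "\<And>j. p $ j > 0"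
    and p: "\<And>j. 1 / p $ j = (\<Sum>i\<in>I. 1 / ps i $ j)"
    and F: "\<And>i. i \<in> I \<Longrightarrow> F i \<in> borel_measurable borel"
  shows "nested_norm p js (\<lambda>y. \<Prod>i\<in>I. F i y) x \<le> (\<Prod>i\<in>I. nested_norm (ps i) js (F i) x)"
  using F
proof (induction js arbitrary: F)
  case (Cons j js)
  have [measurable]: "F i \<in> borel_measurable borel" if "i \<in> I" for i using Cons.prems that by simp
  have "coord_norm j (p $ j) (\<lambda>y. \<Prod>i\<in>I. F i y) x \<le> (\<Prod>i\<in>I. coord_norm j (ps i $ j) (F i) x)" for x
  proof -
    define l where "l i = p $ j / ps i $ j" for i
    have l: "l i > 0" if "i \<in> I" for i using ps that by (simp add: l_def)
    have "(\<Sum>i\<in>I. l i) = p $ j * (\<Sum>i\<in>I. 1 / ps i $ j)" by (simp add: l_def sum_distrib_left)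
    then have l1: "(\<Sum>i\<in>I. l i) = 1" using ps(2)[of j] unfolding p[of j, symmetric] by simp
    have "(\<integral>\<^sup>+t. ennreal_powr (\<Prod>i\<in>I. F i (upd j x t)) (p $ j) \<partial>lborel)
      = (\<integral>\<^sup>+t. (\<Prod>i\<in>I. ennreal_powr (ennreal_powr (F i (upd j x t)) (ps i $ j)) (l i)) \<partial>lborel)"
    proof (rule nn_integral_cong)
      fix t
      have "ps i $ j * l i = p $ j" if "i \<in> I" for i using ps(1)[OF that, of j] by (simp add: l_def)
      then show "ennreal_powr (\<Prod>i\<in>I. F i (upd j x t)) (p $ j)
          = (\<Prod>i\<in>I. ennreal_powr (ennreal_powr (F i (upd j x t)) (ps i $ j)) (l i))"
        using ps(2)[of j] by (simp add: ennreal_powr_prod ennreal_powr_powr)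
    qed
    also have "\<dots> \<le> (\<Prod>i\<in>I. ennreal_powr (\<integral>\<^sup>+t. ennreal_powr (F i (upd j x t)) (ps i $ j) \<partial>lborel) (l i))"
      using I l l1 by (intro nn_integral_Holder_prod) measurable
    finally have "coord_norm j (p $ j) (\<lambda>y. \<Prod>i\<in>I. F i y) x
      \<le> ennreal_powr (\<Prod>i\<in>I. ennreal_powr (\<integral>\<^sup>+t. ennreal_powr (F i (upd j x t)) (ps i $ j) \<partial>lborel) (l i)) (1 / p $ j)"
      unfolding coord_norm_def using ps(2)[of j] by (intro ennreal_powr_mono) auto
    also have "\<dots> = (\<Prod>i\<in>I. ennreal_powr (\<integral>\<^sup>+t. ennreal_powr (F i (upd j x t)) (ps i $ j) \<partial>lborel) (1 / ps i $ j))"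
    proof -
      have "l i * (1 / p $ j) = 1 / ps i $ j" for i using ps(2)[of j] by (simp add: l_def)
      then show ?thesis using ps(2)[of j] by (simp add: ennreal_powr_prod ennreal_powr_powr)
    qed
    finally show ?thesis unfolding coord_norm_def .
  qed
  then have "nested_norm p (j # js) (\<lambda>y. \<Prod>i\<in>I. F i y) x
      \<le> nested_norm p js (\<lambda>y. \<Prod>i\<in>I. coord_norm j (ps i $ j) (F i) y) x"
    using ps(2) by (auto intro: nested_norm_mono)
  also have "\<dots> \<le> (\<Prod>i\<in>I. nested_norm (ps i) js (coord_norm j (ps i $ j) (F i)) x)"
    by (rule Cons.IH) measurable
  finally show ?case by simp
qed simp

text \<open>A crude triangle inequality: one factor \<open>2\<close> comes from the sum inside the
  integral, and \<open>2 powr (1 / p)\<close>, at most \<open>2\<close>, from the root of the sum of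
  integrals.\<close>

lemma coord_norm_add_le:
  assumes p: "p \<ge> 1" and [measurable]: "F \<in> borel_measurable borel" "G \<in> borel_measurable borel"
  shows "coord_norm j p (\<lambda>y. F y + G y) x \<le> 4 * (coord_norm j p F x + coord_norm j p G x)"
proof -
  let ?F = "\<integral>\<^sup>+t. ennreal_powr (F (upd j x t)) p \<partial>lborel" and ?G = "\<integral>\<^sup>+t. ennreal_powr (G (upd j x t)) p \<partial>lborel"
  have "(\<integral>\<^sup>+t. ennreal_powr (F (upd j x t) + G (upd j x t)) p \<partial>lborel)
     \<le> (\<integral>\<^sup>+t. ennreal (2 powr p) * (ennreal_powr (F (upd j x t)) p + ennreal_powr (G (upd j x t)) p) \<partial>lborel)"
    using p by (intro nn_integral_mono ennreal_powr_add_le) auto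
  also have "\<dots> = ennreal (2 powr p) * (?F + ?G)"
    by (simp add: nn_integral_cmult nn_integral_add)
  finally have "coord_norm j p (\<lambda>y. F y + G y) x \<le> ennreal_powr (ennreal (2 powr p) * (?F + ?G)) (1 / p)"
    unfolding coord_norm_def using p by (intro ennreal_powr_mono) auto
  also have "\<dots> = 2 * ennreal_powr (?F + ?G) (1 / p)"
    using p by (simp add: ennreal_powr_mult ennreal_powr_ennreal powr_powr)
  also have "\<dots> \<le> 2 * (ennreal (2 powr (1 / p)) * (ennreal_powr ?F (1 / p) + ennreal_powr ?G (1 / p)))"
    using p by (intro mult_left_mono ennreal_powr_add_le) auto
  also have "\<dots> \<le> 2 * (2 * (ennreal_powr ?F (1 / p) + ennreal_powr ?G (1 / p)))"
  proof -
    have "2 powr (1 / p) \<le> 2 powr (1::real)" using p by (intro powr_mono) auto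
    then have "ennreal (2 powr (1 / p)) \<le> ennreal 2" by (intro ennreal_leI) simp
    then show ?thesis by (intro mult_left_mono mult_right_mono) auto
  qed
  also have "\<dots> = 4 * (coord_norm j p F x + coord_norm j p G x)"
    by (simp add: coord_norm_def flip: mult.assoc)
  finally show ?thesis .
qed

lemma nested_norm_add_le:
  assumes p: "\<And>j. p $ j \<ge> 1" and "F \<in> borel_measurable borel" "G \<in> borel_measurable borel"
  shows "nested_norm p js (\<lambda>y. F y + G y) x \<le> 4 ^ length js * (nested_norm p js F x + nested_norm p js G x)"
  using assms(2,3)
proof (induction js arbitrary: F G)
  case (Cons j js)
  have p0: "p $ j > 0" for j using p[of j] by simp
  have "nested_norm p (j # js) (\<lambda>y. F y + G y) x
    \<le> nested_norm p js (\<lambda>y. 4 * (coord_norm j (p $ j) F y + coord_norm j (p $ j) G y)) x"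
    unfolding nested_norm.simps using Cons.prems by (intro nested_norm_mono coord_norm_add_le p p0)
  also have "\<dots> = 4 * nested_norm p js (\<lambda>y. coord_norm j (p $ j) F y + coord_norm j (p $ j) G y) x"
    using Cons.prems p0 by (intro nested_norm_cmult) auto
  also have "\<dots> \<le> 4 * (4 ^ length js * (nested_norm p (j # js) F x + nested_norm p (j # js) G x))"
    using Cons.prems by (intro mult_left_mono) (auto intro!: Cons.IH)
  finally show ?case by (simp add: mult.assoc)
qed simp

text \<open>
  A set of pairs rather than a single pair, since the constant must not depend on the functions.
\<close>
definition Ap_dominated :: "'n::finite \<Rightarrow> real \<Rightarrow> ((real ^ 'n \<Rightarrow> ennreal) \<times> (real ^ 'n \<Rightarrow> ennreal)) set \<Rightarrow> bool" where
  "Ap_dominated j q S \<longleftrightarrow>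
     (\<forall>G F. (G, F) \<in> S \<longrightarrow> G \<in> borel_measurable borel \<and> F \<in> borel_measurable borel) \<and>
     (\<forall>A>0. \<exists>B>0. \<forall>v G F x. Ap_weight q A v \<longrightarrow> (G, F) \<in> S \<longrightarrow>
        (\<integral>\<^sup>+t. ennreal_powr (G (upd j x t)) q * ennreal (v t) \<partial>lborel)
          \<le> ennreal B * (\<integral>\<^sup>+t. ennreal_powr (F (upd j x t)) q * ennreal (v t) \<partial>lborel))"

lemma Ap_dominated_measurable:
  assumes "Ap_dominated j q S" "(G, F) \<in> S"
  shows "G \<in> borel_measurable borel" "F \<in> borel_measurable borel"
  using assms unfolding Ap_dominated_def by auto

lemma Ap_dominatedI:
  assumes "\<And>G F. (G, F) \<in> S \<Longrightarrow> G \<in> borel_measurable borel \<and> F \<in> borel_measurable borel"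
    and "\<And>A. A > 0 \<Longrightarrow> \<exists>B>0. \<forall>v G F x. Ap_weight q A v \<longrightarrow> (G, F) \<in> S \<longrightarrow>
        (\<integral>\<^sup>+t. ennreal_powr (G (upd j x t)) q * ennreal (v t) \<partial>lborel)
          \<le> ennreal B * (\<integral>\<^sup>+t. ennreal_powr (F (upd j x t)) q * ennreal (v t) \<partial>lborel)"
  shows "Ap_dominated j q S"
  unfolding Ap_dominated_def using assms by blast

lemma Ap_dominatedE:
  assumes "Ap_dominated j q S" "A > 0"
  obtains B where "B > 0" "\<And>v G F x. Ap_weight q A v \<Longrightarrow> (G, F) \<in> S \<Longrightarrow>
        (\<integral>\<^sup>+t. ennreal_powr (G (upd j x t)) q * ennreal (v t) \<partial>lborel)
          \<le> ennreal B * (\<integral>\<^sup>+t. ennreal_powr (F (upd j x t)) q * ennreal (v t) \<partial>lborel)"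
  using assms unfolding Ap_dominated_def by blast

text \<open>Extrapolation on every line in direction \<open>j\<close>. Its constant depends on the
  pair only through \<open>B\<close>, so it is uniform over the set.\<close>

lemma Ap_dominated_extrapolate:
  assumes q: "q > 1" and p: "p > 1" and S: "Ap_dominated j q S"
  shows "Ap_dominated j p S"
proof (rule Ap_dominatedI)
  show "G \<in> borel_measurable borel \<and> F \<in> borel_measurable borel" if "(G, F) \<in> S" for G F
    using Ap_dominated_measurable[OF S that] by simp
  fix A :: real assume A: "A > 0"
  have "extrapolation_const q p A > 0" by (simp add: extrapolation_const_def less_max_iff_disj)
  then obtain B where B: "B > 0" "\<And>v G F x. Ap_weight q (extrapolation_const q p A) v \<Longrightarrow> (G, F) \<in> S \<Longrightarrow>
     (\<integral>\<^sup>+t. ennreal_powr (G (upd j x t)) q * ennreal (v t) \<partial>lborel)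
          \<le> ennreal B * (\<integral>\<^sup>+t. ennreal_powr (F (upd j x t)) q * ennreal (v t) \<partial>lborel)"
    using Ap_dominatedE[OF S] by blast
  show "\<exists>B>0. \<forall>v G F x. Ap_weight p A v \<longrightarrow> (G, F) \<in> S \<longrightarrow>
        (\<integral>\<^sup>+t. ennreal_powr (G (upd j x t)) p * ennreal (v t) \<partial>lborel)
          \<le> ennreal B * (\<integral>\<^sup>+t. ennreal_powr (F (upd j x t)) p * ennreal (v t) \<partial>lborel)"
  proof (intro exI[of _ "(4 * B powr (1 / q)) powr p"] conjI allI impI)
    fix v G F x assume v: "Ap_weight p A v" and GF: "(G, F) \<in> S"
    note [measurable] = Ap_dominated_measurable[OF S GF]
    show "(\<integral>\<^sup>+t. ennreal_powr (G (upd j x t)) p * ennreal (v t) \<partial>lborel)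
          \<le> ennreal ((4 * B powr (1 / q)) powr p) * (\<integral>\<^sup>+t. ennreal_powr (F (upd j x t)) p * ennreal (v t) \<partial>lborel)"
      by (rule extrapolation[OF q p A B(1) v _ _ B(2)[OF _ GF]]) measurable
  qed (use B in simp)
qed

text \<open>The new norm must have the exponent of the weighted inequality: then root and power
  cancel, and after exchanging the integrals the hypothesis applies for each fixed value of
  coordinate \<open>k\<close>.\<close>

lemma Ap_dominated_coord_norm:
  assumes S: "Ap_dominated j q S" and k: "k \<noteq> j" and q: "q > 0"
  shows "Ap_dominated j q (map_prod (coord_norm k q) (coord_norm k q) ` S)"
proof (rule Ap_dominatedI)
  show "G \<in> borel_measurable borel \<and> F \<in> borel_measurable borel"
    if "(G, F) \<in> map_prod (coord_norm k q) (coord_norm k q) ` S" for G F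
    using that Ap_dominated_measurable[OF S] by (auto intro!: measurable_coord_norm)
  fix A :: real assume A: "A > 0"
  obtain B where B: "B > 0" "\<And>v G F x. Ap_weight q A v \<Longrightarrow> (G, F) \<in> S \<Longrightarrow>
     (\<integral>\<^sup>+t. ennreal_powr (G (upd j x t)) q * ennreal (v t) \<partial>lborel)
          \<le> ennreal B * (\<integral>\<^sup>+t. ennreal_powr (F (upd j x t)) q * ennreal (v t) \<partial>lborel)"
    using Ap_dominatedE[OF S A] by blast
  have swap: "(\<integral>\<^sup>+t. ennreal_powr (coord_norm k q F (upd j x t)) q * ennreal (v t) \<partial>lborel)
    = (\<integral>\<^sup>+s. (\<integral>\<^sup>+t. ennreal_powr (F (upd j (upd k x s) t)) q * ennreal (v t) \<partial>lborel) \<partial>lborel)"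
    if [measurable]: "F \<in> borel_measurable borel" "v \<in> borel_measurable borel" for F v x
  proof -
    have "(\<integral>\<^sup>+t. ennreal_powr (coord_norm k q F (upd j x t)) q * ennreal (v t) \<partial>lborel)
      = (\<integral>\<^sup>+t. (\<integral>\<^sup>+s. ennreal_powr (F (upd j (upd k x s) t)) q * ennreal (v t) \<partial>lborel) \<partial>lborel)"
      using q k by (simp add: coord_norm_def ennreal_powr_powr nn_integral_multc upd_commute[of j k])
    also have "\<dots> = (\<integral>\<^sup>+s. (\<integral>\<^sup>+t. ennreal_powr (F (upd j (upd k x s) t)) q * ennreal (v t) \<partial>lborel) \<partial>lborel)"
      by (rule lborel_pair.Fubini') measurable
    finally show ?thesis .
  qed
  show "\<exists>B>0. \<forall>v G F x. Ap_weight q A v \<longrightarrow> (G, F) \<in> map_prod (coord_norm k q) (coord_norm k q) ` S \<longrightarrow>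
        (\<integral>\<^sup>+t. ennreal_powr (G (upd j x t)) q * ennreal (v t) \<partial>lborel)
          \<le> ennreal B * (\<integral>\<^sup>+t. ennreal_powr (F (upd j x t)) q * ennreal (v t) \<partial>lborel)"
  proof (intro exI[of _ B] conjI allI impI B(1))
    fix v G' F' x assume v: "Ap_weight q A v" and "(G', F') \<in> map_prod (coord_norm k q) (coord_norm k q) ` S"
    then obtain G F where GF: "G' = coord_norm k q G" "F' = coord_norm k q F" "(G, F) \<in> S" by auto
    note [measurable] = Ap_dominated_measurable[OF S GF(3)]
    have [measurable]: "v \<in> borel_measurable borel"
      using v by (simp add: Ap_weight_def)
    have "(\<integral>\<^sup>+s. (\<integral>\<^sup>+t. ennreal_powr (G (upd j (upd k x s) t)) q * ennreal (v t) \<partial>lborel) \<partial>lborel)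
      \<le> (\<integral>\<^sup>+s. ennreal B * (\<integral>\<^sup>+t. ennreal_powr (F (upd j (upd k x s) t)) q * ennreal (v t) \<partial>lborel) \<partial>lborel)"
      by (intro nn_integral_mono B(2) v GF)
    also have "\<dots> = ennreal B * (\<integral>\<^sup>+s. (\<integral>\<^sup>+t. ennreal_powr (F (upd j (upd k x s) t)) q * ennreal (v t) \<partial>lborel) \<partial>lborel)"
      by (intro nn_integral_cmult) measurable
    finally show "(\<integral>\<^sup>+t. ennreal_powr (G' (upd j x t)) q * ennreal (v t) \<partial>lborel)
          \<le> ennreal B * (\<integral>\<^sup>+t. ennreal_powr (F' (upd j x t)) q * ennreal (v t) \<partial>lborel)"
      unfolding GF by (simp add: swap)
  qed
qed

text \<open>The hypothesis ranges over all exponents so that it is available at \<open>p $ k\<close>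
  for the head \<open>k\<close>; extrapolation restores all exponents before the next coordinate is
  integrated.\<close>

lemma Ap_dominated_nested_norm:
  assumes "\<And>i. p $ i > 1" "\<And>q. q > 1 \<Longrightarrow> Ap_dominated j q S" "j \<notin> set js" "q > 1"
  shows "Ap_dominated j q (map_prod (nested_norm p js) (nested_norm p js) ` S)"
  using assms(2-)
proof (induction js arbitrary: S q)
  case Nil
  have "map_prod (nested_norm p []) (nested_norm p []) = id" by auto
  then show ?case using Nil by simp
next
  case (Cons k js)
  define S' where "S' = map_prod (coord_norm k (p $ k)) (coord_norm k (p $ k)) ` S"
  have "Ap_dominated j (p $ k) S'"
    unfolding S'_def using Cons.prems assms(1)[of k] by (intro Ap_dominated_coord_norm) auto
  then have "Ap_dominated j q S'" if "q > 1" for q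
    using Ap_dominated_extrapolate assms(1)[of k] that by blast
  then have "Ap_dominated j q (map_prod (nested_norm p js) (nested_norm p js) ` S')"
    using Cons by (intro Cons.IH) auto
  also have "map_prod (nested_norm p js) (nested_norm p js) ` S'
      = map_prod (nested_norm p (k # js)) (nested_norm p (k # js)) ` S"
    unfolding S'_def image_image by (auto simp: map_prod_def case_prod_beta)
  finally show ?case .
qed

definition coord_max :: "'n::finite \<Rightarrow> (real ^ 'n \<Rightarrow> ennreal) \<Rightarrow> real ^ 'n \<Rightarrow> ennreal" where
  "coord_max j F x = maxf (\<lambda>t. F (upd j x t)) (x $ j)"

lemma measurable_coord_max [measurable]:
  assumes [measurable]: "F \<in> borel_measurable borel"
  shows "coord_max j F \<in> borel_measurable borel"
proof -
  have "(\<lambda>x. (\<integral>\<^sup>+t\<in>I. F (upd j x t) \<partial>lborel) / emeasure lborel I * indicator I (x $ j)) \<in> borel_measurable borel"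
    if "I \<in> rat_intervals" for I
  proof -
    note rat_intervals_borel[OF that, measurable]
    show ?thesis by measurable
  qed
  then show ?thesis
    unfolding coord_max_def[abs_def] interval_maximal_def
    by (intro borel_measurable_SUP countable_rat_intervals)
qed

lemma Ap_dominated_coord_max:
  assumes "p > 1"
  shows "Ap_dominated j p {(coord_max j F, F) | F. F \<in> borel_measurable borel}"
proof (rule Ap_dominatedI)
  fix A :: real assume A: "A > 0"
  show "\<exists>B>0. \<forall>v G F x. Ap_weight p A v \<longrightarrow> (G, F) \<in> {(coord_max j F, F) | F. F \<in> borel_measurable borel} \<longrightarrow>
        (\<integral>\<^sup>+t. ennreal_powr (G (upd j x t)) p * ennreal (v t) \<partial>lborel)
          \<le> ennreal B * (\<integral>\<^sup>+t. ennreal_powr (F (upd j x t)) p * ennreal (v t) \<partial>lborel)"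
  proof (intro exI[of _ "muckenhoupt_const p A"] conjI allI impI muckenhoupt_const_pos[OF assms A])
    fix v G F x assume v: "Ap_weight p A v" and "(G, F) \<in> {(coord_max j F, F) | F. F \<in> borel_measurable borel}"
    then have GF: "G = coord_max j F" and [measurable]: "F \<in> borel_measurable borel" by auto
    show "(\<integral>\<^sup>+t. ennreal_powr (G (upd j x t)) p * ennreal (v t) \<partial>lborel)
          \<le> ennreal (muckenhoupt_const p A) * (\<integral>\<^sup>+t. ennreal_powr (F (upd j x t)) p * ennreal (v t) \<partial>lborel)"
      using muckenhoupt[OF assms A v, of "\<lambda>t. F (upd j x t)"] by (simp add: GF coord_max_def)
  qed
qed auto

text \<open>Only the norms before \<open>j\<close> involve weights. At \<open>j\<close> the
  inequality is used with the constant weight \<open>1\<close>, and the later norms preserve it by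
  monotonicity.\<close>

lemma coord_max_bounded:
  assumes p: "\<And>i. p $ i > 1" and js: "distinct js" "j \<in> set js"
  obtains C where "C > 0" "\<And>F x. F \<in> borel_measurable borel \<Longrightarrow>
    nested_norm p js (coord_max j F) x \<le> ennreal C * nested_norm p js F x"
proof -
  obtain as bs where js_eq: "js = as @ j # bs" "j \<notin> set as"
    using split_list_first[OF js(2)] by blast
  have p0: "p $ i > 0" for i using p[of i] by simp
  let ?r = "p $ j"
  have dom: "Ap_dominated j ?r (map_prod (nested_norm p as) (nested_norm p as) ` {(coord_max j F, F) | F. F \<in> borel_measurable borel})"
    by (intro Ap_dominated_nested_norm p Ap_dominated_coord_max js_eq)
  then obtain B where B: "B > 0" "\<And>v G F x. Ap_weight ?r 1 v \<Longrightarrow>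
      (G, F) \<in> map_prod (nested_norm p as) (nested_norm p as) ` {(coord_max j F, F) | F. F \<in> borel_measurable borel} \<Longrightarrow>
     (\<integral>\<^sup>+t. ennreal_powr (G (upd j x t)) ?r * ennreal (v t) \<partial>lborel)
          \<le> ennreal B * (\<integral>\<^sup>+t. ennreal_powr (F (upd j x t)) ?r * ennreal (v t) \<partial>lborel)"
    using Ap_dominatedE[OF dom zero_less_one] by blast
  have B2: "(\<integral>\<^sup>+t. ennreal_powr (nested_norm p as (coord_max j F) (upd j x t)) ?r \<partial>lborel)
          \<le> ennreal B * (\<integral>\<^sup>+t. ennreal_powr (nested_norm p as F (upd j x t)) ?r \<partial>lborel)"
    if "F \<in> borel_measurable borel" for F x
  proof -
    have "(nested_norm p as (coord_max j F), nested_norm p as F)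
      \<in> map_prod (nested_norm p as) (nested_norm p as) ` {(coord_max j F, F) | F. F \<in> borel_measurable borel}"
      by (intro image_eqI[of _ _ "(coord_max j F, F)"]) (use that in auto)
    from B(2)[OF Ap_weight_1[OF p order_refl] this] show ?thesis by simp
  qed
  show ?thesis
  proof (rule that[of "B powr (1 / ?r)"])
    fix F :: "real ^ 'a \<Rightarrow> ennreal" and x assume [measurable]: "F \<in> borel_measurable borel"
    have "coord_norm j ?r (nested_norm p as (coord_max j F)) y \<le> ennreal (B powr (1 / ?r)) * coord_norm j ?r (nested_norm p as F) y" for y
    proof -
      have "coord_norm j ?r (nested_norm p as (coord_max j F)) y
        \<le> ennreal_powr (ennreal B * (\<integral>\<^sup>+t. ennreal_powr (nested_norm p as F (upd j y t)) ?r \<partial>lborel)) (1 / ?r)"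
        unfolding coord_norm_def using p0[of j] by (intro ennreal_powr_mono B2) auto
      also have "\<dots> = ennreal (B powr (1 / ?r)) * coord_norm j ?r (nested_norm p as F) y"
        using p0[of j] B(1) by (simp add: coord_norm_def ennreal_powr_mult ennreal_powr_ennreal)
      finally show ?thesis .
    qed
    then have "nested_norm p js (coord_max j F) x \<le> nested_norm p bs (\<lambda>y. ennreal (B powr (1 / ?r)) * coord_norm j ?r (nested_norm p as F) y) x"
      unfolding js_eq nested_norm_append nested_norm.simps by (intro nested_norm_mono p0)
    also have "\<dots> = ennreal (B powr (1 / ?r)) * nested_norm p js F x"
      unfolding js_eq nested_norm_append nested_norm.simps by (intro nested_norm_cmult p0) measurable
    finally show "nested_norm p js (coord_max j F) x \<le> ennreal (B powr (1 / ?r)) * nested_norm p js F x" .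
  qed (use B in simp)
qed

text \<open>The head acts first, matching \<open>nested_norm\<close>, so that averages can be peeled
  off one coordinate at a time.\<close>

fun coord_max_list :: "'n::finite list \<Rightarrow> (real ^ 'n \<Rightarrow> ennreal) \<Rightarrow> real ^ 'n \<Rightarrow> ennreal" where
  "coord_max_list [] F = F"
| "coord_max_list (j # js) F = coord_max_list js (coord_max j F)"

lemma measurable_coord_max_list [measurable]:
  "F \<in> borel_measurable borel \<Longrightarrow> coord_max_list js F \<in> borel_measurable borel"
  by (induction js arbitrary: F) auto

lemma coord_max_list_bounded:
  assumes p: "\<And>i. p $ i > 1" and js: "distinct js" "set ks \<subseteq> set js"
  obtains C where "C > 0" "\<And>F x. F \<in> borel_measurable borel \<Longrightarrow>
    nested_norm p js (coord_max_list ks F) x \<le> ennreal C * nested_norm p js F x"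
  using js(2)
proof (induction ks arbitrary: thesis)
  case Nil
  show ?case by (rule Nil(1)[of 1]) auto
next
  case (Cons k ks)
  obtain C where C: "C > 0" "\<And>F x. F \<in> borel_measurable borel \<Longrightarrow>
    nested_norm p js (coord_max_list ks F) x \<le> ennreal C * nested_norm p js F x"
    using Cons.IH Cons.prems(2) by auto
  obtain D where D: "D > 0" "\<And>F x. F \<in> borel_measurable borel \<Longrightarrow>
    nested_norm p js (coord_max k F) x \<le> ennreal D * nested_norm p js F x"
    using coord_max_bounded[OF p js(1), of k] Cons.prems(2) by auto
  show ?case
  proof (rule Cons.prems(1)[of "C * D"])
    fix F :: "real ^ 'a \<Rightarrow> ennreal" and x assume F: "F \<in> borel_measurable borel"
    have "nested_norm p js (coord_max_list (k # ks) F) x \<le> ennreal C * nested_norm p js (coord_max k F) x"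
      using C(2)[of "coord_max k F" x] F by simp
    also have "\<dots> \<le> ennreal C * (ennreal D * nested_norm p js F x)"
      by (intro mult_left_mono D F) auto
    finally show "nested_norm p js (coord_max_list (k # ks) F) x \<le> ennreal (C * D) * nested_norm p js F x"
      using C D by (simp add: ennreal_mult mult.assoc)
  qed (use C D in simp)
qed

subsection \<open>Nested norms of balls\<close>

lemma measurable_vec_lambda:
  fixes f :: "'a \<Rightarrow> 'n::finite \<Rightarrow> real"
  assumes "\<And>k. (\<lambda>z. f z k) \<in> borel_measurable M"
  shows "(\<lambda>z. \<chi> k. f z k) \<in> borel_measurable M"
proof -
  have "\<exists>k. b = axis k 1" if "b \<in> Basis" for b :: "real ^ 'n"
    using that by (auto simp: Basis_vec_def)
  moreover have "(\<lambda>z. (\<chi> k. f z k) \<bullet> axis k 1) \<in> borel_measurable M" for k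
    using assms[of k] by (simp add: inner_axis)
  ultimately have "\<forall>b\<in>Basis. (\<lambda>z. (\<chi> k. f z k) \<bullet> b) \<in> borel_measurable M"
    by metis
  then show ?thesis by (subst borel_measurable_euclidean_space)
qed

section \<open>Exponents equal to 1: the Lebesgue integral by Tonelli's theorem\<close>

lemma coord_norm_1: "coord_norm j 1 F x = (\<integral>\<^sup>+t. F (upd j x t) \<partial>lborel)"
  by (simp add: coord_norm_def)

lemma nested_norm_1_eq_PiM:
  fixes F :: "real ^ 'n::finite \<Rightarrow> ennreal"
  assumes "distinct js" and "F \<in> borel_measurable borel"
  shows "nested_norm 1 js F x
    = (\<integral>\<^sup>+y. F (\<chi> k. if k \<in> set js then y k else x $ k) \<partial>(\<Pi>\<^sub>M k\<in>set js. lborel))"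
  using assms
proof (induction js arbitrary: F)
  case Nil
  interpret P: product_sigma_finite "\<lambda>_ :: 'n. lborel :: real measure" ..
  show ?case by (simp add: P.nn_integral_empty del: nn_integral_const)
next
  case (Cons j js)
  interpret product_sigma_finite "\<lambda>_ :: 'n. lborel :: real measure" ..
  note [measurable] = Cons.prems(2)
  have comp: "(\<lambda>z. z k) \<in> borel_measurable (\<Pi>\<^sub>M k\<in>insert j (set js). lborel)" if "k \<in> insert j (set js)" for k
    using measurable_component_singleton[OF that, of "\<lambda>_. lborel"] by simp
  have "(\<lambda>y. \<chi> k. if k \<in> set (j # js) then y k else x $ k) \<in> borel_measurable (\<Pi>\<^sub>M k\<in>insert j (set js). lborel)"
  proof (rule measurable_vec_lambda)
    fix k show "(\<lambda>z. if k \<in> set (j # js) then z k else x $ k) \<in> borel_measurable (\<Pi>\<^sub>M k\<in>insert j (set js). lborel)"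
      using comp[of k] by (cases "k \<in> set (j # js)") auto
  qed
  then have meas: "(\<lambda>y. F (\<chi> k. if k \<in> set (j # js) then y k else x $ k)) \<in> borel_measurable (\<Pi>\<^sub>M k\<in>insert j (set js). lborel)"
    by (rule measurable_compose) fact
  have "nested_norm 1 (j # js) F x
    = (\<integral>\<^sup>+y. (\<integral>\<^sup>+t. F (upd j (\<chi> k. if k \<in> set js then y k else x $ k) t) \<partial>lborel) \<partial>(\<Pi>\<^sub>M k\<in>set js. lborel))"
    using Cons.prems by (simp add: Cons.IH coord_norm_1)
  also have "\<dots> = (\<integral>\<^sup>+y. (\<integral>\<^sup>+t. F (\<chi> k. if k \<in> set (j # js) then (y(j := t)) k else x $ k) \<partial>lborel) \<partial>(\<Pi>\<^sub>M k\<in>set js. lborel))"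
    by (intro nn_integral_cong arg_cong[of _ _ F]) (auto simp: vec_eq_iff)
  also have "\<dots> = (\<integral>\<^sup>+y. F (\<chi> k. if k \<in> set (j # js) then y k else x $ k) \<partial>(\<Pi>\<^sub>M k\<in>insert j (set js). lborel))"
    using Cons.prems by (intro product_nn_integral_insert[symmetric] meas) auto
  finally show ?case by simp
qed

text \<open>Both measures give a box the product of its side lengths, which characterizes Lebesgue
  measure.\<close>

lemma lborel_vec: "lborel = distr (\<Pi>\<^sub>M k\<in>UNIV. lborel) borel (\<lambda>y. (\<chi> k. y k) :: real ^ 'n::finite)"
proof (rule lborel_eqI)
  interpret product_sigma_finite "\<lambda>_ :: 'n. lborel :: real measure" ..
  have [measurable]: "(\<lambda>y. (\<chi> k. y k) :: real ^ 'n) \<in> borel_measurable (\<Pi>\<^sub>M k\<in>UNIV. lborel)"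
    by (rule measurable_vec_lambda) (use measurable_component_singleton[of _ UNIV "\<lambda>_. lborel"] in auto)
  fix l u :: "real ^ 'n" assume le: "\<And>b. b \<in> Basis \<Longrightarrow> l \<bullet> b \<le> u \<bullet> b"
  have le': "l $ k \<le> u $ k" for k
    using le[of "axis k 1"] by (simp add: inner_axis axis_in_Basis_iff)
  have "emeasure (distr (\<Pi>\<^sub>M k\<in>UNIV. lborel) borel (\<lambda>y. (\<chi> k. y k) :: real ^ 'n)) (box l u)
      = emeasure (\<Pi>\<^sub>M k\<in>(UNIV :: 'n set). lborel :: real measure) (\<Pi>\<^sub>E k\<in>UNIV. {l $ k<..<u $ k})"
    by (subst emeasure_distr) (auto simp: mem_box_cart space_PiM PiE_def Pi_def intro!: arg_cong[of _ _ "emeasure _"])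
  also have "\<dots> = (\<Prod>k\<in>UNIV. ennreal (u $ k - l $ k))"
    using le' by (subst emeasure_PiM) auto
  also have "\<dots> = ennreal (\<Prod>k\<in>UNIV. u $ k - l $ k)"
    using le' by (intro prod_ennreal) auto
  also have "(\<Prod>k\<in>UNIV. u $ k - l $ k) = (\<Prod>b\<in>Basis. (u - l) \<bullet> b)"
  proof -
    have B: "Basis = range (\<lambda>k :: 'n. axis k (1::real))" by (auto simp: Basis_vec_def)
    have inj: "inj (\<lambda>k :: 'n. axis k (1::real))" by (simp add: inj_on_def axis_eq_axis)
    have "(\<Prod>b\<in>Basis. (u - l) \<bullet> b) = (\<Prod>k\<in>UNIV. (u - l) \<bullet> axis k 1)"
      unfolding B by (subst prod.reindex[OF inj]) simp
    then show ?thesis by (simp add: inner_axis)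
  qed
  finally show "emeasure (distr (\<Pi>\<^sub>M k\<in>UNIV. lborel) borel (\<lambda>y. (\<chi> k. y k) :: real ^ 'n)) (box l u) = (\<Prod>b\<in>Basis. (u - l) \<bullet> b)" .
qed simp

lemma nested_norm_1_eq_lborel:
  fixes F :: "real ^ 'n::finite \<Rightarrow> ennreal"
  assumes js: "distinct js" "set js = UNIV" and F [measurable]: "F \<in> borel_measurable borel"
  shows "nested_norm 1 js F x = (\<integral>\<^sup>+y. F y \<partial>lborel)"
proof -
  have [measurable]: "(\<lambda>y. (\<chi> k. y k) :: real ^ 'n) \<in> borel_measurable (\<Pi>\<^sub>M k\<in>UNIV. lborel)"
    by (rule measurable_vec_lambda) (use measurable_component_singleton[of _ UNIV "\<lambda>_. lborel"] in auto)
  show ?thesis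
    unfolding nested_norm_1_eq_PiM[OF js(1) F] js(2)
    by (subst lborel_vec, subst nn_integral_distr) auto
qed

text \<open>The nested norm at \<open>x\<close> only sees points that agree with \<open>x\<close>
  outside the list. In \<open>nested_norm_1_box_le\<close> this keeps coordinate \<open>j\<close> of
  those points inside \<open>I j\<close>.\<close>

lemma nested_norm_mono_on:
  assumes p: "\<And>j. p $ j > 0" and "\<And>y. (\<And>k. k \<notin> set js \<Longrightarrow> y $ k = x $ k) \<Longrightarrow> F y \<le> G y"
  shows "nested_norm p js F x \<le> nested_norm p js G x"
  using assms(2)
proof (induction js arbitrary: F G)
  case Nil
  then show ?case by simp
next
  case (Cons j js)
  have "coord_norm j (p $ j) F y \<le> coord_norm j (p $ j) G y" if "\<And>k. k \<notin> set js \<Longrightarrow> y $ k = x $ k" for y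
    unfolding coord_norm_def using p[of j] that
    by (intro ennreal_powr_mono nn_integral_mono Cons.prems) auto
  then show ?case by (auto intro: Cons.IH)
qed

text \<open>The integral over \<open>I j\<close> is at most its length times the maximal function at
  any point with coordinate in \<open>I j\<close>; the indicators of the other coordinates are
  constants in this integration.\<close>

lemma nested_norm_1_box_le:
  assumes "distinct js" "F \<in> borel_measurable borel"
    and I: "\<And>k. k \<in> set js \<Longrightarrow> I k \<in> rat_intervals \<and> x $ k \<in> I k"
  shows "nested_norm 1 js (\<lambda>y. F y * (\<Prod>k\<in>set js. indicator (I k) (y $ k))) x
    \<le> (\<Prod>k\<in>set js. emeasure lborel (I k)) * coord_max_list js F x"
  using assms
proof (induction js arbitrary: F)
  case (Cons j js)
  note [measurable] = Cons.prems(2)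
  have I: "I k \<in> rat_intervals" "x $ k \<in> I k" if "k \<in> set (j # js)" for k
    using Cons.prems(3) that by auto
  have [measurable]: "(\<lambda>y. \<Prod>k\<in>set js. indicator (I k) (y $ k) :: ennreal) \<in> borel_measurable borel"
    using rat_intervals_borel[OF I(1)] by (intro borel_measurable_prod_ennreal) auto
  have [measurable]: "I j \<in> sets borel" using rat_intervals_borel[OF I(1)] by simp
  have "nested_norm 1 (j # js) (\<lambda>y. F y * (\<Prod>k\<in>set (j # js). indicator (I k) (y $ k))) x
     \<le> nested_norm 1 js (\<lambda>y. emeasure lborel (I j) * (coord_max j F y * (\<Prod>k\<in>set js. indicator (I k) (y $ k)))) x"
    unfolding nested_norm.simps
  proof (rule nested_norm_mono_on)
    fix y assume y: "\<And>k. k \<notin> set js \<Longrightarrow> y $ k = x $ k"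
    have yj: "y $ j \<in> I j" using y[of j] I(2)[of j] Cons.prems(1) by simp
    obtain L where L: "L > 0" "emeasure lborel (I j) = ennreal L"
      using emeasure_rat_interval[OF I(1)[of j]] by auto
    have "coord_norm j (1 $ j) (\<lambda>y. F y * (\<Prod>k\<in>set (j # js). indicator (I k) (y $ k))) y
      = (\<integral>\<^sup>+t. (\<Prod>k\<in>set js. indicator (I k) (y $ k)) * (F (upd j y t) * indicator (I j) t) \<partial>lborel)"
    proof -
      have "(\<Prod>k\<in>set js. indicator (I k) (upd j y t $ k)) = (\<Prod>k\<in>set js. indicator (I k) (y $ k) :: ennreal)" for t
        using Cons.prems(1) by (intro prod.cong) auto
      then show ?thesis
        using Cons.prems(1) by (simp add: coord_norm_1 mult_ac)
    qed
    also have "\<dots> = (\<Prod>k\<in>set js. indicator (I k) (y $ k)) * (\<integral>\<^sup>+t\<in>I j. F (upd j y t) \<partial>lborel)"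
      by (intro nn_integral_cmult) measurable
    also have "\<dots> \<le> (\<Prod>k\<in>set js. indicator (I k) (y $ k)) * (emeasure lborel (I j) * coord_max j F y)"
    proof (rule mult_left_mono)
      have "(\<integral>\<^sup>+t\<in>I j. F (upd j y t) \<partial>lborel) / emeasure lborel (I j) * indicator (I j) (y $ j) \<le> coord_max j F y"
        unfolding coord_max_def interval_maximal_def by (rule SUP_upper) (simp add: I)
      then have "ennreal L * ((\<integral>\<^sup>+t\<in>I j. F (upd j y t) \<partial>lborel) / ennreal L) \<le> ennreal L * coord_max j F y"
        using yj L by (intro mult_left_mono) auto
      also have "ennreal L * ((\<integral>\<^sup>+t\<in>I j. F (upd j y t) \<partial>lborel) / ennreal L) = (\<integral>\<^sup>+t\<in>I j. F (upd j y t) \<partial>lborel)"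
        using L unfolding ennreal_times_divide
        by (subst mult.commute) (simp add: mult_divide_eq_ennreal)
      finally show "(\<integral>\<^sup>+t\<in>I j. F (upd j y t) \<partial>lborel) \<le> emeasure lborel (I j) * coord_max j F y"
        using L by simp
    qed simp
    finally show "coord_norm j (1 $ j) (\<lambda>y. F y * (\<Prod>k\<in>set (j # js). indicator (I k) (y $ k))) y
      \<le> emeasure lborel (I j) * (coord_max j F y * (\<Prod>k\<in>set js. indicator (I k) (y $ k)))"
      by (simp only: mult_ac)
  qed simp
  also have "\<dots> = emeasure lborel (I j) * nested_norm 1 js (\<lambda>y. coord_max j F y * (\<Prod>k\<in>set js. indicator (I k) (y $ k))) x"
    by (intro nested_norm_cmult) (simp, measurable)
  also have "\<dots> \<le> emeasure lborel (I j) * ((\<Prod>k\<in>set js. emeasure lborel (I k)) * coord_max_list js (coord_max j F) x)"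
    using Cons.prems I by (intro mult_left_mono Cons.IH) auto
  finally show ?case using Cons.prems(1) by (simp add: mult.assoc)
qed simp

lemma nn_integral_ball_le_coord_max_list:
  fixes F :: "real ^ 'n::finite \<Rightarrow> ennreal"
  assumes js: "distinct js" "set js = UNIV" and F [measurable]: "F \<in> borel_measurable borel" and r: "r > 0"
  shows "(\<integral>\<^sup>+y\<in>ball x r. F y \<partial>lborel) \<le> ennreal ((4 * r) ^ CARD('n)) * coord_max_list js F x"
proof -
  \<comment> \<open>The slack between \<open>r\<close> and \<open>2 * r\<close> leaves room for
    rational endpoints; the sides stay shorter than \<open>4 * r\<close>.\<close>
  have "\<exists>a b. a \<in> \<rat> \<and> b \<in> \<rat> \<and> x $ k - 2 * r < a \<and> a < x $ k - r \<and> x $ k + r < b \<and> b < x $ k + 2 * r" for k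
    using Rats_dense_in_real[of "x $ k - 2 * r" "x $ k - r"] Rats_dense_in_real[of "x $ k + r" "x $ k + 2 * r"] r by auto
  then obtain a b where ab: "\<And>k. a k \<in> \<rat> \<and> b k \<in> \<rat> \<and> x $ k - 2 * r < a k \<and> a k < x $ k - r \<and> x $ k + r < b k \<and> b k < x $ k + 2 * r"
    by metis
  define I where "I k = {a k<..<b k}" for k
  have I: "I k \<in> rat_intervals \<and> x $ k \<in> I k" and len: "emeasure lborel (I k) \<le> ennreal (4 * r)" for k
  proof -
    show "I k \<in> rat_intervals \<and> x $ k \<in> I k"
      unfolding rat_intervals_def I_def using ab[of k] r
      by (intro conjI CollectI exI[of _ "a k"] exI[of _ "b k"]) auto
    show "emeasure lborel (I k) \<le> ennreal (4 * r)"
      unfolding I_def using ab[of k] r by (auto intro!: ennreal_leI)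
  qed
  have [measurable]: "I k \<in> sets borel" for k unfolding I_def by simp
  have "(\<integral>\<^sup>+y\<in>ball x r. F y \<partial>lborel) \<le> (\<integral>\<^sup>+y. F y * (\<Prod>k\<in>set js. indicator (I k) (y $ k)) \<partial>lborel)"
  proof (intro nn_integral_mono mult_left_mono)
    fix y
    have "y $ k \<in> I k" if "y \<in> ball x r" for k
    proof -
      have "\<bar>(x - y) $ k\<bar> < r" using component_le_norm_cart[of "x - y" k] that by (simp add: dist_norm)
      then show ?thesis using ab[of k] by (auto simp: I_def)
    qed
    then show "indicator (ball x r) y \<le> (\<Prod>k\<in>set js. indicator (I k) (y $ k) :: ennreal)"
      by (cases "y \<in> ball x r") auto
  qed simp
  also have "\<dots> = nested_norm 1 js (\<lambda>y. F y * (\<Prod>k\<in>set js. indicator (I k) (y $ k))) x"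
    by (intro nested_norm_1_eq_lborel[symmetric] js) measurable
  also have "\<dots> \<le> (\<Prod>k\<in>set js. emeasure lborel (I k)) * coord_max_list js F x"
    using I by (intro nested_norm_1_box_le js) auto
  also have "\<dots> \<le> ennreal ((4 * r) ^ CARD('n)) * coord_max_list js F x"
  proof (intro mult_right_mono)
    have "(\<Prod>k\<in>set js. emeasure lborel (I k)) \<le> (\<Prod>k\<in>(UNIV :: 'n set). ennreal (4 * r))"
      unfolding js(2) by (intro prod_mono_ennreal len)
    also have "\<dots> = ennreal ((4 * r) ^ CARD('n))" using r by (simp add: ennreal_power)
    finally show "(\<Prod>k\<in>set js. emeasure lborel (I k)) \<le> ennreal ((4 * r) ^ CARD('n))" .
  qed simp
  finally show ?thesis .
qed

lemma nested_norm_box: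
  assumes p: "\<And>j. p $ j > 0" and "distinct js" and [measurable]: "\<And>k. J k \<in> sets borel"
  shows "nested_norm p js (\<lambda>y. \<Prod>k\<in>set js. indicator (J k) (y $ k)) x
    = (\<Prod>k\<in>set js. ennreal_powr (emeasure lborel (J k)) (1 / p $ k))"
  using assms(2)
proof (induction js)
  case (Cons j js)
  have [measurable]: "(\<lambda>y. \<Prod>k\<in>set js. indicator (J k) (y $ k) :: ennreal) \<in> borel_measurable borel"
    by (intro borel_measurable_prod_ennreal) measurable
  have "coord_norm j (p $ j) (\<lambda>y. \<Prod>k\<in>set (j # js). indicator (J k) (y $ k)) y
    = ennreal_powr (emeasure lborel (J j)) (1 / p $ j) * (\<Prod>k\<in>set js. indicator (J k) (y $ k))" for y
  proof -
    let ?P = "\<Prod>k\<in>set js. indicator (J k) (y $ k) :: ennreal"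
    have "(\<Prod>k\<in>set js. indicator (J k) (upd j y t $ k)) = ?P" for t
      using Cons.prems by (intro prod.cong) auto
    moreover have "ennreal_powr (indicator (J j) t) (p $ j) = indicator (J j) t" for t
      by (simp add: indicator_def)
    ultimately have "(\<integral>\<^sup>+t. ennreal_powr (\<Prod>k\<in>set (j # js). indicator (J k) (upd j y t $ k)) (p $ j) \<partial>lborel)
      = (\<integral>\<^sup>+t. ennreal_powr ?P (p $ j) * indicator (J j) t \<partial>lborel)"
      using Cons.prems p[of j] by (simp add: ennreal_powr_mult mult.commute)
    also have "\<dots> = ennreal_powr ?P (p $ j) * emeasure lborel (J j)"
      by (intro nn_integral_cmult_indicator) simp
    finally show ?thesis
      using p[of j] by (simp add: coord_norm_def ennreal_powr_mult ennreal_powr_powr mult.commute)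
  qed
  then have eq: "coord_norm j (p $ j) (\<lambda>y. \<Prod>k\<in>set (j # js). indicator (J k) (y $ k))
    = (\<lambda>y. ennreal_powr (emeasure lborel (J j)) (1 / p $ j) * (\<Prod>k\<in>set js. indicator (J k) (y $ k)))"
    by (rule ext)
  have "nested_norm p (j # js) (\<lambda>y. \<Prod>k\<in>set (j # js). indicator (J k) (y $ k)) x
     = nested_norm p js (\<lambda>y. ennreal_powr (emeasure lborel (J j)) (1 / p $ j) * (\<Prod>k\<in>set js. indicator (J k) (y $ k))) x"
    by (simp only: nested_norm.simps eq)
  also have "\<dots> = ennreal_powr (emeasure lborel (J j)) (1 / p $ j) * nested_norm p js (\<lambda>y. \<Prod>k\<in>set js. indicator (J k) (y $ k)) x"
    by (intro nested_norm_cmult p) measurable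
  finally show ?case using Cons by simp
qed simp

lemma nested_norm_cube:
  assumes p: "\<And>j. p $ j > 0" and js: "distinct js" "set js = (UNIV :: 'n::finite set)" and d: "d > 0"
  shows "nested_norm p js (\<lambda>y. \<Prod>k\<in>set js. indicator {c $ k - d<..<c $ k + d} (y $ k)) x
    = ennreal ((2 * d) powr (\<Sum>k\<in>UNIV. 1 / p $ k))"
proof -
  have "nested_norm p js (\<lambda>y. \<Prod>k\<in>set js. indicator {c $ k - d<..<c $ k + d} (y $ k)) x
    = (\<Prod>k\<in>(UNIV :: 'n set). ennreal_powr (emeasure lborel {c $ k - d<..<c $ k + d}) (1 / p $ k))"
    by (subst nested_norm_box[OF p js(1)]) (auto simp: js(2))
  also have "\<dots> = (\<Prod>k\<in>(UNIV :: 'n set). ennreal ((2 * d) powr (1 / p $ k)))"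
    using d by (intro prod.cong) (auto simp: ennreal_powr_ennreal)
  also have "\<dots> = ennreal ((2 * d) powr (\<Sum>k\<in>UNIV. 1 / p $ k))"
    using d by (simp add: prod_ennreal powr_sum)
  finally show ?thesis .
qed

lemma nested_norm_ball_le:
  fixes c :: "real ^ 'n::finite"
  assumes p: "\<And>j. p $ j > 0" and js: "distinct js" "set js = UNIV" and r: "r > 0"
  shows "nested_norm p js (indicator (ball c r)) x \<le> ennreal ((2 * r) powr (\<Sum>k\<in>UNIV. 1 / p $ k))"
proof -
  have "indicator (ball c r) y \<le> (\<Prod>k\<in>set js. indicator {c $ k - r<..<c $ k + r} (y $ k) :: ennreal)" for y
  proof -
    have "y $ k \<in> {c $ k - r<..<c $ k + r}" if "y \<in> ball c r" for k
      using component_le_norm_cart[of "c - y" k] that by (auto simp: dist_norm)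
    then show ?thesis by (cases "y \<in> ball c r") auto
  qed
  then show ?thesis
    unfolding nested_norm_cube[OF p js r, of c x, symmetric] by (intro nested_norm_mono p)
qed

text \<open>The cube of half side \<open>r / CARD('n)\<close> fits into the ball because the
  Euclidean norm is at most the sum of the moduli of the coordinates.\<close>

lemma nested_norm_ball_ge:
  fixes c :: "real ^ 'n::finite"
  assumes p: "\<And>j. p $ j > 0" and js: "distinct js" "set js = UNIV" and r: "r > 0"
  shows "ennreal ((2 * (r / CARD('n))) powr (\<Sum>k\<in>UNIV. 1 / p $ k)) \<le> nested_norm p js (indicator (ball c r)) x"
proof -
  define d where "d = r / CARD('n)"
  have d: "d > 0" using r by (simp add: d_def)
  have "(\<Prod>k\<in>set js. indicator {c $ k - d<..<c $ k + d} (y $ k) :: ennreal) \<le> indicator (ball c r) y" for y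
  proof (cases "\<forall>k. y $ k \<in> {c $ k - d<..<c $ k + d}")
    case True
    have "norm (c - y) \<le> (\<Sum>k\<in>UNIV. \<bar>(c - y) $ k\<bar>)" by (rule norm_le_l1_cart)
    also have "\<dots> < (\<Sum>k\<in>(UNIV :: 'n set). d)"
    proof (rule sum_strict_mono)
      fix k :: 'n
      have "y $ k \<in> {c $ k - d<..<c $ k + d}" using True ..
      then show "\<bar>(c - y) $ k\<bar> < d" by (simp add: abs_less_iff)
    qed auto
    also have "\<dots> = r" by (simp add: d_def)
    finally show ?thesis using True by (simp add: dist_norm)
  next
    case False
    then obtain k where "y $ k \<notin> {c $ k - d<..<c $ k + d}" by auto
    then have "(\<Prod>k\<in>set js. indicator {c $ k - d<..<c $ k + d} (y $ k) :: ennreal) = 0"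
      by (intro prod_zero bexI[of _ k]) (auto simp: js(2) indicator_def)
    then show ?thesis by (simp only: zero_le)
  qed
  then show ?thesis
    unfolding d_def[symmetric] nested_norm_cube[OF p js d, of c x, symmetric] by (intro nested_norm_mono p)
qed

text \<open>Hoelder's inequality against the indicator of the ball with componentwise conjugate
  exponents, whose reciprocals \<open>1 - 1 / q $ k\<close> sum to the power of
  \<open>2 * r\<close>.\<close>

lemma nn_integral_le_nested_norm:
  fixes F :: "real ^ 'n::finite \<Rightarrow> ennreal"
  assumes q: "\<And>j. q $ j > 1" and js: "distinct js" "set js = UNIV"
    and [measurable]: "F \<in> borel_measurable borel" and r: "r > 0"
  shows "(\<integral>\<^sup>+y\<in>ball c r. F y \<partial>lborel) \<le>
    ennreal ((2 * r) powr (CARD('n) - (\<Sum>k\<in>UNIV. 1 / q $ k))) * nested_norm q js (\<lambda>y. F y * indicator (ball c r) y) x"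
proof -
  define q' :: "real ^ 'n" where "q' = (\<chi> j. q $ j / (q $ j - 1))"
  have q': "q' $ j > 0" "1 / q' $ j = 1 - 1 / q $ j" for j
    using q[of j] by (auto simp: q'_def field_simps)
  have q0: "q $ j > 0" for j using q[of j] by simp
  \<comment> \<open>Two factors indexed by \<open>bool\<close>, so that
    \<open>nested_norm_Holder\<close> applies; the indicator may stand in both, being
    idempotent.\<close>
  let ?ps = "\<lambda>b. if b then q else q'" and ?Fs = "\<lambda>b y. if b then F y * indicator (ball c r) y else indicator (ball c r) y :: ennreal"
  have [measurable]: "ball c r \<in> sets borel" by simp
  have "nested_norm 1 js (\<lambda>y. \<Prod>b\<in>{True, False}. ?Fs b y) x \<le> (\<Prod>b\<in>{True, False}. nested_norm (?ps b) js (?Fs b) x)"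
  proof (rule nested_norm_Holder)
    show "?Fs b \<in> borel_measurable borel" for b by (cases b; simp only: if_True if_False; measurable)
  qed (use q0 q' in auto)
  moreover have "(\<lambda>y. \<Prod>b\<in>{True, False}. ?Fs b y) = (\<lambda>y. F y * indicator (ball c r) y)"
    by (auto simp: fun_eq_iff indicator_def)
  ultimately have "(\<integral>\<^sup>+y\<in>ball c r. F y \<partial>lborel) \<le> nested_norm q js (\<lambda>y. F y * indicator (ball c r) y) x * nested_norm q' js (indicator (ball c r)) x"
    by (simp add: nested_norm_1_eq_lborel[OF js])
  also have "\<dots> \<le> nested_norm q js (\<lambda>y. F y * indicator (ball c r) y) x * ennreal ((2 * r) powr (\<Sum>k\<in>UNIV. 1 / q' $ k))"
    by (intro mult_left_mono nested_norm_ball_le q' js r) auto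
  also have "(\<Sum>k\<in>UNIV. 1 / q' $ k) = CARD('n) - (\<Sum>k\<in>UNIV. 1 / q $ k)"
    by (simp add: q'(2) sum_subtractf)
  finally show ?thesis by (simp add: mult.commute)
qed

text \<open>\<open>F\<close> and \<open>G\<close> may be non-measurable, so a measurable
  \<open>Z\<close> carries the exceptional set. It is a function rather than a set, since
  integrating an indicator in one coordinate yields a general function, whose zeros are the lines on
  which the exceptional set is null.\<close>

lemma nested_norm_eq_on_null:
  assumes Z: "Z \<in> borel_measurable borel" "nested_norm 1 js Z x = 0" and FG: "\<And>y. Z y = 0 \<Longrightarrow> F y = G y"
  shows "nested_norm p js F x = nested_norm p js G x"
  using assms
proof (induction js arbitrary: Z F G)
  case (Cons j js)
  note [measurable] = Cons.prems(1)
  have "coord_norm j (p $ j) F y = coord_norm j (p $ j) G y" if "coord_norm j 1 Z y = 0" for y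
  proof -
    have "AE t in lborel. Z (upd j y t) = 0"
      using that unfolding coord_norm_1 by (subst (asm) nn_integral_0_iff_AE) auto
    then have "AE t in lborel. F (upd j y t) = G (upd j y t)"
      by eventually_elim (rule Cons.prems(3))
    then have "(\<integral>\<^sup>+t. ennreal_powr (F (upd j y t)) (p $ j) \<partial>lborel) = (\<integral>\<^sup>+t. ennreal_powr (G (upd j y t)) (p $ j) \<partial>lborel)"
      by (intro nn_integral_cong_AE) (auto elim!: eventually_mono)
    then show ?thesis by (simp add: coord_norm_def)
  qed
  then show ?case
    using Cons.prems(2) unfolding nested_norm.simps one_index
    by (intro Cons.IH[of "coord_norm j 1 Z"]) auto
qed simp

text \<open>Allows a Lebesgue measurable modulus to be exchanged for a Borel function, although its
  slices may fail to be measurable.\<close>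

lemma nested_norm_cong_AE:
  fixes F G :: "real ^ 'n::finite \<Rightarrow> ennreal"
  assumes js: "distinct js" "set js = UNIV" and FG: "AE y in lborel. F y = G y"
  shows "nested_norm p js F x = nested_norm p js G x"
proof -
  obtain N where N: "N \<in> null_sets lborel" "{y \<in> space lborel. F y \<noteq> G y} \<subseteq> N"
    using FG unfolding eventually_ae_filter by auto
  have [measurable]: "N \<in> sets borel" using N(1) by auto
  have "nested_norm 1 js (indicator N) x = 0"
    using N(1) by (subst nested_norm_1_eq_lborel[OF js]) auto
  then show ?thesis
    using N(2) by (intro nested_norm_eq_on_null[of "indicator N"]) (auto simp: indicator_def split: if_splits)
qed

text \<open>The same tracking as in \<open>nested_norm_eq_on_null\<close>: on a line where
  \<open>Z\<close> is not null, \<open>F\<close> is infinite on a set of positive measure, so its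
  norm along that line is infinite again.\<close>

lemma nested_norm_finite_imp:
  assumes p: "\<And>j. p $ j > 0" and "Z \<in> borel_measurable borel" "F \<in> borel_measurable borel"
    and "\<And>y. Z y \<noteq> 0 \<Longrightarrow> F y = top" "nested_norm p js F x < top"
  shows "nested_norm 1 js Z x = 0"
  using assms(2-)
proof (induction js arbitrary: Z F)
  case Nil
  then show ?case by (metis less_irrefl nested_norm.simps(1))
next
  case (Cons j js)
  note [measurable] = Cons.prems(1,2)
  have "coord_norm j (p $ j) F y = top" if "coord_norm j 1 Z y \<noteq> 0" for y
  proof (rule ccontr)
    assume "coord_norm j (p $ j) F y \<noteq> top"
    then have "(\<integral>\<^sup>+t. ennreal_powr (F (upd j y t)) (p $ j) \<partial>lborel) \<noteq> top"
      by (simp add: coord_norm_def)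
    then have "AE t in lborel. ennreal_powr (F (upd j y t)) (p $ j) \<noteq> top"
      by (subst infinity_ennreal_def[symmetric], intro nn_integral_PInf_AE) auto
    then have "AE t in lborel. Z (upd j y t) = 0"
      by eventually_elim (use Cons.prems(3) in auto)
    then have "coord_norm j 1 Z y = 0"
      unfolding coord_norm_1 by (subst nn_integral_0_iff_AE) auto
    then show False using that by simp
  qed
  then show ?case
    using Cons.prems(4) unfolding nested_norm.simps one_index
    by (intro Cons.IH[of "coord_norm j 1 Z" "coord_norm j (p $ j) F"]) auto
qed

lemma nested_norm_finite_imp_AE:
  assumes p: "\<And>j. p $ j > 0" and js: "distinct js" "set js = UNIV"
    and [measurable]: "F \<in> borel_measurable borel" and fin: "nested_norm p js F x < top"
  shows "AE y in lborel. F y < top"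
proof -
  define Z where "Z y = (indicator {y. F y = top} y :: ennreal)" for y
  have [measurable]: "Z \<in> borel_measurable borel" unfolding Z_def by measurable
  have "nested_norm 1 js Z x = 0"
    by (rule nested_norm_finite_imp[OF p _ _ _ fin]) (auto simp: Z_def indicator_def)
  then have "(\<integral>\<^sup>+y. Z y \<partial>lborel) = 0" by (simp add: nested_norm_1_eq_lborel[OF js])
  then have "AE y in lborel. Z y = 0" by (subst (asm) nn_integral_0_iff_AE) auto
  then show ?thesis by eventually_elim (auto simp: Z_def indicator_def less_top split: if_splits)
qed

subsection \<open>Morrey spaces\<close>

abbreviation coords :: "'n::{finite,linorder} list" where
  "coords \<equiv> sorted_list_of_set UNIV"

lemma coords: "distinct (coords :: 'n::{finite,linorder} list)" "set (coords :: 'n::{finite,linorder} list) = UNIV"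
  by simp_all

text \<open>For a non-measurable slice of the weight, \<open>nn_integral\<close> is the supremum
  over simple functions below it; the estimates rely on its monotonicity, which still holds.\<close>

definition weight_tail :: "('a \<Rightarrow> real \<Rightarrow> real) \<Rightarrow> 'a \<Rightarrow> real \<Rightarrow> ennreal" where
  "weight_tail \<phi> x r = (\<integral>\<^sup>+t\<in>{r<..}. ennreal (\<phi> x t / t) \<partial>lebesgue)"

lemma weight_tail_antimono: "r \<le> s \<Longrightarrow> weight_tail \<phi> x s \<le> weight_tail \<phi> x r"
  unfolding weight_tail_def by (intro nn_integral_mono mult_left_mono) (auto simp: indicator_def)

lemma mixed_norm_mono:
  "(\<And>j. p $ j > 0) \<Longrightarrow> (\<And>y. F y \<le> G y) \<Longrightarrow> mixed_norm p F \<le> mixed_norm p G"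
  by (simp add: mixed_norm_eq_nested_norm nested_norm_mono)

lemma mixed_norm_cong_AE:
  "(\<And>j. p $ j > 0) \<Longrightarrow> AE y in lborel. F y = G y \<Longrightarrow> mixed_norm p F = mixed_norm p G"
  by (simp add: mixed_norm_eq_nested_norm nested_norm_cong_AE[OF coords])

lemma morrey_norm_mono:
  "(\<And>j. p $ j > 0) \<Longrightarrow> (\<And>y. F y \<le> G y) \<Longrightarrow> morrey_norm \<phi> p F \<le> morrey_norm \<phi> p G"
  unfolding morrey_norm_def by (intro SUP_mono' mult_left_mono mixed_norm_mono mult_right_mono) auto

lemma morrey_norm_cong_AE:
  assumes p: "\<And>j. p $ j > 0" and FG: "AE y in lborel. F y = G y"
  shows "morrey_norm \<phi> p F = morrey_norm \<phi> p G"
proof -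
  have "mixed_norm p (\<lambda>y. F y * indicator (ball x r) y) = mixed_norm p (\<lambda>y. G y * indicator (ball x r) y)" for x r
    using FG by (intro mixed_norm_cong_AE p) (auto elim!: eventually_mono)
  then show ?thesis unfolding morrey_norm_def by simp
qed

lemma mixed_norm_ball:
  fixes x :: "real ^ 'n::{finite,linorder}"
  assumes p: "\<And>j. p $ j > 0" and r: "r > 0"
  shows "mixed_norm p (indicator (ball x r)) \<le> ennreal ((2 * r) powr (\<Sum>k\<in>UNIV. 1 / p $ k))"
    "ennreal ((2 * (r / CARD('n))) powr (\<Sum>k\<in>UNIV. 1 / p $ k)) \<le> mixed_norm p (indicator (ball x r))"
    "mixed_norm p (indicator (ball x r)) \<noteq> 0" "mixed_norm p (indicator (ball x r)) \<noteq> top"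
proof -
  show 1: "mixed_norm p (indicator (ball x r)) \<le> ennreal ((2 * r) powr (\<Sum>k\<in>UNIV. 1 / p $ k))"
    unfolding mixed_norm_eq_nested_norm[OF p] by (intro nested_norm_ball_le p coords r)
  show 2: "ennreal ((2 * (r / CARD('n))) powr (\<Sum>k\<in>UNIV. 1 / p $ k)) \<le> mixed_norm p (indicator (ball x r))"
    unfolding mixed_norm_eq_nested_norm[OF p] by (intro nested_norm_ball_ge p coords r)
  show "mixed_norm p (indicator (ball x r)) \<noteq> 0"
    using 2 r by (auto simp: ennreal_eq_0_iff)
  show "mixed_norm p (indicator (ball x r)) \<noteq> top"
    using 1 by (auto simp: top_unique)
qed

lemma mixed_norm_le_morrey_norm:
  fixes x :: "real ^ 'n::{finite,linorder}"
  assumes p: "\<And>j. p $ j > 0" and r: "r > 0" and \<phi>: "\<phi> x r > 0"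
  shows "mixed_norm p (\<lambda>y. F y * indicator (ball x r) y)
    \<le> ennreal (\<phi> x r * (2 * r) powr (\<Sum>k\<in>UNIV. 1 / p $ k)) * morrey_norm \<phi> p F"
proof -
  let ?X = "mixed_norm p (\<lambda>y. F y * indicator (ball x r) y)" and ?b = "mixed_norm p (indicator (ball x r))"
  obtain b where b: "?b = ennreal b" "b > 0" "b \<le> (2 * r) powr (\<Sum>k\<in>UNIV. 1 / p $ k)"
    using mixed_norm_ball[where p = p, OF p r, of x] by (cases ?b) auto
  have "inverse (ennreal (\<phi> x r)) * inverse ?b * ?X \<le> morrey_norm \<phi> p F"
    unfolding morrey_norm_def using r by (intro SUP_upper2[of x] SUP_upper2[of r]) auto
  then have "ennreal (\<phi> x r * b) * (ennreal (1 / (\<phi> x r * b)) * ?X) \<le> ennreal (\<phi> x r * b) * morrey_norm \<phi> p F"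
    using b \<phi> by (intro mult_left_mono) (simp_all add: inverse_ennreal inverse_eq_divide flip: ennreal_mult)
  also have "\<dots> \<le> ennreal (\<phi> x r * (2 * r) powr (\<Sum>k\<in>UNIV. 1 / p $ k)) * morrey_norm \<phi> p F"
    using b \<phi> by (intro mult_right_mono ennreal_leI mult_left_mono) auto
  also have "ennreal (\<phi> x r * b) * (ennreal (1 / (\<phi> x r * b)) * ?X) = ?X"
    using ennreal_mult_inverse_cancel[of "\<phi> x r * b" ?X] b \<phi> by (simp add: mult.commute)
  finally show ?thesis .
qed

text \<open>The weight need not be monotone in the radius, but the left-hand side is, so averaging over
  \<open>s < t < 2 s\<close> brings in the integral of the weight. Its slices need not be measurable, hence the
  comparison with a constant.\<close>
lemma mixed_norm_le_weight_tail:
  fixes x :: "real ^ 'n::{finite,linorder}"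
  assumes p: "\<And>j. p $ j > 0" and s: "s > 0" and \<phi>: "\<And>r. r > 0 \<Longrightarrow> \<phi> x r > 0"
    and fin: "morrey_norm \<phi> p F < top"
  shows "mixed_norm p (\<lambda>y. F y * indicator (ball x s) y)
    \<le> ennreal (2 * (4 * s) powr (\<Sum>k\<in>UNIV. 1 / p $ k)) * (morrey_norm \<phi> p F * weight_tail \<phi> x s)"
proof -
  let ?Q = "\<Sum>k\<in>UNIV. 1 / p $ k"
  have Q: "?Q \<ge> 0" using p by (intro sum_nonneg) (simp add: less_imp_le)
  obtain N where N: "morrey_norm \<phi> p F = ennreal N" "N \<ge> 0" using fin by (cases "morrey_norm \<phi> p F") auto
  have le: "mixed_norm p (\<lambda>y. F y * indicator (ball x r) y) \<le> ennreal (\<phi> x r * (2 * r) powr ?Q * N)" if "r > 0" for r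
    using mixed_norm_le_morrey_norm[where p = p and F = F and \<phi> = \<phi>, OF p that \<phi>[OF that]] \<phi>[OF that] N by (simp add: ennreal_mult)
  let ?X = "mixed_norm p (\<lambda>y. F y * indicator (ball x s) y)"
  obtain X where X: "?X = ennreal X" "X \<ge> 0"
    using le[OF s] by (cases ?X) (auto simp: top_unique)
  show ?thesis
  proof (cases "N = 0")
    case True
    then show ?thesis using le[OF s] by simp
  next
    case False
    define c where "c = (4 * s) powr ?Q * N"
    have c: "c > 0" using False N s by (simp add: c_def)
    \<comment> \<open>For \<open>t\<close> between \<open>s\<close> and \<open>2 * s\<close> the
      weight is at least \<open>X / c\<close>, because the larger ball contains the smaller and
      \<open>2 * t\<close> is below \<open>4 * s\<close>. Division by \<open>t < 2 * s\<close> and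
      the interval length \<open>s\<close> leave the factor \<open>2\<close>.\<close>
    have "ennreal (X / (2 * c * s)) * indicator {s<..<2 * s} t \<le> ennreal (\<phi> x t / t) * indicator {s<..} t" for t
    proof (cases "t \<in> {s<..<2 * s}")
      case True
      then have t: "s < t" "t < 2 * s" "t > 0" using s by auto
      have "ennreal X \<le> mixed_norm p (\<lambda>y. F y * indicator (ball x t) y)"
        unfolding X(1)[symmetric] using t by (intro mixed_norm_mono p mult_left_mono) (auto simp: indicator_def)
      also have "\<dots> \<le> ennreal (\<phi> x t * (2 * t) powr ?Q * N)" by (rule le[OF t(3)])
      also have "\<dots> \<le> ennreal (\<phi> x t * (4 * s) powr ?Q * N)"
        using t \<phi>[OF t(3)] N Q by (intro ennreal_leI mult_right_mono mult_left_mono powr_mono2) auto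
      finally have "X \<le> \<phi> x t * c"
        using \<phi>[OF t(3)] N by (simp add: c_def mult.assoc)
      then have "X / (2 * c * s) \<le> \<phi> x t / (2 * s)"
        using c s by (simp add: field_simps)
      also have "\<dots> \<le> \<phi> x t / t"
        using t \<phi>[OF t(3)] by (intro divide_left_mono) auto
      finally show ?thesis using True by (simp add: ennreal_leI)
    qed simp
    then have "(\<integral>\<^sup>+t. ennreal (X / (2 * c * s)) * indicator {s<..<2 * s} t \<partial>lebesgue) \<le> weight_tail \<phi> x s"
      unfolding weight_tail_def by (intro nn_integral_mono)
    moreover have "(\<integral>\<^sup>+t. ennreal (X / (2 * c * s)) * indicator {s<..<2 * s} t \<partial>lebesgue) = ennreal (X / (2 * c))"
      using s X c by (subst nn_integral_cmult_indicator) (simp_all flip: ennreal_mult)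
    ultimately have "ennreal (2 * c) * ennreal (X / (2 * c)) \<le> ennreal (2 * c) * weight_tail \<phi> x s"
      by (intro mult_left_mono) auto
    then show ?thesis
      using c X N s False unfolding c_def by (simp add: mult.assoc flip: ennreal_mult) (simp add: ennreal_mult mult_ac)
  qed
qed

lemma ennreal_mult_divide_cancel:
  assumes "c \<ge> 0" "v > 0"
  shows "ennreal (c * v) * u / ennreal v = ennreal c * u"
proof -
  have "ennreal (c * v) * u / ennreal v = ennreal c * u * (ennreal v / ennreal v)"
    using assms by (simp add: ennreal_mult divide_ennreal_def mult_ac)
  also have "ennreal v / ennreal v = 1" using assms by (simp add: divide_ennreal)
  finally show ?thesis by simp
qed

text \<open>One majorant \<open>H\<close> serves all radii \<open>t\<close>, which lets the supremum
  be taken after several such bounds are multiplied. The constant is fixed before weight, function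
  and ball.\<close>

lemma ball_average_le_majorant:
  fixes q :: "real ^ 'n::{finite,linorder}"
  assumes q: "\<And>j. q $ j > 1"
  obtains C where "C > 0" "\<And>\<phi> g x r. (\<And>t. t > 0 \<Longrightarrow> \<phi> x t > 0) \<Longrightarrow> g \<in> borel_measurable borel \<Longrightarrow>
    morrey_norm \<phi> q g < top \<Longrightarrow> r > 0 \<Longrightarrow>
    \<exists>H \<in> borel_measurable borel.
      (\<forall>y\<in>ball x r. \<forall>t>0. (\<integral>\<^sup>+z\<in>ball y t. g z \<partial>lborel) / emeasure lborel (ball y t) \<le> H y) \<and>
      mixed_norm q (\<lambda>y. H y * indicator (ball x r) y)
        \<le> ennreal (C * r powr (\<Sum>k\<in>UNIV. 1 / q $ k)) * (morrey_norm \<phi> q g * weight_tail \<phi> x r)"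
proof -
  let ?Q = "\<Sum>k\<in>UNIV. 1 / q $ k" and ?n = "CARD('n)"
  have q0: "q $ j > 0" and q1: "q $ j \<ge> 1" for j using q[of j] by auto
  note mixed = mixed_norm_eq_nested_norm[of q, OF q0]
  obtain D where D: "D > 0" "\<And>F x. F \<in> borel_measurable borel \<Longrightarrow>
    nested_norm q coords (coord_max_list coords F) x \<le> ennreal D * nested_norm q coords F x"
    by (rule coord_max_list_bounded[where p = q and js = coords and ks = coords, OF q coords(1)]) auto
  define ub where "ub = unit_ball_vol (real ?n)"
  have ub: "ub > 0" by (simp add: ub_def)
  have ball: "emeasure lborel (ball y t) = ennreal (ub * t ^ ?n)" if "t > 0" for y :: "real ^ 'n::{finite,linorder}" and t
    using that by (simp add: emeasure_ball ub_def)
  \<comment> \<open>Relative to the volume of a ball, \<open>c1\<close> measures the cube bound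
    \<open>(4 * t) ^ ?n\<close> and \<open>c2\<close> the product of the Hoelder factor and the tail
    bound. In \<open>C\<close>, \<open>4 ^ ?n\<close> comes from the triangle inequality in all
    coordinates and \<open>8\<close> from \<open>4 * (2 * r)\<close>.\<close>
  define c1 where "c1 = 4 ^ ?n / ub"
  define c2 where "c2 = 2 * 2 powr ?Q * 4 ^ ?n / ub"
  have c: "c1 > 0" "c2 > 0" using ub by (simp_all add: c1_def c2_def)
  define C where "C = 4 ^ ?n * (c1 * D * (2 * 8 powr ?Q) + c2 * 2 powr ?Q)"
  show ?thesis
  proof (rule that[of C])
    show "C > 0" unfolding C_def using c D by (intro mult_pos_pos add_pos_pos) auto
    fix \<phi> :: "real ^ 'n::{finite,linorder} \<Rightarrow> real \<Rightarrow> real" and g x and r :: real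
    assume \<phi>: "\<And>t. t > 0 \<Longrightarrow> \<phi> x t > 0" and [measurable]: "g \<in> borel_measurable borel"
      and fin: "morrey_norm \<phi> q g < top" and r: "r > 0"
    let ?NE = "morrey_norm \<phi> q g * weight_tail \<phi> x r"
    have [measurable]: "ball y t \<in> sets borel" for y :: "real ^ 'n::{finite,linorder}" and t by simp
    define G where "G y = g y * indicator (ball x (2 * r)) y" for y
    have [measurable]: "G \<in> borel_measurable borel" unfolding G_def by measurable
    define H where "H y = ennreal c1 * coord_max_list coords G y + ennreal c2 * ?NE" for y
    have [measurable]: "H \<in> borel_measurable borel" unfolding H_def by measurable
    have tail: "mixed_norm q (\<lambda>y. g y * indicator (ball x (2 * s)) y)
       \<le> ennreal (2 * (8 * s) powr ?Q) * ?NE" if "s \<ge> r" for s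
    proof -
      have "mixed_norm q (\<lambda>y. g y * indicator (ball x (2 * s)) y)
        \<le> ennreal (2 * (4 * (2 * s)) powr ?Q) * (morrey_norm \<phi> q g * weight_tail \<phi> x (2 * s))"
        using r that by (intro mixed_norm_le_weight_tail q0 \<phi> fin) auto
      also have "\<dots> \<le> ennreal (2 * (4 * (2 * s)) powr ?Q) * ?NE"
        using r that by (intro mult_left_mono weight_tail_antimono) auto
      finally show ?thesis by simp
    qed
    have "(\<integral>\<^sup>+z\<in>ball y t. g z \<partial>lborel) / emeasure lborel (ball y t) \<le> H y" if y: "y \<in> ball x r" and t: "t > 0" for y t
    proof (cases "t \<le> r")
      case True
      have "(\<integral>\<^sup>+z\<in>ball y t. g z \<partial>lborel) = (\<integral>\<^sup>+z\<in>ball y t. G z \<partial>lborel)"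
      proof (intro nn_integral_cong)
        fix z
        have "z \<in> ball x (2 * r)" if "z \<in> ball y t"
          using dist_triangle[of x z y] that y True by simp
        then show "g z * indicator (ball y t) z = G z * indicator (ball y t) z"
          by (auto simp: G_def indicator_def)
      qed
      also have "\<dots> \<le> ennreal ((4 * t) ^ ?n) * coord_max_list coords G y"
        using t by (intro nn_integral_ball_le_coord_max_list coords) auto
      finally have "(\<integral>\<^sup>+z\<in>ball y t. g z \<partial>lborel) / emeasure lborel (ball y t)
          \<le> ennreal ((4 * t) ^ ?n) * coord_max_list coords G y / emeasure lborel (ball y t)"
        by (rule divide_right_mono_ennreal)
      also have "(4 * t) ^ ?n = c1 * (ub * t ^ ?n)" using ub by (simp add: c1_def power_mult_distrib)
      also have "ennreal (c1 * (ub * t ^ ?n)) * coord_max_list coords G y / emeasure lborel (ball y t)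
          = ennreal c1 * coord_max_list coords G y"
        unfolding ball[OF t] using c t ub by (intro ennreal_mult_divide_cancel) auto
      finally show ?thesis unfolding H_def by (rule order_trans) simp
    next
      case False
      have "(\<integral>\<^sup>+z\<in>ball y t. g z \<partial>lborel) \<le> (\<integral>\<^sup>+z\<in>ball x (2 * t). g z \<partial>lborel)"
      proof (intro nn_integral_mono mult_left_mono)
        fix z
        have "z \<in> ball x (2 * t)" if "z \<in> ball y t"
          using dist_triangle[of x z y] that y False by simp
        then show "indicator (ball y t) z \<le> (indicator (ball x (2 * t)) z :: ennreal)"
          by (auto simp: indicator_def)
      qed simp
      also have "\<dots> \<le> ennreal ((2 * (2 * t)) powr (?n - ?Q)) * mixed_norm q (\<lambda>y. g y * indicator (ball x (2 * t)) y)"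
        unfolding mixed using t by (intro nn_integral_le_nested_norm q coords) auto
      also have "\<dots> \<le> ennreal ((2 * (2 * t)) powr (?n - ?Q)) * (ennreal (2 * (8 * t) powr ?Q) * ?NE)"
        using False by (intro mult_left_mono tail) auto
      also have "\<dots> = ennreal ((4 * t) powr (?n - ?Q) * (2 * (8 * t) powr ?Q)) * ?NE"
        by (simp add: ennreal_mult'' mult.assoc)
      \<comment> \<open>The powers of \<open>t\<close> combine to \<open>t ^ ?n\<close>, matching
        the volume, so the resulting bound does not depend on the radius.\<close>
      also have "(4 * t) powr (?n - ?Q) * (2 * (8 * t) powr ?Q) = c2 * (ub * t ^ ?n)"
      proof -
        have "(8 * t) powr ?Q = 2 powr ?Q * (4 * t) powr ?Q"
          using t powr_mult[of 2 "4 * t" ?Q] by simp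
        moreover have "(4 * t) powr (?n - ?Q) * (4 * t) powr ?Q = (4 * t) powr ?n"
          by (simp flip: powr_add)
        moreover have "(4 * t) powr ?n = 4 ^ ?n * t ^ ?n"
          using t by (simp add: powr_realpow power_mult_distrib)
        ultimately show ?thesis
          using ub by (simp add: c2_def mult_ac)
      qed
      finally have "(\<integral>\<^sup>+z\<in>ball y t. g z \<partial>lborel) / emeasure lborel (ball y t)
          \<le> ennreal (c2 * (ub * t ^ ?n)) * ?NE / emeasure lborel (ball y t)"
        by (rule divide_right_mono_ennreal)
      also have "\<dots> = ennreal c2 * ?NE"
        unfolding ball[OF t] using c t ub by (intro ennreal_mult_divide_cancel) auto
      finally show ?thesis unfolding H_def by (rule order_trans) simp
    qed
    moreover have "mixed_norm q (\<lambda>y. H y * indicator (ball x r) y) \<le> ennreal (C * r powr ?Q) * ?NE"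
    proof -
      have 1: "nested_norm q coords (\<lambda>y. ennreal c1 * coord_max_list coords G y) 0
        \<le> ennreal (c1 * D * (2 * (8 * r) powr ?Q)) * ?NE"
      proof -
        have "nested_norm q coords (\<lambda>y. ennreal c1 * coord_max_list coords G y) 0
           = ennreal c1 * nested_norm q coords (coord_max_list coords G) 0"
          by (intro nested_norm_cmult q0) measurable
        also have "\<dots> \<le> ennreal c1 * (ennreal D * nested_norm q coords G 0)"
          by (intro mult_left_mono D) auto
        also have "\<dots> \<le> ennreal c1 * (ennreal D * (ennreal (2 * (8 * r) powr ?Q) * ?NE))"
          using tail[of r] by (intro mult_left_mono) (auto simp: mixed G_def[abs_def])
        finally show ?thesis using c D by (simp add: ennreal_mult mult_ac)
      qed
      have 2: "nested_norm q coords (\<lambda>y. (ennreal c2 * ?NE) * indicator (ball x r) y) 0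
         \<le> ennreal (c2 * (2 * r) powr ?Q) * ?NE"
      proof -
        have "nested_norm q coords (\<lambda>y. (ennreal c2 * ?NE) * indicator (ball x r) y) 0
          = (ennreal c2 * ?NE) * nested_norm q coords (indicator (ball x r)) 0"
          by (intro nested_norm_cmult q0) measurable
        also have "\<dots> \<le> (ennreal c2 * ?NE) * ennreal ((2 * r) powr ?Q)"
          using r by (intro mult_left_mono nested_norm_ball_le q0 coords) auto
        finally show ?thesis using c by (simp add: ennreal_mult mult_ac)
      qed
      have "mixed_norm q (\<lambda>y. H y * indicator (ball x r) y)
        \<le> nested_norm q coords (\<lambda>y. ennreal c1 * coord_max_list coords G y + (ennreal c2 * ?NE) * indicator (ball x r) y) 0"
        unfolding mixed by (intro nested_norm_mono q0) (auto simp: H_def indicator_def)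
      also have "\<dots> \<le> 4 ^ length (coords :: 'n list) * (nested_norm q coords (\<lambda>y. ennreal c1 * coord_max_list coords G y) 0
          + nested_norm q coords (\<lambda>y. (ennreal c2 * ?NE) * indicator (ball x r) y) 0)"
        by (intro nested_norm_add_le q1) measurable
      also have "\<dots> \<le> 4 ^ length (coords :: 'n list) * (ennreal (c1 * D * (2 * (8 * r) powr ?Q)) * ?NE + ennreal (c2 * (2 * r) powr ?Q) * ?NE)"
        by (intro mult_left_mono add_mono 1 2) auto
      also have "\<dots> = ennreal (4 ^ ?n * (c1 * D * (2 * (8 * r) powr ?Q) + c2 * (2 * r) powr ?Q)) * ?NE"
      proof -
        have "4 ^ length (coords :: 'n list) = ennreal (4 ^ ?n)" by (simp flip: ennreal_power)
        then show ?thesis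
          using c D by (simp add: ennreal_mult distrib_right mult.assoc)
      qed
      also have "4 ^ ?n * (c1 * D * (2 * (8 * r) powr ?Q) + c2 * (2 * r) powr ?Q) = C * r powr ?Q"
        using r by (simp add: C_def powr_mult algebra_simps)
      finally show ?thesis .
    qed
    ultimately show "\<exists>H \<in> borel_measurable borel.
      (\<forall>y\<in>ball x r. \<forall>t>0. (\<integral>\<^sup>+z\<in>ball y t. g z \<partial>lborel) / emeasure lborel (ball y t) \<le> H y) \<and>
      mixed_norm q (\<lambda>y. H y * indicator (ball x r) y) \<le> ennreal (C * r powr ?Q) * ?NE"
      by (intro bexI[of _ H]) auto
  qed
qed

text \<open>Membership in the ball is an open condition on the pair of centre and point, so this is
  the measurability of section integrals in Tonelli's theorem.\<close>

lemma measurable_ball_integral: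
  fixes g :: "real ^ 'n::finite \<Rightarrow> ennreal"
  assumes [measurable]: "g \<in> borel_measurable borel"
  shows "(\<lambda>y. \<integral>\<^sup>+z\<in>ball y t. g z \<partial>lborel) \<in> borel_measurable borel"
proof -
  have "(\<integral>\<^sup>+z\<in>ball y t. g z \<partial>lborel) = (\<integral>\<^sup>+z. g z * indicator {u. dist (fst u) (snd u) < t} (y, z) \<partial>lborel)" for y
    by (intro nn_integral_cong) (simp add: indicator_def)
  moreover have "open {u :: (real ^ 'n) \<times> (real ^ 'n). dist (fst u) (snd u) < t}"
    by (intro open_Collect_less continuous_intros)
  then have [measurable]: "{u :: (real ^ 'n) \<times> (real ^ 'n). dist (fst u) (snd u) < t} \<in> sets (borel \<Otimes>\<^sub>M borel)"
    unfolding borel_prod by simp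
  have "(\<lambda>y. \<integral>\<^sup>+z. g z * indicator {u. dist (fst u) (snd u) < t} (y, z) \<partial>lborel) \<in> borel_measurable borel"
    by measurable
  ultimately show ?thesis by simp
qed

text \<open>By left-continuity in the radius, rational radii suffice.\<close>
lemma SUP_ball_average_rational:
  fixes g :: "'i \<Rightarrow> real ^ 'n::finite \<Rightarrow> ennreal"
  assumes I: "finite I" and g: "\<And>i. i \<in> I \<Longrightarrow> g i \<in> borel_measurable borel"
    and fin: "\<And>i r. i \<in> I \<Longrightarrow> (\<integral>\<^sup>+z\<in>ball y r. g i z \<partial>lborel) < top"
  shows "(SUP r\<in>{0<..}. \<Prod>i\<in>I. (\<integral>\<^sup>+z\<in>ball y r. g i z \<partial>lborel) / emeasure lborel (ball y r))
    = (SUP r\<in>{0<..} \<inter> \<rat>. \<Prod>i\<in>I. (\<integral>\<^sup>+z\<in>ball y r. g i z \<partial>lborel) / emeasure lborel (ball y r))"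
    (is "?L = ?R")
proof (rule antisym)
  show "?R \<le> ?L" by (intro SUP_subset_mono) auto
  show "?L \<le> ?R"
  proof (rule SUP_least)
    fix r :: real assume "r \<in> {0<..}"
    then have r: "r > 0" by simp
    define a where "a i s = enn2real (\<integral>\<^sup>+z\<in>ball y s. g i z \<partial>lborel)" for i s
    define v where "v s = unit_ball_vol (real CARD('n)) * s ^ CARD('n)" for s :: real
    have v: "emeasure lborel (ball y s) = ennreal (v s)" "v s > 0" if "s > 0" for s
      using that by (simp_all add: emeasure_ball v_def)
    have a: "(\<integral>\<^sup>+z\<in>ball y s. g i z \<partial>lborel) = ennreal (a i s)" "a i s \<ge> 0" if "i \<in> I" for i s
      using fin[OF that] by (simp_all add: a_def)
    have prod: "(\<Prod>i\<in>I. (\<integral>\<^sup>+z\<in>ball y s. g i z \<partial>lborel) / emeasure lborel (ball y s)) = ennreal (\<Prod>i\<in>I. a i s / v s)"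
      if "s > 0" for s
    proof -
      have "(\<Prod>i\<in>I. (\<integral>\<^sup>+z\<in>ball y s. g i z \<partial>lborel) / emeasure lborel (ball y s)) = (\<Prod>i\<in>I. ennreal (a i s / v s))"
        using a v[OF that] by (intro prod.cong) (auto simp: divide_ennreal)
      also have "\<dots> = ennreal (\<Prod>i\<in>I. a i s / v s)"
        using a v[OF that] by (intro prod_ennreal) auto
      finally show ?thesis .
    qed
    \<comment> \<open>Radii increasing to \<open>r\<close> from below; the \<open>2\<close> keeps
      the first one positive.\<close>
    define s where "s k = r * (1 - 1 / (real k + 2))" for k :: nat
    have s: "0 < s k" "s k < r" for k using r by (simp_all add: s_def field_simps add_pos_nonneg)
    have s_inc: "s k \<le> s l" if "k \<le> l" for k l
      unfolding s_def using r that by (intro mult_left_mono diff_left_mono divide_left_mono) auto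
    have s_lim: "s \<longlonglongrightarrow> r"
    proof -
      have "(\<lambda>k. r * (1 - inverse (real (Suc (Suc k))))) \<longlonglongrightarrow> r * (1 - 0)"
        by (intro tendsto_intros LIMSEQ_Suc[OF LIMSEQ_inverse_real_of_nat])
      then show ?thesis by (simp add: s_def[abs_def] inverse_eq_divide add.commute)
    qed
    have Un: "(\<Union>k. ball y (s k)) = ball y r"
    proof (rule antisym)
      show "(\<Union>k. ball y (s k)) \<subseteq> ball y r" using s(2) by (force intro: less_trans)
      show "ball y r \<subseteq> (\<Union>k. ball y (s k))"
      proof
        fix z assume "z \<in> ball y r"
        then have "eventually (\<lambda>k. dist y z < s k) sequentially"
          using order_tendstoD(1)[OF s_lim] by simp
        then obtain k where "dist y z < s k" by (auto simp: eventually_sequentially)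
        then show "z \<in> (\<Union>k. ball y (s k))" by auto
      qed
    qed
    have lim: "(\<lambda>k. a i (s k)) \<longlonglongrightarrow> a i r" if i: "i \<in> I" for i
    proof -
      note [measurable] = g[OF i]
      have meas: "emeasure (density lborel (g i)) (ball y t) = ennreal (a i t)" for t
        using a(1)[OF i] by (simp add: emeasure_density)
      have "(\<lambda>k. emeasure (density lborel (g i)) (ball y (s k))) \<longlonglongrightarrow> emeasure (density lborel (g i)) (\<Union>k. ball y (s k))"
        by (rule Lim_emeasure_incseq) (auto simp: incseq_def intro!: subset_ball s_inc)
      then show ?thesis
        unfolding Un meas using a(2)[OF i] by (simp add: tendsto_ennreal_iff)
    qed
    have "(\<lambda>k. ennreal (\<Prod>i\<in>I. a i (s k) / v r)) \<longlonglongrightarrow> ennreal (\<Prod>i\<in>I. a i r / v r)"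
      using v(2)[OF r] by (intro tendsto_ennrealI tendsto_prod tendsto_divide lim tendsto_const) auto
    \<comment> \<open>A rational \<open>u\<close> between \<open>s k\<close> and \<open>r\<close>
      has at least the integral of \<open>s k\<close> and at most the volume of \<open>r\<close>, so
      its average dominates.\<close>
    moreover have "ennreal (\<Prod>i\<in>I. a i (s k) / v r) \<le> ?R" for k
    proof -
      obtain u where u: "u \<in> \<rat>" "s k < u" "u < r" using Rats_dense_in_real[OF s(2)] by blast
      have u0: "u > 0" using s(1)[of k] u by simp
      have "v u \<le> v r" unfolding v_def using u u0 by (intro mult_left_mono power_mono) auto
      moreover have "a i (s k) \<le> a i u" if i: "i \<in> I" for i
      proof -
        have "(\<integral>\<^sup>+z\<in>ball y (s k). g i z \<partial>lborel) \<le> (\<integral>\<^sup>+z\<in>ball y u. g i z \<partial>lborel)"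
          using u by (intro nn_integral_mono mult_left_mono) (auto simp: indicator_def)
        then show ?thesis using a[OF i] by simp
      qed
      ultimately have "(\<Prod>i\<in>I. a i (s k) / v r) \<le> (\<Prod>i\<in>I. a i u / v u)"
        using a v(2)[OF u0] v(2)[OF r] by (intro prod_mono conjI frac_le divide_nonneg_pos) auto
      then have "ennreal (\<Prod>i\<in>I. a i (s k) / v r) \<le> (\<Prod>i\<in>I. (\<integral>\<^sup>+z\<in>ball y u. g i z \<partial>lborel) / emeasure lborel (ball y u))"
        unfolding prod[OF u0] by (rule ennreal_leI)
      also have "\<dots> \<le> ?R" using u u0 by (intro SUP_upper) auto
      finally show ?thesis .
    qed
    ultimately have "ennreal (\<Prod>i\<in>I. a i r / v r) \<le> ?R"
      by (intro LIMSEQ_le_const2) auto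
    then show "(\<Prod>i\<in>I. (\<integral>\<^sup>+z\<in>ball y r. g i z \<partial>lborel) / emeasure lborel (ball y r)) \<le> ?R"
      unfolding prod[OF r] .
  qed
qed

lemma lebesgue_modulus_borel:
  fixes f :: "real ^ 'n::finite \<Rightarrow> complex"
  assumes "f \<in> borel_measurable lebesgue"
  obtains g where "g \<in> borel_measurable borel" "AE y in lborel. ennreal (cmod (f y)) = g y"
proof -
  have "(\<lambda>y. ennreal (cmod (f y))) \<in> borel_measurable (completion lborel)"
    using assms by measurable
  from completion_ex_borel_measurable[OF this] show ?thesis using that by auto
qed

section \<open>The multilinear estimate on Morrey spaces\<close>

theorem theorem5p6:
  fixes m :: nat
    and qs :: "nat \<Rightarrow> real ^ 'n::{finite,linorder}"
    and q :: "real ^ 'n::{finite,linorder}"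
    and \<phi> :: "real ^ 'n::{finite,linorder} \<Rightarrow> real \<Rightarrow> real"
    and \<phi>s :: "nat \<Rightarrow> real ^ 'n::{finite,linorder} \<Rightarrow> real \<Rightarrow> real"
    and C\<^sub>0 :: real
  assumes "m \<ge> 2"
    and "\<And>i j. i \<in> {1..m} \<Longrightarrow> 1 < qs i $ j"
    and "\<And>j. 1 / (q $ j) = (\<Sum>i\<in>{1..m}. 1 / (qs i $ j))"
    and "morrey_weight \<phi>"
    and "\<And>i. i \<in> {1..m} \<Longrightarrow> morrey_weight (\<phi>s i)"
    and "C\<^sub>0 > 0"
    and "\<And>x r. r > 0 \<Longrightarrow>
           (\<Prod>i\<in>{1..m}. \<integral>\<^sup>+ t\<in>{r<..}. ennreal (\<phi>s i x t / t) \<partial>lebesgue) \<le> ennreal (C\<^sub>0 * \<phi> x r)"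
  shows "\<exists>C::real. C > 0 \<and>
    (\<forall>f :: nat \<Rightarrow> real ^ 'n::{finite,linorder} \<Rightarrow> complex.
       (\<forall>i\<in>{1..m}. f i \<in> morrey_space (\<phi>s i) (qs i)) \<longrightarrow>
         (AE x in lebesgue. multi_maximal m f x < \<infinity>) \<and>
         (\<lambda>x. complex_of_real (enn2real (multi_maximal m f x))) \<in> morrey_space \<phi> q \<and>
         morrey_norm \<phi> q (multi_maximal m f)
           \<le> ennreal C * (\<Prod>i\<in>{1..m}. morrey_norm (\<phi>s i) (qs i) (\<lambda>x. ennreal (cmod (f i x)))))"
proof -
  let ?I = "{1..m}"
  define Q where "Q p = (\<Sum>k\<in>UNIV. 1 / p $ k)" for p :: "real ^ 'n::{finite,linorder}"
  have ne: "?I \<noteq> {}" using assms(1) by auto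
  have qs0: "qs i $ j > 0" if "i \<in> ?I" for i j using assms(2)[OF that, of j] by simp
  have q0: "q $ j > 0" for j
  proof -
    have "(\<Sum>i\<in>?I. 1 / qs i $ j) > 0" using qs0 ne by (intro sum_pos) auto
    then show ?thesis unfolding assms(3)[symmetric] by (simp add: zero_less_divide_iff)
  qed
  have \<phi>: "\<phi> x r > 0" if "r > 0" for x r using assms(4) that by (simp add: morrey_weight_def)
  have \<phi>s: "\<phi>s i x r > 0" if "i \<in> ?I" "r > 0" for i x r using assms(5)[OF that(1)] that(2) by (simp add: morrey_weight_def)
  \<comment> \<open>The scaling exponents of the factors add up to that of the target, so the powers
    of the radius match.\<close>
  have sumQ: "(\<Sum>i\<in>?I. Q (qs i)) = Q q"
    unfolding Q_def assms(3) by (rule sum.swap)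
  note mixed = mixed_norm_eq_nested_norm[of q, OF q0]
  \<comment> \<open>Packing the conclusion of \<open>ball_average_le_majorant\<close> into a
    predicate lets one constant be chosen for each \<open>i\<close> before the functions are
    given.\<close>
  define P where "P i C \<longleftrightarrow> C > 0 \<and> (\<forall>g x r. g \<in> borel_measurable borel \<longrightarrow> morrey_norm (\<phi>s i) (qs i) g < top \<longrightarrow> r > 0 \<longrightarrow>
    (\<exists>H \<in> borel_measurable borel.
      (\<forall>y\<in>ball x r. \<forall>t>0. (\<integral>\<^sup>+z\<in>ball y t. g z \<partial>lborel) / emeasure lborel (ball y t) \<le> H y) \<and>
      mixed_norm (qs i) (\<lambda>y. H y * indicator (ball x r) y)
        \<le> ennreal (C * r powr Q (qs i)) * (morrey_norm (\<phi>s i) (qs i) g * weight_tail (\<phi>s i) x r)))" for i C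
  have "\<exists>C. P i C" if i: "i \<in> ?I" for i
  proof -
    obtain C where "C > 0" "\<And>\<phi> g x r. (\<And>t. t > 0 \<Longrightarrow> \<phi> x t > 0) \<Longrightarrow> g \<in> borel_measurable borel \<Longrightarrow>
      morrey_norm \<phi> (qs i) g < top \<Longrightarrow> r > 0 \<Longrightarrow>
      \<exists>H \<in> borel_measurable borel.
        (\<forall>y\<in>ball x r. \<forall>t>0. (\<integral>\<^sup>+z\<in>ball y t. g z \<partial>lborel) / emeasure lborel (ball y t) \<le> H y) \<and>
        mixed_norm (qs i) (\<lambda>y. H y * indicator (ball x r) y)
          \<le> ennreal (C * r powr (\<Sum>k\<in>UNIV. 1 / qs i $ k)) * (morrey_norm \<phi> (qs i) g * weight_tail \<phi> x r)"
      using ball_average_le_majorant[OF assms(2)[OF i]] by blast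
    then have "P i C" unfolding P_def Q_def using \<phi>s[OF i] by blast
    then show ?thesis ..
  qed
  then obtain D where D: "\<And>i. i \<in> ?I \<Longrightarrow> P i (D i)" by metis
  have Dpos: "D i > 0" if "i \<in> ?I" for i using D[OF that] by (simp add: P_def)
  define K where "K = (\<Prod>i\<in>?I. D i) * C\<^sub>0"
  have K: "K > 0" unfolding K_def using Dpos assms(6) by (intro mult_pos_pos prod_pos) auto
  \<comment> \<open>The last factor is the ratio of \<open>r powr Q q\<close> to the lower bound
    \<open>(2 * (r / CARD('n))) powr Q q\<close> for the norm of a ball.\<close>
  define C where "C = K * (CARD('n) / 2) powr Q q"
  have "C > 0" unfolding C_def using K by simp
  moreover have "(AE x in lebesgue. multi_maximal m f x < \<infinity>) \<and>
         (\<lambda>x. complex_of_real (enn2real (multi_maximal m f x))) \<in> morrey_space \<phi> q \<and>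
         morrey_norm \<phi> q (multi_maximal m f)
           \<le> ennreal C * (\<Prod>i\<in>{1..m}. morrey_norm (\<phi>s i) (qs i) (\<lambda>x. ennreal (cmod (f i x))))"
    if f: "\<forall>i\<in>?I. f i \<in> morrey_space (\<phi>s i) (qs i)" for f
  proof -
    let ?N = "\<lambda>i. morrey_norm (\<phi>s i) (qs i) (\<lambda>x. ennreal (cmod (f i x)))"
    have "\<exists>g. g \<in> borel_measurable borel \<and> (AE y in lborel. ennreal (cmod (f i y)) = g y)" if "i \<in> ?I" for i
      using f that lebesgue_modulus_borel[of "f i"] unfolding morrey_space_def by blast
    then obtain g where g: "\<And>i. i \<in> ?I \<Longrightarrow> g i \<in> borel_measurable borel"
      and fg: "\<And>i. i \<in> ?I \<Longrightarrow> AE y in lborel. ennreal (cmod (f i y)) = g i y"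
      by metis
    have N: "?N i = morrey_norm (\<phi>s i) (qs i) (g i)" if "i \<in> ?I" for i
      by (intro morrey_norm_cong_AE qs0 that fg)
    have Nfin: "?N i < top" if "i \<in> ?I" for i
      using f that by (auto simp: morrey_space_def)
    have multi: "multi_maximal m f y = (SUP r\<in>{0<..}. \<Prod>i\<in>?I. (\<integral>\<^sup>+z\<in>ball y r. g i z \<partial>lborel) / emeasure lborel (ball y r))" for y
    proof -
      have "(\<integral>\<^sup>+z\<in>ball y r. ennreal (cmod (f i z)) \<partial>lebesgue) = (\<integral>\<^sup>+z\<in>ball y r. g i z \<partial>lborel)" if "i \<in> ?I" for i r
        unfolding nn_integral_completion using fg[OF that] by (intro nn_integral_cong_AE) (auto elim!: eventually_mono)
      then show ?thesis unfolding multi_maximal_def by (intro SUP_cong prod.cong) auto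
    qed
    \<comment> \<open>Local integrability, which the passage to rational radii requires, follows
      from the finiteness of the Morrey norms.\<close>
    have fin: "(\<integral>\<^sup>+z\<in>ball y r. g i z \<partial>lborel) < top" if i: "i \<in> ?I" for i y r
    proof (cases "r > 0")
      case True
      have "mixed_norm (qs i) (\<lambda>z. g i z * indicator (ball y r) z) < top"
        using mixed_norm_le_morrey_norm[where p = "qs i" and F = "g i" and \<phi> = "\<phi>s i" and x = y and r = r, OF qs0[OF i] True \<phi>s[OF i True]] Nfin[OF i]
        unfolding N[OF i] by (auto simp: ennreal_mult_less_top elim!: le_less_trans)
      then show ?thesis
        using nn_integral_le_nested_norm[where q = "qs i" and F = "g i" and c = y and r = r and x = 0, OF assms(2)[OF i] coords g[OF i] True]
        unfolding mixed_norm_eq_nested_norm[of "qs i", OF qs0[OF i]] by (auto simp: ennreal_mult_less_top elim!: le_less_trans)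
    qed (simp add: ball_empty)
    have meas: "multi_maximal m f \<in> borel_measurable borel"
    proof -
      have mm: "multi_maximal m f y = (SUP r\<in>{0<..} \<inter> \<rat>. \<Prod>i\<in>?I. (\<integral>\<^sup>+z\<in>ball y r. g i z \<partial>lborel) / emeasure lborel (ball y r))" for y
        unfolding multi by (intro SUP_ball_average_rational g fin) auto
      \<comment> \<open>The volume does not depend on the centre, so only the numerators vary with
        \<open>y\<close>.\<close>
      have vol: "emeasure lborel (ball y r) = emeasure lborel (ball (0 :: real ^ 'n::{finite,linorder}) r)" if "r > 0" for y :: "real ^ 'n::{finite,linorder}" and r
        using that by (simp add: emeasure_ball)
      have eq: "multi_maximal m f = (\<lambda>y. SUP r\<in>{0<..} \<inter> \<rat>. \<Prod>i\<in>?I. (\<integral>\<^sup>+z\<in>ball y r. g i z \<partial>lborel) / emeasure lborel (ball (0 :: real ^ 'n::{finite,linorder}) r))"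
        unfolding mm by (intro ext SUP_cong prod.cong refl arg_cong2[where f = "(/)"] vol) auto
      show ?thesis
        unfolding eq
        by (intro borel_measurable_SUP borel_measurable_prod_ennreal borel_measurable_divide_ennreal measurable_ball_integral g borel_measurable_const)
           (auto intro: countable_subset[OF _ countable_rat])
    qed
    have main: "mixed_norm q (\<lambda>y. multi_maximal m f y * indicator (ball x r) y)
       \<le> ennreal (K * r powr Q q * \<phi> x r) * (\<Prod>i\<in>?I. ?N i)" if r: "r > 0" for x r
    proof -
      define R where "R i H \<longleftrightarrow> H \<in> borel_measurable borel \<and>
        (\<forall>y\<in>ball x r. \<forall>t>0. (\<integral>\<^sup>+z\<in>ball y t. g i z \<partial>lborel) / emeasure lborel (ball y t) \<le> H y) \<and>
        mixed_norm (qs i) (\<lambda>y. H y * indicator (ball x r) y)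
          \<le> ennreal (D i * r powr Q (qs i)) * (?N i * weight_tail (\<phi>s i) x r)" for i H
      have "\<exists>H. R i H" if "i \<in> ?I" for i
        using D[OF that] g[OF that] Nfin[OF that] r unfolding P_def R_def N[OF that] by blast
      then obtain H where HR: "\<And>i. i \<in> ?I \<Longrightarrow> R i (H i)" by metis
      have H: "H i \<in> borel_measurable borel"
        "\<And>y t. y \<in> ball x r \<Longrightarrow> t > 0 \<Longrightarrow> (\<integral>\<^sup>+z\<in>ball y t. g i z \<partial>lborel) / emeasure lborel (ball y t) \<le> H i y"
        "mixed_norm (qs i) (\<lambda>y. H i y * indicator (ball x r) y)
          \<le> ennreal (D i * r powr Q (qs i)) * (?N i * weight_tail (\<phi>s i) x r)" if "i \<in> ?I" for i
        using HR[OF that] unfolding R_def by blast+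
      have [measurable]: "ball x r \<in> sets borel" by simp
      \<comment> \<open>The bounds \<open>H i\<close> are free of the radius, so the supremum
        disappears; the indicator is repeated in every factor so that each gets its own localized
        norm.\<close>
      have "mixed_norm q (\<lambda>y. multi_maximal m f y * indicator (ball x r) y)
        \<le> mixed_norm q (\<lambda>y. \<Prod>i\<in>?I. H i y * indicator (ball x r) y)"
      proof (intro mixed_norm_mono q0)
        fix y show "multi_maximal m f y * indicator (ball x r) y \<le> (\<Prod>i\<in>?I. H i y * indicator (ball x r) y)"
        proof (cases "y \<in> ball x r")
          case True
          then show ?thesis
            unfolding multi using H(2) by (auto intro!: SUP_least prod_mono_ennreal)
        qed simp
      qed
      also have "\<dots> \<le> (\<Prod>i\<in>?I. mixed_norm (qs i) (\<lambda>y. H i y * indicator (ball x r) y))"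
      proof -
        have "nested_norm q coords (\<lambda>y. \<Prod>i\<in>?I. H i y * indicator (ball x r) y) 0
          \<le> (\<Prod>i\<in>?I. nested_norm (qs i) coords (\<lambda>y. H i y * indicator (ball x r) y) 0)"
          using H(1) by (intro nested_norm_Holder qs0 q0 assms(3) ne) auto
        then show ?thesis
          unfolding mixed by (simp add: mixed_norm_eq_nested_norm[OF qs0])
      qed
      also have "\<dots> \<le> (\<Prod>i\<in>?I. ennreal (D i * r powr Q (qs i)) * (?N i * weight_tail (\<phi>s i) x r))"
        by (intro prod_mono_ennreal H(3))
      also have "\<dots> = ennreal ((\<Prod>i\<in>?I. D i) * r powr Q q) * (\<Prod>i\<in>?I. ?N i) * (\<Prod>i\<in>?I. weight_tail (\<phi>s i) x r)"
      proof -
        have "(\<Prod>i\<in>?I. ennreal (D i * r powr Q (qs i))) = ennreal (\<Prod>i\<in>?I. D i * r powr Q (qs i))"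
          by (intro prod_ennreal mult_nonneg_nonneg less_imp_le[OF Dpos] powr_ge_zero)
        also have "(\<Prod>i\<in>?I. D i * r powr Q (qs i)) = (\<Prod>i\<in>?I. D i) * r powr Q q"
          using r by (simp add: prod.distrib powr_sum flip: sumQ)
        finally show ?thesis by (simp add: prod.distrib mult.assoc)
      qed
      also have "\<dots> \<le> ennreal ((\<Prod>i\<in>?I. D i) * r powr Q q) * (\<Prod>i\<in>?I. ?N i) * ennreal (C\<^sub>0 * \<phi> x r)"
        unfolding weight_tail_def by (intro mult_left_mono assms(7) r) auto
      also have "\<dots> = ennreal ((\<Prod>i\<in>?I. D i) * r powr Q q * (C\<^sub>0 * \<phi> x r)) * (\<Prod>i\<in>?I. ?N i)"
        using \<phi>[OF r, of x] assms(6) by (subst (2) ennreal_mult'') (auto simp: mult_ac)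
      also have "(\<Prod>i\<in>?I. D i) * r powr Q q * (C\<^sub>0 * \<phi> x r) = K * r powr Q q * \<phi> x r"
        by (simp add: K_def)
      finally show ?thesis .
    qed
    have Nprod: "(\<Prod>i\<in>?I. ?N i) < top"
    proof -
      have "?N i \<noteq> top" if "i \<in> ?I" for i using Nfin[OF that] by simp
      then have "(\<Prod>i\<in>?I. ?N i) \<noteq> top" unfolding ennreal_prod_eq_top by blast
      then show ?thesis by (simp only: less_top)
    qed
    have norm: "morrey_norm \<phi> q (multi_maximal m f) \<le> ennreal C * (\<Prod>i\<in>?I. ?N i)"
      unfolding morrey_norm_def[of \<phi> q]
    proof (intro SUP_least)
      fix x :: "real ^ 'n::{finite,linorder}" and r :: real assume "r \<in> {0<..}"
      then have r: "r > 0" by simp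
      let ?b = "mixed_norm q (indicator (ball x r))" and ?l = "(2 * (r / CARD('n))) powr Q q"
      have l: "?l > 0" using r by simp
      have lb: "ennreal ?l \<le> ?b" "?b \<noteq> top"
        unfolding Q_def by (rule mixed_norm_ball[OF q0 r])+
      then obtain v where v: "?b = ennreal v" "?l \<le> v" by (cases ?b) auto
      have "v > 0" using l v(2) by (rule less_le_trans)
      then have "inverse ?b = ennreal (1 / v)"
        unfolding v(1) by (simp add: inverse_ennreal inverse_eq_divide)
      also have "\<dots> \<le> ennreal (1 / ?l)"
        using l v(2) by (intro ennreal_leI frac_le) auto
      finally have b: "inverse ?b \<le> ennreal (1 / ?l)" .
      have "inverse (ennreal (\<phi> x r)) * inverse ?b * mixed_norm q (\<lambda>y. multi_maximal m f y * indicator (ball x r) y)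
        \<le> ennreal (1 / \<phi> x r) * ennreal (1 / ?l) * (ennreal (K * r powr Q q * \<phi> x r) * (\<Prod>i\<in>?I. ?N i))"
        using \<phi>[OF r, of x] by (intro mult_mono main r b) (auto simp: inverse_ennreal inverse_eq_divide)
      also have "\<dots> = ennreal (1 / \<phi> x r * (1 / ?l) * (K * r powr Q q * \<phi> x r)) * (\<Prod>i\<in>?I. ?N i)"
      proof -
        have e: "ennreal (a * b * c) = ennreal a * ennreal b * ennreal c" if "b \<ge> 0" "c \<ge> 0" for a b c
          using that by (simp add: ennreal_mult'')
        have "0 \<le> 1 / ?l" "0 \<le> K * r powr Q q * \<phi> x r"
          using \<phi>[OF r, of x] K by simp_all
        then show ?thesis unfolding e[OF \<open>0 \<le> 1 / ?l\<close> \<open>0 \<le> K * r powr Q q * \<phi> x r\<close>] by (simp only: mult.assoc)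
      qed
      also have "1 / \<phi> x r * (1 / ?l) * (K * r powr Q q * \<phi> x r) = C"
      proof -
        have "r powr Q q = ?l * (CARD('n) / 2) powr Q q"
          using r by (subst powr_mult[symmetric]) auto
        then show ?thesis using \<phi>[OF r, of x] l by (simp add: C_def)
      qed
      finally show "inverse (ennreal (\<phi> x r)) * inverse ?b * mixed_norm q (\<lambda>y. multi_maximal m f y * indicator (ball x r) y)
        \<le> ennreal C * (\<Prod>i\<in>?I. ?N i)" .
    qed
    \<comment> \<open>Finiteness almost everywhere is obtained on each of countably many balls that
      cover the space; \<open>Suc k\<close> keeps the radius positive.\<close>
    have "AE x in lborel. \<forall>k::nat. multi_maximal m f x * indicator (ball 0 (Suc k)) x < top"
    proof (intro AE_all_countable[THEN iffD2] allI)
      fix k :: nat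
      have "mixed_norm q (\<lambda>y. multi_maximal m f y * indicator (ball 0 (Suc k)) y) < top"
        by (rule le_less_trans[OF main]) (use Nprod in \<open>auto simp: ennreal_mult_less_top\<close>)
      then show "AE x in lborel. multi_maximal m f x * indicator (ball 0 (Suc k)) x < top"
        unfolding mixed
        by (rule nested_norm_finite_imp_AE[OF q0 coords, rotated])
           (intro borel_measurable_times_ennreal meas borel_measurable_indicator, simp)
    qed
    then have ae: "AE x in lborel. multi_maximal m f x < \<infinity>"
    proof eventually_elim
      case (elim x)
      obtain k :: nat where "norm x < k" using reals_Archimedean2 by blast
      then have "x \<in> ball 0 (Suc k)" by simp
      then show ?case using elim[rule_format, of k] by simp
    qed
    have "(\<lambda>x. complex_of_real (enn2real (multi_maximal m f x))) \<in> borel_measurable lebesgue"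
      using meas by (intro measurable_completion) measurable
    moreover have "morrey_norm \<phi> q (\<lambda>x. ennreal (cmod (complex_of_real (enn2real (multi_maximal m f x))))) < \<infinity>"
    proof -
      \<comment> \<open>\<open>enn2real\<close> sends \<open>\<infinity>\<close> to
        \<open>0\<close>, so the finite-valued version lies below the maximal function
        everywhere.\<close>
      have "morrey_norm \<phi> q (\<lambda>x. ennreal (cmod (complex_of_real (enn2real (multi_maximal m f x))))) \<le> morrey_norm \<phi> q (multi_maximal m f)"
        by (intro morrey_norm_mono q0) (simp add: ennreal_enn2real_if)
      also have "\<dots> \<le> ennreal C * (\<Prod>i\<in>?I. ?N i)" by (rule norm)
      also have "\<dots> < \<infinity>" using Nprod by (simp add: ennreal_mult_less_top)
      finally show ?thesis .
    qed
    ultimately show ?thesis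
      using norm ae by (auto simp: morrey_space_def AE_completion_iff)
  qed
  ultimately show ?thesis by blast
qed

end
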